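(* Let $k\ge 1$ and $d_1,\dots,d_k\ge 1$ be fixed integers. For every $l\ge 1$ and $j=1,\dots,k$ let $f_l^{(j)}\in\mathfrak{H}^{\odot d_j}$, and set $$\mathbf{I}(l)=\big(I_{d_1}(f_l^{(1)}),\dots,I_{d_k}(f_l^{(k)})\big),\qquad l\ge 1.$$ Assume that there exists $\eta>0$ such that $\|f_l^{(j)}\|_{\mathfrak{H}^{\otimes d_j}}\ge \eta$ for every $j=1,\dots,k$ and every $l\ge 1$, and that for every $j=1,\dots,k$ the sequence $\mathbb{E}[I_{d_j}(f_l^{(j)})^2]=d_j!\,\|f_l^{(j)}\|_{\mathfrak{H}^{\otimes d_j}}^2$, $l\ge 1$, is bounded. For every $l\geq 1$ let $\mathbf{N}(l)=(N_l^{(1)},\dots,N_l^{(k)})$ be a centered $k$-dimensional Gaussian vector with the same covariance matrix as $\mathbf{I}(l)$, i.e. $\mathbb{E}[N_l^{(i)}N_l^{(j)}]=\mathbb{E}[I_{d_i}(f_l^{(i)})I_{d_j}(f_l^{(j)})]$ for all $1\le i,j\le k$. Suppose that for every $j=1,\dots,k$ and every $p=1,\dots,d_j-1$, $$\big\|f_l^{(j)}\otimes_p f_l^{(j)}\big\|_{\mathfrak{H}^{\otimes 2(d_j-p)}}\to 0\quad\text{as } l\to+\infty .$$ Then, for every compact set $M\subset\mathbb{R}^k$, as $l\to+\infty$, $$\sup_{\lambda\in M}\Big|\mathbb{E}\big[\exp(\mathrm{i}\langle\lambda,\mathbf{I}(l)\rangle_k)\big]-\mathbb{E}\big[\exp(\mathrm{i}\langle\lambda,\mathbf{N}(l)\rangle_k)\big]\Big|\to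 0,$$ where, for $\lambda=(\lambda_1,\dots,\lambda_k)\in\mathbb{R}^k$, $\langle\lambda,\mathbf{I}(l)\rangle_k=\sum_{j=1}^k\lambda_j I_{d_j}(f_l^{(j)})$ and $\langle\lambda,\mathbf{N}(l)\rangle_k=\sum_{j=1}^k\lambda_j N_l^{(j)}$.
   Context: $\mathfrak{H}$ is a real separable Hilbert space; $\mathfrak{H}^{\otimes d}$ is its $d$th tensor product and $\mathfrak{H}^{\odot d}$ its $d$th symmetric tensor product, regarded as the subspace of symmetric elements of $\mathfrak{H}^{\otimes d}$ (with $\mathfrak{H}^{\otimes 1}=\mathfrak{H}^{\odot 1}=\mathfrak{H}$). $X=\{X(h):h\in\mathfrak{H}\}$ is an isonormal Gaussian process over $\mathfrak{H}$: a family of centered jointly Gaussian real random variables on a probability space $(\Omega,\mathcal{F},\mathbb{P})$ with $\mathbb{E}[X(h)X(h')]=\langle h,h'\rangle_{\mathfrak{H}}$. For $d\ge1$, $I_d$ is the canonical isometry between $\mathfrak{H}^{\odot d}$ equipped with the norm $\sqrt{d!}\,\|\cdot\|_{\mathfrak{H}^{\otimes d}}$ and the $d$th Wiener chaos of $X$ (the linear isometry with $I_d(h^{\otimes d})=H_d(X(h))$ for $\|h\|_{\mathfrak{H}}=1$, $H_d$ being the $d$th monic Hermite polynomial); when $\mathfrak{H}=L^2(A,\mathcal{A},\mu)$ with $\mu$ $\sigma$-finite and non-atomic, $I_d(f)$ is the multiple Wiener-Itô integral of order $d$. Contractions: let $\{e_i:i\ge1\}$ be a complete orthonormal system of $\mathfrak{H}$.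 For $f\in\mathfrak{H}^{\odot n}$, $g\in\mathfrak{H}^{\odot m}$ and $p\in\{0,\dots,n\wedge m\}$, the $p$th contraction is the element of $\mathfrak{H}^{\otimes (n+m-2p)}$ given by $$f\otimes_p g=\sum_{i_1,\dots,i_p=1}^\infty \langle f,e_{i_1}\otimes\cdots\otimes e_{i_p}\rangle_{\mathfrak{H}^{\otimes p}}\otimes\langle g,e_{i_1}\otimes\cdots\otimes e_{i_p}\rangle_{\mathfrak{H}^{\otimes p}}$$ (it need not be symmetric). For $d_j=1$ the condition on contractions is vacuous. *)

theory Defs
  imports "HOL-Probability.Probability"
begin

section \<open>Hilbert tensor powers\<close>

text \<open>
  The Hilbert tensor power of order n of a real Hilbert space is realised as the space of bounded
  n-linear forms with square summable coefficients in a complete orthonormal system B.  The tensor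
  T is identified with the form that maps [x_1, ..., x_n] to the inner product of T with the
  elementary tensor of x_1, ..., x_n; by Parseval neither the space nor its norm depends on B.
  For n = 1 the Riesz representation theorem gives back the Hilbert space.
  Forms are extended by 0 to lists whose length is not n.
  B is a set, not a sequence, so that finite dimensional Hilbert spaces are included.
\<close>

type_synonym 'h tensor = "'h list \<Rightarrow> real"

definition complete_orthonormal :: "'h::real_inner set \<Rightarrow> bool" where
  "complete_orthonormal B \<longleftrightarrow>
     pairwise orthogonal B \<and> (\<forall>b\<in>B. norm b = 1) \<and> closure (span B) = UNIV"

definition tuples :: "'h set \<Rightarrow> nat \<Rightarrow> 'h list set" where
  "tuples B n = {bs. length bs = n \<and> set bs \<subseteq> B}"

definition multilinear_form :: "nat \<Rightarrow> 'h::real_inner tensor \<Rightarrow> bool" where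
  "multilinear_form n T \<longleftrightarrow>
     (\<forall>xs. length xs \<noteq> n \<longrightarrow> T xs = 0) \<and>
     (\<forall>xs i. length xs = n \<longrightarrow> i < n \<longrightarrow> linear (\<lambda>x. T (xs[i := x])))"

definition tensor_power :: "'h::real_inner set \<Rightarrow> nat \<Rightarrow> 'h tensor set" where
  "tensor_power B n = {T. multilinear_form n T \<and>
     (\<exists>C. \<forall>xs. length xs = n \<longrightarrow> \<bar>T xs\<bar> \<le> C * prod_list (map norm xs)) \<and>
     (\<lambda>bs. (T bs)\<^sup>2) summable_on tuples B n}"

definition tensor_norm :: "'h::real_inner set \<Rightarrow> nat \<Rightarrow> 'h tensor \<Rightarrow> real" where
  "tensor_norm B n T = sqrt (\<Sum>\<^sub>\<infinity>bs\<in>tuples B n. (T bs)\<^sup>2)"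

definition symmetric_tensor_power :: "'h::real_inner set \<Rightarrow> nat \<Rightarrow> 'h tensor set" where
  "symmetric_tensor_power B n =
     {T \<in> tensor_power B n. \<forall>xs ys. mset xs = mset ys \<longrightarrow> T xs = T ys}"

definition elementary_tensor :: "'h::real_inner list \<Rightarrow> 'h tensor" where
  "elementary_tensor hs =
     (\<lambda>xs. if length xs = length hs then \<Prod>i<length hs. (hs ! i) \<bullet> (xs ! i) else 0)"

text \<open>
  The partial inner product of T with the elementary tensor of bs, and the product S \<otimes> T for S of
  order n.
\<close>

definition partial_inner :: "'h tensor \<Rightarrow> 'h list \<Rightarrow> 'h tensor" where
  "partial_inner T bs = (\<lambda>xs. T (bs @ xs))"

definition tensor_product :: "nat \<Rightarrow> 'h tensor \<Rightarrow> 'h tensor \<Rightarrow> 'h tensor" where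
  "tensor_product n S T = (\<lambda>xs. S (take n xs) * T (drop n xs))"

text \<open>The p-th contraction of f, of order n, with g.\<close>

definition contraction :: "'h::real_inner set \<Rightarrow> nat \<Rightarrow> nat \<Rightarrow> 'h tensor \<Rightarrow> 'h tensor \<Rightarrow> 'h tensor" where
  "contraction B n p f g =
     (\<lambda>xs. \<Sum>\<^sub>\<infinity>bs\<in>tuples B p. tensor_product (n - p) (partial_inner f bs) (partial_inner g bs) xs)"

section \<open>Gaussian families and isonormal processes\<close>

text \<open>Gaussian laws may be degenerate: standard deviation 0 gives a point mass.\<close>

definition normal_law :: "real \<Rightarrow> real \<Rightarrow> real measure" where
  "normal_law m s =
     (if s = 0 then return borel m else density lborel (\<lambda>x. ennreal (normal_density m s x)))"

definition jointly_gaussian :: "'w measure \<Rightarrow> ('i \<Rightarrow> 'w \<Rightarrow> real) \<Rightarrow> bool" where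
  "jointly_gaussian M Y \<longleftrightarrow>
     (\<forall>F c. finite F \<longrightarrow>
        (\<lambda>w. \<Sum>i\<in>F. c i * Y i w) \<in> borel_measurable M \<and>
        (\<exists>m s. s \<ge> 0 \<and> distr M borel (\<lambda>w. \<Sum>i\<in>F. c i * Y i w) = normal_law m s))"

definition centered_jointly_gaussian :: "'w measure \<Rightarrow> ('i \<Rightarrow> 'w \<Rightarrow> real) \<Rightarrow> bool" where
  "centered_jointly_gaussian M Y \<longleftrightarrow>
     jointly_gaussian M Y \<and> (\<forall>i. (LINT w|M. Y i w) = 0)"

definition isonormal_process :: "'w measure \<Rightarrow> ('h::real_inner \<Rightarrow> 'w \<Rightarrow> real) \<Rightarrow> bool" where
  "isonormal_process M X \<longleftrightarrow>
     centered_jointly_gaussian M X \<and> (\<forall>h g. (LINT w|M. X h w * X g w) = h \<bullet> g)"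

section \<open>Wiener chaos and multiple integrals\<close>

fun hermite :: "nat \<Rightarrow> real \<Rightarrow> real" where
  "hermite 0 x = 1"
| "hermite (Suc 0) x = x"
| "hermite (Suc (Suc n)) x = x * hermite (Suc n) x - real (Suc n) * hermite n x"

text \<open>The closed linear span in L^2(M) of the variables hermite n (X h) with norm h = 1.\<close>

definition wiener_chaos :: "'w measure \<Rightarrow> ('h::real_inner \<Rightarrow> 'w \<Rightarrow> real) \<Rightarrow> nat \<Rightarrow> ('w \<Rightarrow> real) set" where
  "wiener_chaos M X n =
     {Y \<in> borel_measurable M. integrable M (\<lambda>w. (Y w)\<^sup>2) \<and>
        (\<forall>\<epsilon>>0. \<exists>F c. finite F \<and> (\<forall>h\<in>F. norm h = 1) \<and>
           (LINT w|M. (Y w - (\<Sum>h\<in>F. c h * hermite n (X h w)))\<^sup>2) < \<epsilon>)}"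

text \<open>
  I is the canonical isometry from the symmetric tensor power of order n, with the norm
  sqrt (fact n) * tensor_norm B n, onto the n-th Wiener chaos.  The value I f is a representative
  of an element of L^2(M), hence equalities hold almost everywhere; up to null sets I f is uniquely
  determined by these conditions.
\<close>

definition wiener_isometry ::
  "'w measure \<Rightarrow> ('h::real_inner \<Rightarrow> 'w \<Rightarrow> real) \<Rightarrow> 'h set \<Rightarrow> nat \<Rightarrow> ('h tensor \<Rightarrow> 'w \<Rightarrow> real) \<Rightarrow> bool" where
  "wiener_isometry M X B n I \<longleftrightarrow>
     (\<forall>f\<in>symmetric_tensor_power B n. I f \<in> wiener_chaos M X n) \<and>
     (\<forall>Y\<in>wiener_chaos M X n. \<exists>f\<in>symmetric_tensor_power B n. AE w in M. Y w = I f w) \<and>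
     (\<forall>f\<in>symmetric_tensor_power B n. \<forall>g\<in>symmetric_tensor_power B n. \<forall>a b.
        AE w in M. I (\<lambda>xs. a * f xs + b * g xs) w = a * I f w + b * I g w) \<and>
     (\<forall>f\<in>symmetric_tensor_power B n.
        (LINT w|M. (I f w)\<^sup>2) = (sqrt (fact n) * tensor_norm B n f)\<^sup>2) \<and>
     (\<forall>h. norm h = 1 \<longrightarrow>
        (AE w in M. I (elementary_tensor (replicate n h)) w = hermite n (X h w)))"

end

theory Submission
  imports Defs
begin

text \<open>
  By the definition of the Wiener chaos, each kernel is approximated by a finite sum of powers \<open>c h * h \<otimes> ... \<otimes> h\<close>
  with unit vectors \<open>h\<close>, and its integral by the Hermite sum \<open>F = (\<Sum>h. c h * hermite d (X h))\<close>.
  Gaussian integration by parts turns the derivative of the characteristic function of \<open>\<Sum>j. \<xi> j * F j\<close> along a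
  ray into an expectation against the products \<open>\<Gamma> i j\<close> of Malliavin derivatives, so that the distance to the
  Gaussian characteristic function is at most the sum of the standard deviations of the \<open>\<Gamma> i j\<close>, up to
  the coefficients.  The variance of \<open>\<Gamma> i j\<close> is a sum over diagrams on four vertices.  By the
  Cauchy-Schwarz inequality in coordinates each diagram that is not part of the squared mean is
  dominated by contractions of each kernel with itself, at least one of which is a proper one.
\<close>

section \<open>Variables with moments of all orders\<close>

text \<open>Integration by parts is available for Hermite sums in finitely many variables, whereas
  the hypothesis concerns contractions of the limit kernels. The two sides meet in coordinates: for
  a finite \<open>S\<close> inside \<open>B\<close>, powers of inner products open into sums over
  tuples of \<open>S\<close>, and all estimates are uniform in \<open>S\<close>, so \<open>S\<close>
  may grow to \<open>B\<close>. The Hermite sum chosen at stage \<open>l\<close> has mean square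
  error at most \<open>(1 / l)\<^sup>2\<close>; hence there is no second limit, and tightness never
  enters. In every diagram the row sums force as many edges 12 as 34 and as many edges 14 as 23;
  this symmetry lets Cauchy-Schwarz turn the edges 14 and 23 into edges inside one kernel. Pairs of
  components of different order obey the same estimate: their mean product is 0, and all their
  diagrams cross. Joint Gaussianity is given through linear combinations only, so joint laws have to
  be recovered from one-dimensional characteristic functions before integration by parts can be
  derived from an independent splitting.\<close>

definition all_moments :: "'w measure \<Rightarrow> ('w \<Rightarrow> real) \<Rightarrow> bool" where
  "all_moments M Y \<longleftrightarrow> Y \<in> borel_measurable M \<and> (\<forall>n. integrable M (\<lambda>w. \<bar>Y w\<bar> ^ n))"

lemma all_moments_measurable: "all_moments M Y \<Longrightarrow> Y \<in> borel_measurable M"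
  by (simp add: all_moments_def)

lemma all_moments_integrable: "all_moments M Y \<Longrightarrow> integrable M Y"
proof -
  assume a: "all_moments M Y"
  then have "integrable M (\<lambda>w. \<bar>Y w\<bar> ^ 1)" unfolding all_moments_def by (elim conjE allE)
  from Bochner_Integration.integrable_bound[OF this all_moments_measurable[OF a]] show ?thesis by simp
qed

lemma all_moments_bound:
  assumes "all_moments M Z" "Y \<in> borel_measurable M" "\<And>w. w \<in> space M \<Longrightarrow> \<bar>Y w\<bar> \<le> \<bar>Z w\<bar>"
  shows "all_moments M Y"
  unfolding all_moments_def
proof (intro conjI allI)
  fix n
  show "integrable M (\<lambda>w. \<bar>Y w\<bar> ^ n)"
    by (rule Bochner_Integration.integrable_bound[of M "\<lambda>w. \<bar>Z w\<bar> ^ n"])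
      (use assms in \<open>auto simp: all_moments_def simp del: power_abs intro!: AE_I2 power_mono\<close>)
qed (use assms in auto)

lemma all_moments_add:
  assumes "all_moments M Y" "all_moments M Z"
  shows "all_moments M (\<lambda>w. Y w + Z w)"
proof -
  have m[measurable]: "Y \<in> borel_measurable M" "Z \<in> borel_measurable M"
    using assms by (auto simp: all_moments_def)
  have "integrable M (\<lambda>w. \<bar>Y w + Z w\<bar> ^ n)" for n
  proof (rule Bochner_Integration.integrable_bound)
    show "integrable M (\<lambda>w. 2 ^ n * (\<bar>Y w\<bar> ^ n + \<bar>Z w\<bar> ^ n))"
      using assms by (auto simp: all_moments_def)
    have "\<bar>y + z\<bar> ^ n \<le> 2 ^ n * (\<bar>y\<bar> ^ n + \<bar>z\<bar> ^ n)" for y z :: real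
    proof -
      have "\<bar>y + z\<bar> ^ n \<le> (2 * max \<bar>y\<bar> \<bar>z\<bar>) ^ n" by (intro power_mono) auto
      also have "\<dots> = 2 ^ n * (max \<bar>y\<bar> \<bar>z\<bar>) ^ n" by (simp add: power_mult_distrib)
      also have "\<dots> \<le> 2 ^ n * (\<bar>y\<bar> ^ n + \<bar>z\<bar> ^ n)"
        by (intro mult_left_mono) (auto simp: max_def)
      finally show ?thesis .
    qed
    from this[of "Y w" "Z w" for w] show "AE w in M. norm (\<bar>Y w + Z w\<bar> ^ n) \<le> norm (2 ^ n * (\<bar>Y w\<bar> ^ n + \<bar>Z w\<bar> ^ n))"
      by (intro AE_I2) simp
  qed measurable
  then show ?thesis unfolding all_moments_def by auto
qed

lemma all_moments_mult:
  assumes "all_moments M Y" "all_moments M Z"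
  shows "all_moments M (\<lambda>w. Y w * Z w)"
proof -
  have m[measurable]: "Y \<in> borel_measurable M" "Z \<in> borel_measurable M"
    using assms by (auto simp: all_moments_def)
  have "integrable M (\<lambda>w. \<bar>Y w * Z w\<bar> ^ n)" for n
  proof (rule Bochner_Integration.integrable_bound)
    show "integrable M (\<lambda>w. \<bar>Y w\<bar> ^ (2 * n) + \<bar>Z w\<bar> ^ (2 * n))"
      using assms by (intro Bochner_Integration.integrable_add) (simp_all add: all_moments_def del: power_abs)
    have "\<bar>y * z\<bar> ^ n \<le> \<bar>y\<bar> ^ (2 * n) + \<bar>z\<bar> ^ (2 * n)" for y z :: real
    proof -
      have "2 * (\<bar>y\<bar> ^ n * \<bar>z\<bar> ^ n) \<le> (\<bar>y\<bar> ^ n)\<^sup>2 + (\<bar>z\<bar> ^ n)\<^sup>2"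
        using sum_squares_bound[of "\<bar>y\<bar> ^ n" "\<bar>z\<bar> ^ n"] by (simp add: mult.assoc)
      moreover have "0 \<le> \<bar>y\<bar> ^ n * \<bar>z\<bar> ^ n" by simp
      moreover have "(\<bar>y\<bar> ^ n)\<^sup>2 = \<bar>y\<bar> ^ (2 * n)" "(\<bar>z\<bar> ^ n)\<^sup>2 = \<bar>z\<bar> ^ (2 * n)"
        by (simp_all only: power_mult[symmetric] mult.commute[of 2])
      ultimately show ?thesis unfolding abs_mult power_mult_distrib by linarith
    qed
    from this[of "Y w" "Z w" for w] show "AE w in M. norm (\<bar>Y w * Z w\<bar> ^ n) \<le> norm (\<bar>Y w\<bar> ^ (2 * n) + \<bar>Z w\<bar> ^ (2 * n))"
      by (intro AE_I2) simp
  qed measurable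
  then show ?thesis unfolding all_moments_def by auto
qed

lemma (in prob_space) all_moments_const: "all_moments M (\<lambda>_. c)"
  by (simp add: all_moments_def)

lemma (in prob_space) all_moments_cmult: "all_moments M Y \<Longrightarrow> all_moments M (\<lambda>w. c * Y w)"
  by (intro all_moments_mult all_moments_const)

lemma (in prob_space) all_moments_sum:
  "(\<And>i. i \<in> F \<Longrightarrow> all_moments M (Y i)) \<Longrightarrow> all_moments M (\<lambda>w. \<Sum>i\<in>F. Y i w)"
  by (induction F rule: infinite_finite_induct) (simp_all add: all_moments_add all_moments_const)

lemma (in prob_space) all_moments_power: "all_moments M Y \<Longrightarrow> all_moments M (\<lambda>w. Y w ^ n)"
  by (induction n) (simp_all add: all_moments_mult all_moments_const)

lemma all_moments_diff:
  assumes "all_moments M Y" "all_moments M Z"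
  shows "all_moments M (\<lambda>w. Y w - Z w)"
proof -
  have "all_moments M (\<lambda>w. - Z w)" using assms(2) by (simp add: all_moments_def)
  from all_moments_add[OF assms(1) this] show ?thesis by simp
qed

lemma (in prob_space) cauchy_schwarz:
  assumes Y: "Y \<in> borel_measurable M" "integrable M (\<lambda>w. (Y w)\<^sup>2)"
    and Z: "Z \<in> borel_measurable M" "integrable M (\<lambda>w. (Z w)\<^sup>2)"
  shows "integrable M (\<lambda>w. Y w * Z w)"
    and "\<bar>LINT w|M. Y w * Z w\<bar> \<le> sqrt (LINT w|M. (Y w)\<^sup>2) * sqrt (LINT w|M. (Z w)\<^sup>2)"
proof -
  note [measurable] = Y(1) Z(1)
  have b: "\<bar>y * z\<bar> \<le> y\<^sup>2 + z\<^sup>2" for y z :: real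
    using sum_squares_bound[of "\<bar>y\<bar>" "\<bar>z\<bar>"] abs_ge_zero[of "y * z"] unfolding power2_abs abs_mult by linarith
  show i: "integrable M (\<lambda>w. Y w * Z w)"
    by (rule Bochner_Integration.integrable_bound[OF Bochner_Integration.integrable_add[OF Y(2) Z(2)]])
      (auto intro!: AE_I2 order_trans[OF b])
  define a where "a = (LINT w|M. (Y w)\<^sup>2)"
  define b where "b = (LINT w|M. (Z w)\<^sup>2)"
  define c where "c = (LINT w|M. Y w * Z w)"
  have a0: "a \<ge> 0" and b0: "b \<ge> 0" unfolding a_def b_def by simp_all
  have q: "0 \<le> s\<^sup>2 * a - 2 * s * t * c + t\<^sup>2 * b" for s t
  proof -
    have "0 \<le> (LINT w|M. (s * Y w - t * Z w)\<^sup>2)" by simp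
    also have "\<dots> = (LINT w|M. s\<^sup>2 * (Y w)\<^sup>2 - 2 * s * t * (Y w * Z w) + t\<^sup>2 * (Z w)\<^sup>2)"
      by (intro Bochner_Integration.integral_cong) (auto simp: power2_eq_square algebra_simps)
    also have "\<dots> = s\<^sup>2 * a - 2 * s * t * c + t\<^sup>2 * b"
      unfolding a_def b_def c_def using Y Z i by simp
    finally show ?thesis .
  qed
  have "c\<^sup>2 \<le> a * b"
  proof (cases "b = 0")
    case True
    have "c = 0"
    proof (rule ccontr)
      assume "c \<noteq> 0"
      \<comment> \<open>With \<open>b = 0\<close> the form at \<open>s = 1\<close> is affine in
        \<open>t\<close>; this \<open>t\<close> brings it to -1.\<close>
      have "2 * ((a + 1) / (2 * c)) * c = a + 1" using \<open>c \<noteq> 0\<close> by simp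
      with q[of 1 "(a + 1) / (2 * c)"] show False using True by simp
    qed
    then show ?thesis using True by simp
  next
    case False
    \<comment> \<open>At \<open>s = b\<close>, \<open>t = c\<close> the form is \<open>b\<close>
      times the determinant \<open>a * b - c\<^sup>2\<close>.\<close>
    from q[of b c] have "0 \<le> b * (a * b - c\<^sup>2)" by (simp add: power2_eq_square algebra_simps)
    then show ?thesis using False b0 by (simp add: zero_le_mult_iff)
  qed
  then have "sqrt (c\<^sup>2) \<le> sqrt (a * b)" by (rule real_sqrt_le_mono)
  then show "\<bar>LINT w|M. Y w * Z w\<bar> \<le> sqrt (LINT w|M. (Y w)\<^sup>2) * sqrt (LINT w|M. (Z w)\<^sup>2)"
    unfolding a_def b_def c_def by (simp add: real_sqrt_mult)
qed

lemma (in prob_space) second_moment_linear_combination: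
  assumes "\<And>i. i \<in> J \<Longrightarrow> all_moments M (F i)"
  shows "(LINT w|M. (\<Sum>i\<in>J. a i * F i w)\<^sup>2) = (\<Sum>i\<in>J. \<Sum>j\<in>J. a i * a j * (LINT w|M. F i w * F j w))"
proof -
  have "(LINT w|M. (\<Sum>i\<in>J. a i * F i w)\<^sup>2) = (LINT w|M. (\<Sum>i\<in>J. \<Sum>j\<in>J. a i * a j * (F i w * F j w)))"
    by (simp add: power2_eq_square sum_product mult_ac)
  also have "\<dots> = (\<Sum>i\<in>J. LINT w|M. (\<Sum>j\<in>J. a i * a j * (F i w * F j w)))"
    by (intro Bochner_Integration.integral_sum Bochner_Integration.integrable_sum integrable_mult_right
        all_moments_integrable all_moments_mult assms)
  also have "\<dots> = (\<Sum>i\<in>J. \<Sum>j\<in>J. LINT w|M. a i * a j * (F i w * F j w))"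
    by (intro sum.cong refl Bochner_Integration.integral_sum integrable_mult_right all_moments_integrable all_moments_mult assms)
  finally show ?thesis by simp
qed

lemma (in prob_space) expectation_abs_le:
  assumes Y: "Y \<in> borel_measurable M" "integrable M (\<lambda>w. (Y w)\<^sup>2)"
  shows "integrable M Y" "(LINT w|M. \<bar>Y w\<bar>) \<le> sqrt (LINT w|M. (Y w)\<^sup>2)"
proof -
  show "integrable M Y" using cauchy_schwarz(1)[OF Y, of "\<lambda>_. 1"] by simp
  have "\<bar>LINT w|M. \<bar>Y w\<bar> * 1\<bar> \<le> sqrt (LINT w|M. \<bar>Y w\<bar>\<^sup>2) * sqrt (LINT w|M. 1\<^sup>2)"
    by (rule cauchy_schwarz(2)) (use Y in auto)
  then show "(LINT w|M. \<bar>Y w\<bar>) \<le> sqrt (LINT w|M. (Y w)\<^sup>2)" by (simp add: prob_space)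
qed

section \<open>Laws determined by characteristic functions\<close>

text \<open>An affine image of one fixed law covers the point mass and the density at once, so that
  later computations do not split on \<open>s = 0\<close>.\<close>

lemma normal_law_eq_distr:
  assumes "s \<ge> 0"
  shows "normal_law m s = distr std_normal_distribution borel (\<lambda>x. m + s * x)"
proof -
  interpret real_distribution std_normal_distribution by (rule real_dist_normal_dist)
  show ?thesis
  proof (cases "s = 0")
    case True
    then show ?thesis by (simp add: normal_law_def)
  next
    case False
    have "distributed std_normal_distribution lborel (\<lambda>x. x) std_normal_density"
      by (auto simp: distributed_def distr_id2)
    from normal_density_affine[OF this, of s m] have
      "distributed std_normal_distribution lborel (\<lambda>x. m + s * x) (normal_density m s)"
      using False assms by simp
    then have "distr std_normal_distribution lborel (\<lambda>x. m + s * x) = density lborel (normal_density m s)"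
      by (simp add: distributed_def)
    moreover have "distr std_normal_distribution lborel (\<lambda>x. m + s * x) = distr std_normal_distribution borel (\<lambda>x. m + s * x)"
      by (rule distr_cong) auto
    ultimately show ?thesis using False by (simp add: normal_law_def)
  qed
qed

lemma all_moments_std_normal: "all_moments std_normal_distribution (\<lambda>x. x)"
  unfolding all_moments_def
proof (intro conjI allI)
  show "integrable std_normal_distribution (\<lambda>x. \<bar>x\<bar> ^ n)" for n
    using integrable_std_normal_moment_abs[of n] by (subst integrable_density) auto
qed simp

lemma
  assumes "prob_space M" and Z[measurable]: "Z \<in> borel_measurable M"
    and s: "s \<ge> 0" and d: "distr M borel Z = normal_law m s"
  shows all_moments_normal: "all_moments M Z"
    and expectation_normal: "(LINT w|M. Z w) = m"
    and variance_normal: "(LINT w|M. (Z w)\<^sup>2) = m\<^sup>2 + s\<^sup>2"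
    and char_normal: "(LINT w|M. iexp (Z w)) = iexp m * exp (- s\<^sup>2 / 2)"
proof -
  interpret N: real_distribution std_normal_distribution by (rule real_dist_normal_dist)
  note d' = d[unfolded normal_law_eq_distr[OF s]]
  have am: "all_moments std_normal_distribution (\<lambda>x. m + s * x)"
    by (intro all_moments_add N.all_moments_const N.all_moments_cmult all_moments_std_normal)
  have tr: "(LINT w|M. g (Z w)) = (LINT x|std_normal_distribution. g (m + s * x))"
    if [measurable]: "g \<in> borel_measurable borel" for g :: "real \<Rightarrow> 'b::{banach, second_countable_topology}"
    using integral_distr[of Z M borel g] integral_distr[of "\<lambda>x. m + s * x" std_normal_distribution borel g]
    by (simp add: d')
  have tri: "integrable M (\<lambda>w. g (Z w)) \<longleftrightarrow> integrable std_normal_distribution (\<lambda>x. g (m + s * x))"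
    if [measurable]: "g \<in> borel_measurable borel" for g :: "real \<Rightarrow> real"
    using integrable_distr_eq[of Z M borel g] integrable_distr_eq[of "\<lambda>x. m + s * x" std_normal_distribution borel g]
    by (simp add: d')
  show "all_moments M Z"
    unfolding all_moments_def
  proof (intro conjI allI)
    show "integrable M (\<lambda>w. \<bar>Z w\<bar> ^ n)" for n
      by (subst tri[of "\<lambda>x. \<bar>x\<bar> ^ n"]) (use am in \<open>auto simp: all_moments_def\<close>)
  qed simp
  define S where "S = std_normal_distribution"
  have i1: "integrable S (\<lambda>x. x)"
    using integrable_std_normal_distribution_moment[of 1] by (simp add: S_def)
  have e1: "(LINT x|S. x) = 0"
    using integral_std_normal_distribution_moment_odd[of 1] by (simp add: S_def)
  have e2: "(LINT x|S. x\<^sup>2) = 1"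
    using std_normal_distribution_even_moments(1)[of 1] by (simp add: S_def)
  have i2: "integrable S (\<lambda>x. x\<^sup>2)"
    using integrable_std_normal_distribution_moment[of 2] by (simp add: S_def)
  interpret S: prob_space S unfolding S_def by (rule N.prob_space_axioms)
  have "(LINT w|M. Z w) = (LINT x|S. m + s * x)" unfolding S_def by (rule tr) simp
  also have "\<dots> = m" using i1 e1 by (simp add: S.prob_space)
  finally show "(LINT w|M. Z w) = m" .
  have sq: "(m + s * x)\<^sup>2 = m\<^sup>2 + 2 * m * s * x + s\<^sup>2 * x\<^sup>2" for x
    by (simp add: power2_eq_square algebra_simps)
  have "(LINT w|M. (Z w)\<^sup>2) = (LINT x|S. (m + s * x)\<^sup>2)"
    unfolding S_def by (rule tr) simp
  also have "\<dots> = (LINT x|S. m\<^sup>2 + 2 * m * s * x + s\<^sup>2 * x\<^sup>2)"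
    by (simp only: sq)
  also have "\<dots> = m\<^sup>2 + s\<^sup>2" using i1 i2 e1 e2 by (simp add: S.prob_space)
  finally show "(LINT w|M. (Z w)\<^sup>2) = m\<^sup>2 + s\<^sup>2" .
  have ex: "iexp (m + s * x) = iexp m * iexp (s * x)" for x
    by (simp add: exp_add[symmetric] distrib_left)
  have "(LINT w|M. iexp (Z w)) = (LINT x|S. iexp (m + s * x))"
    unfolding S_def by (rule tr) simp
  also have "\<dots> = iexp m * char S s"
    by (simp only: ex char_def) simp
  also have "char S s = complex_of_real (exp (- s\<^sup>2 / 2))"
    unfolding S_def char_std_normal_distribution ..
  finally show "(LINT w|M. iexp (Z w)) = iexp m * exp (- s\<^sup>2 / 2)" .
qed

section \<open>Joint laws from one-dimensional characteristic functions (the Cramer-Wold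
  device)\<close>

lemma (in prob_space) integral_iexp_eq:
  assumes [measurable]: "Y \<in> borel_measurable M" "W \<in> borel_measurable M" and "integrable M W"
  shows "(LINT w|M. W w *\<^sub>R iexp (Y w)) =
    Complex (LINT w|M. W w * cos (Y w)) (LINT w|M. W w * sin (Y w))"
proof -
  have i: "integrable M (\<lambda>w. W w *\<^sub>R iexp (Y w))"
    by (rule Bochner_Integration.integrable_bound[OF assms(3)]) auto
  have "Re (LINT w|M. W w *\<^sub>R iexp (Y w)) = (LINT w|M. W w * cos (Y w))"
    using integral_Re[OF i] by (simp add: Re_exp)
  moreover have "Im (LINT w|M. W w *\<^sub>R iexp (Y w)) = (LINT w|M. W w * sin (Y w))"
    using integral_Im[OF i] by (simp add: Im_exp)
  ultimately show ?thesis by (simp add: complex_eq_iff)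
qed

lemma (in prob_space) density_distr_normalized:
  assumes [measurable]: "Y \<in> borel_measurable M" "W \<in> borel_measurable M" "E \<in> sets borel"
    and W: "\<And>w. 0 \<le> W w" "integrable M W" and aM: "a = (LINT w|M. W w)" and a: "(a::real) > 0"
  shows "real_distribution (distr (density M (\<lambda>w. ennreal (W w / a))) borel Y)" (is ?t1)
    and "char (distr (density M (\<lambda>w. ennreal (W w / a))) borel Y) =
        (\<lambda>t. Complex (LINT w|M. W w * cos (t * Y w)) (LINT w|M. W w * sin (t * Y w)) / a)" (is ?t2)
    and "measure (distr (density M (\<lambda>w. ennreal (W w / a))) borel Y) E = (LINT w|M. W w * indicator E (Y w)) / a" (is ?t3)
proof -
  have "emeasure (density M (\<lambda>w. ennreal (W w / a))) (space M) = (\<integral>\<^sup>+ w. ennreal (W w / a) \<partial>M)"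
    by (subst emeasure_density) (auto intro!: nn_integral_cong)
  also have "\<dots> = ennreal (LINT w|M. W w / a)"
    using W a by (intro nn_integral_eq_integral) auto
  also have "\<dots> = 1" using a aM by simp
  finally have p: "prob_space (density M (\<lambda>w. ennreal (W w / a)))" by (intro prob_spaceI) simp
  then interpret D: prob_space "density M (\<lambda>w. ennreal (W w / a))" .
  have 1: "real_distribution (distr (density M (\<lambda>w. ennreal (W w / a))) borel Y)"
    unfolding real_distribution_def real_distribution_axioms_def using D.prob_space_distr[of Y borel] by simp
  have 2: "char (distr (density M (\<lambda>w. ennreal (W w / a))) borel Y) t =
    Complex (LINT w|M. W w * cos (t * Y w)) (LINT w|M. W w * sin (t * Y w)) / a" for t
  proof -
    have "char (distr (density M (\<lambda>w. ennreal (W w / a))) borel Y) t =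
      (LINT w|M. (1 / a) *\<^sub>R (W w *\<^sub>R iexp (t * Y w)))"
      unfolding char_def using W a
      by (subst integral_distr) (auto simp: integral_density)
    also have "\<dots> = Complex (LINT w|M. W w * cos (t * Y w)) (LINT w|M. W w * sin (t * Y w)) / a"
      unfolding integral_scaleR_right
      by (subst integral_iexp_eq) (use W in \<open>auto simp: complex_eq_iff\<close>)
    finally show ?thesis .
  qed
  have "emeasure (distr (density M (\<lambda>w. ennreal (W w / a))) borel Y) E =
    (\<integral>\<^sup>+ w. ennreal (W w / a) * indicator (Y -` E \<inter> space M) w \<partial>M)"
    by (simp add: emeasure_distr emeasure_density)
  also have "\<dots> = (\<integral>\<^sup>+ w. ennreal (W w * indicator E (Y w) / a) \<partial>M)"
    by (intro nn_integral_cong) (auto simp: indicator_def)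
  also have "\<dots> = ennreal (LINT w|M. W w * indicator E (Y w) / a)"
  proof (rule nn_integral_eq_integral)
    show "integrable M (\<lambda>w. W w * indicator E (Y w) / a)"
      by (rule Bochner_Integration.integrable_bound[of M "\<lambda>w. W w / a"])
        (use W a in \<open>auto intro!: AE_I2 simp: indicator_def\<close>)
  qed (use W a in auto)
  finally have "emeasure (distr (density M (\<lambda>w. ennreal (W w / a))) borel Y) E =
     ennreal (LINT w|M. W w * indicator E (Y w) / a)" .
  moreover have "0 \<le> (LINT w|M. W w * indicator E (Y w) / a)"
    using W a by (intro integral_nonneg_AE) auto
  ultimately have 3: "measure (distr (density M (\<lambda>w. ennreal (W w / a))) borel Y) E =
     (LINT w|M. W w * indicator E (Y w)) / a"
    unfolding measure_def by simp
  show ?t1 ?t2 ?t3 using 1 2 3 by blast+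
qed

text \<open>At \<open>t = 0\<close> the cosine hypothesis says that both weights have the same mass
  \<open>a\<close>. If \<open>a = 0\<close>, both weights vanish almost everywhere; otherwise
  dividing by \<open>a\<close> gives probability laws, and Levy's uniqueness theorem
  applies.\<close>

lemma weighted_law_unique:
  fixes C :: real and M1 :: "'v measure" and M2 :: "'w measure" and Y1 W1 :: "'v \<Rightarrow> real" and Y2 W2 :: "'w \<Rightarrow> real"
  assumes M1: "prob_space M1" and M2: "prob_space M2"
    and [measurable]: "Y1 \<in> borel_measurable M1" "W1 \<in> borel_measurable M1"
      "Y2 \<in> borel_measurable M2" "W2 \<in> borel_measurable M2"
    and b: "\<And>w. 0 \<le> W1 w" "\<And>w. W1 w \<le> C" "\<And>w. 0 \<le> W2 w" "\<And>w. W2 w \<le> C"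
    and c: "\<And>t. (LINT w|M1. W1 w * cos (t * Y1 w)) = (LINT w|M2. W2 w * cos (t * Y2 w))"
    and s: "\<And>t. (LINT w|M1. W1 w * sin (t * Y1 w)) = (LINT w|M2. W2 w * sin (t * Y2 w))"
    and E[measurable]: "E \<in> sets borel"
  shows "(LINT w|M1. W1 w * indicator E (Y1 w)) = (LINT w|M2. W2 w * indicator E (Y2 w))"
proof -
  interpret M1: prob_space M1 by fact
  interpret M2: prob_space M2 by fact
  have i1: "integrable M1 W1" by (rule M1.integrable_const_bound[of _ C]) (auto simp: b)
  have i2: "integrable M2 W2" by (rule M2.integrable_const_bound[of _ C]) (auto simp: b)
  define a where "a = (LINT w|M1. W1 w)"
  have a2: "a = (LINT w|M2. W2 w)" using c[of 0] by (simp add: a_def)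
  show ?thesis
  proof (cases "a = 0")
    case True
    have "AE w in M1. W1 w = 0"
      using integral_nonneg_eq_0_iff_AE[OF i1] b True by (simp add: a_def)
    then have "(LINT w|M1. W1 w * indicator E (Y1 w)) = (LINT w|M1. 0)"
      by (intro integral_cong_AE) auto
    moreover have "AE w in M2. W2 w = 0"
      using integral_nonneg_eq_0_iff_AE[OF i2] b True by (simp add: a2)
    then have "(LINT w|M2. W2 w * indicator E (Y2 w)) = (LINT w|M2. 0)"
      by (intro integral_cong_AE) auto
    ultimately show ?thesis by simp
  next
    case False
    then have a: "a > 0" using b by (simp add: a_def less_le)
    have k1: "real_distribution (distr (density M1 (\<lambda>w. ennreal (W1 w / a))) borel Y1)"
      "char (distr (density M1 (\<lambda>w. ennreal (W1 w / a))) borel Y1) =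
        (\<lambda>t. Complex (LINT w|M1. W1 w * cos (t * Y1 w)) (LINT w|M1. W1 w * sin (t * Y1 w)) / a)"
      "measure (distr (density M1 (\<lambda>w. ennreal (W1 w / a))) borel Y1) E = (LINT w|M1. W1 w * indicator E (Y1 w)) / a"
      using M1.density_distr_normalized[of Y1 W1 E a] a i1 a_def b by auto
    have k2: "real_distribution (distr (density M2 (\<lambda>w. ennreal (W2 w / a))) borel Y2)"
      "char (distr (density M2 (\<lambda>w. ennreal (W2 w / a))) borel Y2) =
        (\<lambda>t. Complex (LINT w|M2. W2 w * cos (t * Y2 w)) (LINT w|M2. W2 w * sin (t * Y2 w)) / a)"
      "measure (distr (density M2 (\<lambda>w. ennreal (W2 w / a))) borel Y2) E = (LINT w|M2. W2 w * indicator E (Y2 w)) / a"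
      using M2.density_distr_normalized[of Y2 W2 E a] a i2 a2 b by auto
    have "distr (density M1 (\<lambda>w. ennreal (W1 w / a))) borel Y1 = distr (density M2 (\<lambda>w. ennreal (W2 w / a))) borel Y2"
      using k1 k2 c s by (intro Levy_uniqueness) auto
    then show ?thesis using k1(3) k2(3) a by simp
  qed
qed

text \<open>Adding 1 makes the weights nonnegative; the unweighted identity, itself the case of
  weight 1, is then subtracted. The free phase \<open>\<phi>\<close> lets one cosine identity
  provide the sine identity too.\<close>

lemma weighted_law_unique_signed:
  fixes M1 :: "'v measure" and M2 :: "'w measure" and Y1 W1 :: "'v \<Rightarrow> real" and Y2 W2 :: "'w \<Rightarrow> real"
  assumes M1: "prob_space M1" and M2: "prob_space M2"
    and [measurable]: "Y1 \<in> borel_measurable M1" "W1 \<in> borel_measurable M1"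
      "Y2 \<in> borel_measurable M2" "W2 \<in> borel_measurable M2" and E[measurable]: "E \<in> sets borel"
    and b: "\<And>w. \<bar>W1 w\<bar> \<le> 1" "\<And>w. \<bar>W2 w\<bar> \<le> 1"
    and c: "\<And>\<phi> t. (LINT w|M1. W1 w * cos (\<phi> + t * Y1 w)) = (LINT w|M2. W2 w * cos (\<phi> + t * Y2 w))"
    and u: "\<And>\<phi> t. (LINT w|M1. cos (\<phi> + t * Y1 w)) = (LINT w|M2. cos (\<phi> + t * Y2 w))"
  shows "(LINT w|M1. W1 w * indicator E (Y1 w)) = (LINT w|M2. W2 w * indicator E (Y2 w))"
proof -
  interpret M1: prob_space M1 by fact
  interpret M2: prob_space M2 by fact
  have i1: "integrable M1 (\<lambda>w. V w * g (Y1 w))" if "\<And>w. \<bar>V w\<bar> \<le> 1" "\<And>y. \<bar>g y\<bar> \<le> 1"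
    "V \<in> borel_measurable M1" "g \<in> borel_measurable borel" for V :: "'v \<Rightarrow> real" and g :: "real \<Rightarrow> real"
    using that by (intro M1.integrable_const_bound[of _ 1]) (auto intro!: AE_I2 mult_le_one simp: abs_mult)
  have i2: "integrable M2 (\<lambda>w. V w * g (Y2 w))" if "\<And>w. \<bar>V w\<bar> \<le> 1" "\<And>y. \<bar>g y\<bar> \<le> 1"
    "V \<in> borel_measurable M2" "g \<in> borel_measurable borel" for V :: "'w \<Rightarrow> real" and g :: "real \<Rightarrow> real"
    using that by (intro M2.integrable_const_bound[of _ 1]) (auto intro!: AE_I2 mult_le_one simp: abs_mult)
  have split: "(LINT w|M1. (W1 w + 1) * g (Y1 w)) = (LINT w|M1. W1 w * g (Y1 w)) + (LINT w|M1. g (Y1 w))"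
    "(LINT w|M2. (W2 w + 1) * g (Y2 w)) = (LINT w|M2. W2 w * g (Y2 w)) + (LINT w|M2. g (Y2 w))"
    if "\<And>y. \<bar>g y\<bar> \<le> 1" "g \<in> borel_measurable borel" for g
    using i1[of W1 g] i1[of "\<lambda>_. 1" g] i2[of W2 g] i2[of "\<lambda>_. 1" g] b that by (simp_all add: distrib_right)
  have sin: "sin x = cos (- (pi / 2) + x)" for x :: real
    using cos_minus[of "pi / 2 - x"] by (simp add: sin_cos_eq)
  have "(LINT w|M1. (W1 w + 1) * indicator E (Y1 w)) = (LINT w|M2. (W2 w + 1) * indicator E (Y2 w))"
  proof (rule weighted_law_unique[OF M1 M2, where C = 2])
    show "0 \<le> W1 w + 1" "W1 w + 1 \<le> 2" for w using b(1)[of w] by linarith+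
    show "0 \<le> W2 w + 1" "W2 w + 1 \<le> 2" for w using b(2)[of w] by linarith+
    have "(LINT w|M1. (W1 w + 1) * cos (\<phi> + t * Y1 w)) = (LINT w|M2. (W2 w + 1) * cos (\<phi> + t * Y2 w))" for \<phi> t
      using split[of "\<lambda>y. cos (\<phi> + t * y)"] c u by simp
    from this[of 0] this[of "- (pi / 2)"]
    show "(LINT w|M1. (W1 w + 1) * cos (t * Y1 w)) = (LINT w|M2. (W2 w + 1) * cos (t * Y2 w))"
      "(LINT w|M1. (W1 w + 1) * sin (t * Y1 w)) = (LINT w|M2. (W2 w + 1) * sin (t * Y2 w))" for t
      unfolding sin by simp_all
  qed measurable
  moreover have "(LINT w|M1. 1 * indicator E (Y1 w)) = (LINT w|M2. 1 * indicator E (Y2 w) :: real)"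
    by (rule weighted_law_unique[OF M1 M2, where C = 1]) (use u[of 0] u[of "- (pi / 2)"] in \<open>simp_all add: sin\<close>)
  ultimately show ?thesis using split[of "indicator E"] by (simp add: indicator_def)
qed

lemma (in prob_space) integrable_indicator_prod_cos:
  assumes "finite A" "S \<subseteq> A" "\<And>i. i \<in> A \<Longrightarrow> Y i \<in> borel_measurable M"
    and "\<And>i. i \<in> S \<Longrightarrow> E i \<in> sets borel"
  shows "integrable M (\<lambda>w. (\<Prod>i\<in>S. indicator (E i) (Y i w)) * cos (\<theta> + (\<Sum>i\<in>A. c i * Y i w)) :: real)"
proof (rule integrable_const_bound[of _ 1])
  have [measurable]: "(\<lambda>w. indicator (E i) (Y i w) :: real) \<in> borel_measurable M" if "i \<in> S" for i
    by (rule measurable_compose[OF assms(3) borel_measurable_indicator[OF assms(4)]]) (use assms(2) that in auto)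
  have [measurable]: "\<And>i. i \<in> A \<Longrightarrow> Y i \<in> borel_measurable M" by fact
  show "(\<lambda>w. (\<Prod>i\<in>S. indicator (E i) (Y i w)) * cos (\<theta> + (\<Sum>i\<in>A. c i * Y i w)) :: real) \<in> borel_measurable M"
    by (intro borel_measurable_times borel_measurable_prod measurable_compose[OF _ borel_measurable_cos]
        borel_measurable_add borel_measurable_const borel_measurable_sum) measurable
  have "\<bar>\<Prod>i\<in>S. indicator (E i) (Y i w) :: real\<bar> \<le> 1" for w
    unfolding abs_prod by (intro prod_le_1) (auto simp: indicator_def)
  then have "\<bar>\<Prod>i\<in>S. indicator (E i) (Y i w) :: real\<bar> * \<bar>cos (\<theta> + (\<Sum>i\<in>A. c i * Y i w))\<bar> \<le> 1 * 1" for w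
    by (intro mult_mono) auto
  then show "AE w in M. norm ((\<Prod>i\<in>S. indicator (E i) (Y i w)) * cos (\<theta> + (\<Sum>i\<in>A. c i * Y i w)) :: real) \<le> 1"
    by (simp add: abs_mult)
qed

text \<open>The product formula for cosines turns an extra factor
  \<open>cos (\<phi> + t * Y k w)\<close> into shifts of the phase and of the \<open>k\<close>-th
  coefficient. The family \<open>J\<close> is therefore closed under such factors, as the induction
  over coordinates in \<open>joint_law_unique\<close> requires.\<close>

lemma (in prob_space) expectation_indicator_cos_cos:
  fixes Y :: "'i \<Rightarrow> 'a \<Rightarrow> real"
  assumes "finite A" "S \<subseteq> A" "\<And>i. i \<in> A \<Longrightarrow> Y i \<in> borel_measurable M"
    and "\<And>i. i \<in> S \<Longrightarrow> E i \<in> sets borel" and k: "k \<in> A"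
  defines "J \<equiv> \<lambda>\<theta> c. (LINT w|M. (\<Prod>i\<in>S. indicator (E i) (Y i w)) * cos (\<theta> + (\<Sum>i\<in>A. c i * Y i w)))"
  shows "(LINT w|M. ((\<Prod>i\<in>S. indicator (E i) (Y i w)) * cos (\<theta> + (\<Sum>i\<in>A. c i * Y i w))) * cos (\<phi> + t * Y k w)) =
    J (\<phi> + \<theta>) (\<lambda>i. c i + (if i = k then t else 0)) / 2 + J (\<theta> - \<phi>) (\<lambda>i. c i - (if i = k then t else 0)) / 2"
proof -
  note i = integrable_indicator_prod_cos[OF assms(1-4)]
  have s1: "(\<Sum>i\<in>A. (if i = k then t else 0) * Y i w) = t * Y k w" for w
    using assms(1) k by (simp add: if_distrib[of "\<lambda>x. x * _"] cong: if_cong)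
  have eq: "(p * cos (\<theta> + u)) * cos (\<phi> + v) = p * cos (\<phi> + \<theta> + (u + v)) / 2 + p * cos (\<theta> - \<phi> + (u - v)) / 2"
    for p u v :: real
  proof -
    have a: "\<phi> + \<theta> + (u + v) = (\<theta> + u) + (\<phi> + v)" "\<theta> - \<phi> + (u - v) = (\<theta> + u) - (\<phi> + v)" by simp_all
    then show ?thesis unfolding mult.assoc cos_times_cos a by (simp add: distrib_left add_divide_distrib)
  qed
  show ?thesis
    unfolding J_def eq s1[symmetric]
    unfolding sum.distrib[symmetric] sum_subtractf[symmetric] distrib_right[symmetric] left_diff_distrib[symmetric]
    using i by (subst Bochner_Integration.integral_add; simp)
qed

abbreviation paths :: "'i set \<Rightarrow> ('i \<Rightarrow> real) measure" where
  "paths A \<equiv> Pi\<^sub>M A (\<lambda>_. borel)"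

text \<open>The coordinates are treated one at a time: with the indicators of the coordinates in
  \<open>S\<close> and a cosine as signed weight, one-dimensional uniqueness inserts the indicator
  of the next coordinate. Once all indicators are present, the laws agree on boxes.\<close>

lemma joint_law_unique:
  fixes Y :: "'i \<Rightarrow> 'v \<Rightarrow> real" and Z :: "'i \<Rightarrow> 'w \<Rightarrow> real"
  assumes M1: "prob_space M1" and M2: "prob_space M2" and A: "finite A"
    and Y: "\<And>i. i \<in> A \<Longrightarrow> Y i \<in> borel_measurable M1" and Z: "\<And>i. i \<in> A \<Longrightarrow> Z i \<in> borel_measurable M2"
    and ch: "\<And>c. (LINT w|M1. iexp (\<Sum>i\<in>A. c i * Y i w)) = (LINT w|M2. iexp (\<Sum>i\<in>A. c i * Z i w))"
  shows "distr M1 (paths A) (\<lambda>w. \<lambda>i\<in>A. Y i w) = distr M2 (paths A) (\<lambda>w. \<lambda>i\<in>A. Z i w)"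
proof -
  interpret M1: prob_space M1 by fact
  interpret M2: prob_space M2 by fact
  have base: "(LINT w|M1. cos (\<theta> + (\<Sum>i\<in>A. c i * Y i w))) = (LINT w|M2. cos (\<theta> + (\<Sum>i\<in>A. c i * Z i w)))" for \<theta> c
  proof -
    have m: "(\<lambda>w. \<Sum>i\<in>A. c i * Y i w) \<in> borel_measurable M1" "(\<lambda>w. \<Sum>i\<in>A. c i * Z i w) \<in> borel_measurable M2"
      using Y Z by (auto intro!: borel_measurable_sum)
    have "(LINT w|M1. cos (\<Sum>i\<in>A. c i * Y i w)) = (LINT w|M2. cos (\<Sum>i\<in>A. c i * Z i w))"
      "(LINT w|M1. sin (\<Sum>i\<in>A. c i * Y i w)) = (LINT w|M2. sin (\<Sum>i\<in>A. c i * Z i w))"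
      using ch[of c] M1.integral_iexp_eq[OF m(1), of "\<lambda>_. 1"] M2.integral_iexp_eq[OF m(2), of "\<lambda>_. 1"]
      by simp_all
    moreover have "integrable M1 (\<lambda>w. cos (\<Sum>i\<in>A. c i * Y i w))" "integrable M1 (\<lambda>w. sin (\<Sum>i\<in>A. c i * Y i w))"
      "integrable M2 (\<lambda>w. cos (\<Sum>i\<in>A. c i * Z i w))" "integrable M2 (\<lambda>w. sin (\<Sum>i\<in>A. c i * Z i w))"
      using m by (auto intro!: M1.integrable_const_bound[of _ 1] M2.integrable_const_bound[of _ 1])
    ultimately show ?thesis by (simp add: cos_add)
  qed
  \<comment> \<open>Phase and coefficients stay arbitrary, because the step for \<open>k\<close>
    shifts both.\<close>
  have key: "S \<subseteq> A \<Longrightarrow> (\<And>i. i \<in> S \<Longrightarrow> E i \<in> sets borel) \<Longrightarrow>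
      (LINT w|M1. (\<Prod>i\<in>S. indicator (E i) (Y i w)) * cos (\<theta> + (\<Sum>i\<in>A. c i * Y i w))) =
      (LINT w|M2. (\<Prod>i\<in>S. indicator (E i) (Z i w)) * cos (\<theta> + (\<Sum>i\<in>A. c i * Z i w)))"
    if "finite S" for S E \<theta> c
    using that
  proof (induction S arbitrary: \<theta> c rule: finite_induct)
    case empty
    then show ?case using base by simp
  next
    case (insert k S)
    then have SA: "S \<subseteq> A" and k: "k \<in> A" and E: "\<And>i. i \<in> S \<Longrightarrow> E i \<in> sets borel" "E k \<in> sets borel" by auto
    let ?W1 = "\<lambda>w. (\<Prod>i\<in>S. indicator (E i) (Y i w)) * cos (\<theta> + (\<Sum>i\<in>A. c i * Y i w))"
    let ?W2 = "\<lambda>w. (\<Prod>i\<in>S. indicator (E i) (Z i w)) * cos (\<theta> + (\<Sum>i\<in>A. c i * Z i w))"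
    have "\<bar>?W1 w\<bar> \<le> 1" "\<bar>?W2 v\<bar> \<le> 1" for w v
      unfolding abs_mult abs_prod by (intro mult_le_one prod_le_1 prod_nonneg; simp add: indicator_def)+
    moreover have "(LINT w|M1. ?W1 w * cos (\<phi> + t * Y k w)) = (LINT w|M2. ?W2 w * cos (\<phi> + t * Z k w))" for \<phi> t
      using M1.expectation_indicator_cos_cos[where Y=Y and E=E, OF A SA Y E(1) k, where \<theta>=\<theta> and c=c and \<phi>=\<phi> and t=t]
        M2.expectation_indicator_cos_cos[where Y=Z and E=E, OF A SA Z E(1) k, where \<theta>=\<theta> and c=c and \<phi>=\<phi> and t=t]
        insert.IH[OF SA E(1)] by simp
    moreover have "(LINT w|M1. cos (\<phi> + t * Y k w)) = (LINT w|M2. cos (\<phi> + t * Z k w))" for \<phi> t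
      using base[of \<phi> "\<lambda>i. if i = k then t else 0"] A k by (simp add: if_distrib[of "\<lambda>x. x * _"] cong: if_cong)
    moreover have "?W1 \<in> borel_measurable M1" "?W2 \<in> borel_measurable M2"
      by (rule borel_measurable_integrable, rule M1.integrable_indicator_prod_cos[OF A SA Y E(1)], assumption+)
        (rule borel_measurable_integrable, rule M2.integrable_indicator_prod_cos[OF A SA Z E(1)], assumption+)
    ultimately have "(LINT w|M1. ?W1 w * indicator (E k) (Y k w)) = (LINT w|M2. ?W2 w * indicator (E k) (Z k w))"
      using Y[OF k] Z[OF k] E(2) by (intro weighted_law_unique_signed[OF M1 M2])
    then show ?case using insert.hyps by (simp add: mult_ac)
  qed
  have mY: "(\<lambda>w. \<lambda>i\<in>A. Y i w) \<in> measurable M1 (paths A)" by (rule measurable_restrict) (rule Y)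
  have mZ: "(\<lambda>w. \<lambda>i\<in>A. Z i w) \<in> measurable M2 (paths A)" by (rule measurable_restrict) (rule Z)
  show ?thesis
  proof (rule measure_eqI_PiM_finite[OF A, where A = "\<lambda>_. space (paths A)"])
    fix E :: "'i \<Rightarrow> real set" assume E: "\<And>i. i \<in> A \<Longrightarrow> E i \<in> sets borel"
    have s: "Pi\<^sub>E A E \<in> sets (paths A)" using A E by (intro sets_PiM_I_finite) auto
    have e: "emeasure (distr M (paths A) (\<lambda>w. \<lambda>i\<in>A. U i w)) (Pi\<^sub>E A E) =
        ennreal (LINT w|M. (\<Prod>i\<in>A. indicator (E i) (U i w)))"
      if M: "prob_space M" and m: "(\<lambda>w. \<lambda>i\<in>A. U i w) \<in> measurable M (paths A)" for M :: "'z measure" and U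
    proof -
      interpret prob_space M by fact
      have "(\<Prod>i\<in>A. indicator (E i) (U i w)) = (indicator (Pi\<^sub>E A E) (\<lambda>i\<in>A. U i w) :: real)" for w
      proof (cases "\<forall>i\<in>A. U i w \<in> E i")
        case True
        then show ?thesis by simp
      next
        case False
        then obtain i where i: "i \<in> A" "U i w \<notin> E i" by blast
        then have "(\<Prod>i\<in>A. indicator (E i) (U i w)) = (0 :: real)" using A by (intro prod_zero bexI[of _ i]) auto
        moreover have "(\<lambda>i\<in>A. U i w) \<notin> Pi\<^sub>E A E" using i by (auto dest: PiE_mem)
        ultimately show ?thesis by simp
      qed
      then have "(LINT w|M. (\<Prod>i\<in>A. indicator (E i) (U i w))) = (LINT w|M. indicator (Pi\<^sub>E A E) (\<lambda>i\<in>A. U i w) :: real)" by simp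
      also have "\<dots> = (LINT w|M. indicator ((\<lambda>w. \<lambda>i\<in>A. U i w) -` Pi\<^sub>E A E \<inter> space M) w :: real)"
        by (intro Bochner_Integration.integral_cong) (auto simp: indicator_def)
      also have "\<dots> = prob ((\<lambda>w. \<lambda>i\<in>A. U i w) -` Pi\<^sub>E A E \<inter> space M)" by simp
      finally show ?thesis using m s by (simp add: emeasure_distr emeasure_eq_measure)
    qed
    \<comment> \<open>The case \<open>S = A\<close> with zero phase and zero coefficients: the
      cosine is 1 and the indicators form the box.\<close>
    show "emeasure (distr M1 (paths A) (\<lambda>w. \<lambda>i\<in>A. Y i w)) (Pi\<^sub>E A E) =
       emeasure (distr M2 (paths A) (\<lambda>w. \<lambda>i\<in>A. Z i w)) (Pi\<^sub>E A E)"
      using e[OF M1 mY] e[OF M2 mZ] key[OF A order_refl, of E 0 "\<lambda>_. 0"] E by simp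
  next
    show "range (\<lambda>_::nat. space (paths A)) \<subseteq> prod_algebra A (\<lambda>_. borel)"
      using A prod_algebraI_finite[of A "\<lambda>_. UNIV" "\<lambda>_. borel"] by (auto simp: space_PiM)
    show "emeasure (distr M1 (paths A) (\<lambda>w. \<lambda>i\<in>A. Y i w)) (space (paths A)) \<noteq> \<infinity>"
      using M1.prob_space_distr[OF mY] prob_space.emeasure_space_1 by fastforce
  qed auto
qed

text \<open>These are the boundary terms of the integration by parts. For \<open>n \<ge> 2\<close>
  the Gaussian exponent \<open>n\<^sup>2 / 2\<close> is at least \<open>n\<close>, so exponential
  decay beats the power.\<close>

lemma std_normal_times_power_tendsto:
  "(\<lambda>n. (1 + real n) ^ m * std_normal_density (real n)) \<longlonglongrightarrow> 0"
proof (rule Lim_null_comparison)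
  have "(\<lambda>n. exp 1 * ((1 + real n) ^ m / exp (1 + real n))) \<longlonglongrightarrow> exp 1 * 0"
    by (intro tendsto_mult tendsto_const filterlim_compose[OF tendsto_power_div_exp_0] filterlim_tendsto_add_at_top[OF tendsto_const] filterlim_real_sequentially)
  then show "(\<lambda>n. exp 1 * ((1 + real n) ^ m / exp (1 + real n))) \<longlonglongrightarrow> 0" by simp
  show "\<forall>\<^sub>F n in sequentially. norm ((1 + real n) ^ m * std_normal_density (real n)) \<le> exp 1 * ((1 + real n) ^ m / exp (1 + real n))"
  proof (rule eventually_sequentiallyI[of 2])
    fix n :: nat assume n: "2 \<le> n"
    have "2 * real n \<le> (real n)\<^sup>2" using n by (simp add: power2_eq_square)
    then have "exp (- (real n)\<^sup>2 / 2) \<le> exp (- real n)" by simp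
    moreover have "1 / sqrt (2 * pi) \<le> 1" using pi_gt3 by (simp add: real_le_rsqrt)
    ultimately have "1 / sqrt (2 * pi) * exp (- (real n)\<^sup>2 / 2) \<le> 1 * exp (- real n)"
      by (intro mult_mono) auto
    then have "(1 + real n) ^ m * std_normal_density (real n) \<le> (1 + real n) ^ m * exp (- real n)"
      by (intro mult_left_mono) (auto simp: std_normal_density_def)
    also have "\<dots> = exp 1 * ((1 + real n) ^ m / exp (1 + real n))" by (simp add: exp_add exp_minus field_simps)
    finally show "norm ((1 + real n) ^ m * std_normal_density (real n)) \<le> exp 1 * ((1 + real n) ^ m / exp (1 + real n))" by simp
  qed
qed

lemma integrable_std_normal_poly_growth:
  assumes [measurable]: "g \<in> borel_measurable borel" and "\<And>x. \<bar>g x\<bar> \<le> C * (1 + \<bar>x\<bar>) ^ m"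
  shows "integrable std_normal_distribution g"
proof -
  interpret N: real_distribution std_normal_distribution by (rule real_dist_normal_dist)
  have "all_moments std_normal_distribution (\<lambda>x. \<bar>x\<bar>)"
    using all_moments_std_normal by (simp add: all_moments_def)
  then have "all_moments std_normal_distribution (\<lambda>x. C * (1 + \<bar>x\<bar>) ^ m)"
    by (intro N.all_moments_cmult N.all_moments_power all_moments_add N.all_moments_const)
  then have "all_moments std_normal_distribution g"
    by (rule all_moments_bound) (auto intro: order_trans[OF assms(2)])
  then show ?thesis by (rule all_moments_integrable)
qed

text \<open>Stein's identity: the product of \<open>g\<close> with the density has derivative
  \<open>f\<close>, the density times \<open>g' x - x * g x\<close>. It is integrable by the growth
  bounds, and integrating it over \<open>[-n, n]\<close> leaves boundary terms that vanish in the
  limit.\<close>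

lemma std_normal_integration_by_parts:
  fixes g g' :: "real \<Rightarrow> real"
  assumes d: "\<And>x. (g has_real_derivative g' x) (at x)" and c: "continuous_on UNIV g'"
    and b: "\<And>x. \<bar>g x\<bar> \<le> C * (1 + \<bar>x\<bar>) ^ m" and b': "\<And>x. \<bar>g' x\<bar> \<le> C' * (1 + \<bar>x\<bar>) ^ m'"
  shows "(LINT x|std_normal_distribution. x * g x) = (LINT x|std_normal_distribution. g' x)"
proof -
  have cg: "continuous_on UNIV g" using d by (meson DERIV_isCont continuous_at_imp_continuous_on)
  have [measurable]: "g \<in> borel_measurable borel" "g' \<in> borel_measurable borel"
    using c cg by (auto intro: borel_measurable_continuous_onI)
  have C: "0 \<le> C" using b[of 0] by simp
  have i1: "integrable std_normal_distribution g'" by (rule integrable_std_normal_poly_growth[OF _ b']) simp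
  have "\<bar>x * g x\<bar> \<le> C * (1 + \<bar>x\<bar>) ^ Suc m" for x
    using mult_mono[OF _ b[of x], of "\<bar>x\<bar>" "1 + \<bar>x\<bar>"] C by (simp add: abs_mult mult_ac)
  then have i2: "integrable std_normal_distribution (\<lambda>x. x * g x)"
    by (intro integrable_std_normal_poly_growth[of _ C "Suc m"]) auto
  define f where "f x = std_normal_density x * (g' x - x * g x)" for x
  have il: "integrable lborel f" "(LINT x|lborel. f x) = (LINT x|std_normal_distribution. g' x) - (LINT x|std_normal_distribution. x * g x)"
    using i1 i2 unfolding f_def
    by (auto simp: integrable_density integral_density right_diff_distrib)
  have dn: "(std_normal_density has_real_derivative - x * std_normal_density x) (at x)" for x
  proof -
    define k where "k = 1 / sqrt (2 * pi)"
    have k: "std_normal_density = (\<lambda>x. k * exp (- x\<^sup>2 / 2))" by (simp add: std_normal_density_def k_def fun_eq_iff)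
    show ?thesis unfolding k by (auto intro!: derivative_eq_intros)
  qed
  have dF: "((\<lambda>x. g x * std_normal_density x) has_real_derivative f x) (at x)" for x
    by (rule derivative_eq_intros d dn refl)+ (simp add: f_def algebra_simps)
  have cn: "continuous_on UNIV std_normal_density" using dn by (meson DERIV_isCont continuous_at_imp_continuous_on)
  have cf: "isCont f x" for x
  proof -
    have "continuous_on UNIV f" unfolding f_def by (intro continuous_intros c cg cn)
    then show ?thesis by (simp add: continuous_on_eq_continuous_at)
  qed
  have F: "(LINT x|lborel. f x * indicator {- real n..real n} x) = g (real n) * std_normal_density (real n) - g (- real n) * std_normal_density (- real n)" for n
    by (rule integral_FTC_Icc_real) (use dF cf in auto)
  have "(\<lambda>n. LINT x|lborel. f x * indicator {- real n..real n} x) \<longlonglongrightarrow> (LINT x|lborel. f x)"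
  proof (rule integral_dominated_convergence[where w="\<lambda>x. norm (f x)"])
    show "AE x in lborel. (\<lambda>n. f x * indicator {- real n..real n} x) \<longlonglongrightarrow> f x"
    proof (intro AE_I2 tendsto_eventually)
      fix x :: real
      show "\<forall>\<^sub>F n in sequentially. f x * indicator {- real n..real n} x = f x"
      proof (rule eventually_sequentiallyI[of "nat \<lceil>\<bar>x\<bar>\<rceil>"])
        fix n assume "nat \<lceil>\<bar>x\<bar>\<rceil> \<le> n"
        then have "\<bar>x\<bar> \<le> real n" by linarith
        then show "f x * indicator {- real n..real n} x = f x" by (auto simp: indicator_def abs_le_iff)
      qed
    qed
  qed (use il(1) in \<open>auto simp: indicator_def intro!: borel_measurable_times\<close>)
  moreover have "(\<lambda>n. LINT x|lborel. f x * indicator {- real n..real n} x) \<longlonglongrightarrow> 0"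
  proof (rule Lim_null_comparison)
    have "(\<lambda>n. 2 * C * ((1 + real n) ^ m * std_normal_density (real n))) \<longlonglongrightarrow> 2 * C * 0"
      by (intro tendsto_mult tendsto_const std_normal_times_power_tendsto)
    then show "(\<lambda>n. 2 * C * ((1 + real n) ^ m * std_normal_density (real n))) \<longlonglongrightarrow> 0" by simp
    show "\<forall>\<^sub>F n in sequentially. norm (LINT x|lborel. f x * indicator {- real n..real n} x) \<le> 2 * C * ((1 + real n) ^ m * std_normal_density (real n))"
    proof (intro always_eventually allI)
      fix n
      have "std_normal_density (- real n) = std_normal_density (real n)" by (simp add: std_normal_density_def)
      then have "norm (LINT x|lborel. f x * indicator {- real n..real n} x) \<le> (\<bar>g (real n)\<bar> + \<bar>g (- real n)\<bar>) * std_normal_density (real n)"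
        unfolding F left_diff_distrib[symmetric]
        by (simp add: left_diff_distrib[symmetric] abs_mult mult_right_mono)
      also have "\<dots> \<le> (2 * C * (1 + real n) ^ m) * std_normal_density (real n)"
        using b[of "real n"] b[of "- real n"] by (intro mult_right_mono) auto
      finally show "norm (LINT x|lborel. f x * indicator {- real n..real n} x) \<le> 2 * C * ((1 + real n) ^ m * std_normal_density (real n))"
        by (simp add: mult_ac)
    qed
  qed
  ultimately have "(LINT x|lborel. f x) = 0" by (rule LIMSEQ_unique)
  with il(2) show ?thesis by simp
qed

section \<open>Gaussian integration by parts\<close>

text \<open>The index type is arbitrary, so the same facts serve the isonormal process, indexed by
  vectors, and the finite vectors \<open>N l\<close>.\<close>

locale gaussian_family = prob_space M for M :: "'w measure" +
  fixes Y :: "'i \<Rightarrow> 'w \<Rightarrow> real"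
  assumes gaussian: "centered_jointly_gaussian M Y"
begin

lemma combination:
  assumes "finite F"
  obtains s where "s \<ge> 0" "(\<lambda>w. \<Sum>i\<in>F. c i * Y i w) \<in> borel_measurable M"
    "distr M borel (\<lambda>w. \<Sum>i\<in>F. c i * Y i w) = normal_law (LINT w|M. (\<Sum>i\<in>F. c i * Y i w)) s"
proof -
  obtain m s where 1: "(\<lambda>w. \<Sum>i\<in>F. c i * Y i w) \<in> borel_measurable M" "s \<ge> 0"
    "distr M borel (\<lambda>w. \<Sum>i\<in>F. c i * Y i w) = normal_law m s"
    using gaussian assms unfolding centered_jointly_gaussian_def jointly_gaussian_def by blast
  with expectation_normal[OF prob_space_axioms 1] have "m = (LINT w|M. (\<Sum>i\<in>F. c i * Y i w))" by simp
  with 1 that show ?thesis by blast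
qed

lemma all_moments_Y: "all_moments M (Y i)"
proof -
  obtain s where 1: "s \<ge> 0" "(\<lambda>w. \<Sum>i\<in>{i}. 1 * Y i w) \<in> borel_measurable M"
    "distr M borel (\<lambda>w. \<Sum>i\<in>{i}. 1 * Y i w) = normal_law (LINT w|M. (\<Sum>i\<in>{i}. 1 * Y i w)) s"
    by (rule combination[of "{i}" "\<lambda>_. 1"]) auto
  from all_moments_normal[OF prob_space_axioms 1(2,1,3)] show ?thesis by simp
qed

lemma measurable_Y[measurable]: "Y i \<in> borel_measurable M"
  by (rule all_moments_measurable[OF all_moments_Y])

lemma expectation_combination: "(LINT w|M. (\<Sum>i\<in>F. c i * Y i w)) = 0"
proof -
  have "integrable M (Y i)" for i by (rule all_moments_integrable[OF all_moments_Y])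
  moreover have "(LINT w|M. Y i w) = 0" for i using gaussian by (simp add: centered_jointly_gaussian_def)
  ultimately show ?thesis by simp
qed

lemma second_moment_combination:
  "(LINT w|M. (\<Sum>i\<in>F. c i * Y i w)\<^sup>2) = (\<Sum>i\<in>F. \<Sum>j\<in>F. c i * c j * (LINT w|M. Y i w * Y j w))"
  by (rule second_moment_linear_combination) (rule all_moments_Y)

lemma expectation_iexp_combination:
  assumes "finite F"
  shows "(LINT w|M. iexp (\<Sum>i\<in>F. c i * Y i w)) =
    complex_of_real (exp (- (\<Sum>i\<in>F. \<Sum>j\<in>F. c i * c j * (LINT w|M. Y i w * Y j w)) / 2))"
proof -
  obtain s where 1: "s \<ge> 0" "(\<lambda>w. \<Sum>i\<in>F. c i * Y i w) \<in> borel_measurable M"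
    "distr M borel (\<lambda>w. \<Sum>i\<in>F. c i * Y i w) = normal_law (LINT w|M. (\<Sum>i\<in>F. c i * Y i w)) s"
    by (rule combination[OF assms])
  from char_normal[OF prob_space_axioms 1(2,1,3)] variance_normal[OF prob_space_axioms 1(2,1,3)]
  show ?thesis unfolding expectation_combination second_moment_combination by simp
qed

end

locale isonormal = prob_space M for M :: "'w measure" +
  fixes X :: "'h::real_inner \<Rightarrow> 'w \<Rightarrow> real"
  assumes isonormal: "isonormal_process M X"
begin

sublocale gaussian_family M X
  using isonormal by unfold_locales (simp add: isonormal_process_def)

lemma covariance: "(LINT w|M. X h w * X g w) = h \<bullet> g"
  using isonormal by (simp add: isonormal_process_def)

lemma expectation_iexp_X:
  assumes "finite F"
  shows "(LINT w|M. iexp (\<Sum>h\<in>F. c h * X h w)) = complex_of_real (exp (- (norm (\<Sum>h\<in>F. c h *\<^sub>R h))\<^sup>2 / 2))"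
  unfolding expectation_iexp_combination[OF assms] covariance
  by (simp add: power2_norm_eq_inner inner_sum_left inner_sum_right sum_distrib_left inner_commute mult_ac)

end

definition poly_growth :: "'i set \<Rightarrow> (('i \<Rightarrow> real) \<Rightarrow> real) \<Rightarrow> bool" where
  "poly_growth A \<Psi> \<longleftrightarrow> (\<exists>C m. \<forall>x. \<bar>\<Psi> x\<bar> \<le> C * (1 + (\<Sum>k\<in>A. \<bar>x k\<bar>)) ^ m)"

lemma poly_growthE:
  assumes "poly_growth A \<Psi>"
  obtains C m where "C \<ge> 0" "\<And>x. \<bar>\<Psi> x\<bar> \<le> C * (1 + (\<Sum>k\<in>A. \<bar>x k\<bar>)) ^ m"
proof -
  obtain C m where 1: "\<And>x. \<bar>\<Psi> x\<bar> \<le> C * (1 + (\<Sum>k\<in>A. \<bar>x k\<bar>)) ^ m"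
    using assms unfolding poly_growth_def by blast
  have "0 \<le> C" using 1[of "\<lambda>_. 0"] by simp
  with 1 that show ?thesis by blast
qed

lemma poly_growth_const: "poly_growth A (\<lambda>_. c)"
  unfolding poly_growth_def by (intro exI[of _ "\<bar>c\<bar>"] exI[of _ 0]) simp

lemma poly_growth_add:
  assumes "poly_growth A \<Psi>" "poly_growth A \<Phi>"
  shows "poly_growth A (\<lambda>x. \<Psi> x + \<Phi> x)"
proof -
  obtain C m where 1: "C \<ge> 0" "\<And>x. \<bar>\<Psi> x\<bar> \<le> C * (1 + (\<Sum>k\<in>A. \<bar>x k\<bar>)) ^ m"
    using poly_growthE[OF assms(1)] by blast
  obtain D n where 2: "D \<ge> 0" "\<And>x. \<bar>\<Phi> x\<bar> \<le> D * (1 + (\<Sum>k\<in>A. \<bar>x k\<bar>)) ^ n"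
    using poly_growthE[OF assms(2)] by blast
  have "\<bar>\<Psi> x + \<Phi> x\<bar> \<le> (C + D) * (1 + (\<Sum>k\<in>A. \<bar>x k\<bar>)) ^ (m + n)" for x
  proof -
    let ?r = "1 + (\<Sum>k\<in>A. \<bar>x k\<bar>)"
    have r: "1 \<le> ?r" by (simp add: sum_nonneg)
    have "\<bar>\<Psi> x + \<Phi> x\<bar> \<le> C * ?r ^ m + D * ?r ^ n" using 1(2)[of x] 2(2)[of x] by linarith
    also have "\<dots> \<le> C * ?r ^ (m + n) + D * ?r ^ (m + n)"
      using r 1(1) 2(1) by (intro add_mono mult_left_mono power_increasing) auto
    finally show ?thesis by (simp add: distrib_right)
  qed
  then show ?thesis unfolding poly_growth_def by blast
qed

lemma poly_growth_mult:
  assumes "poly_growth A \<Psi>" "poly_growth A \<Phi>"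
  shows "poly_growth A (\<lambda>x. \<Psi> x * \<Phi> x)"
proof -
  obtain C m where 1: "C \<ge> 0" "\<And>x. \<bar>\<Psi> x\<bar> \<le> C * (1 + (\<Sum>k\<in>A. \<bar>x k\<bar>)) ^ m"
    using poly_growthE[OF assms(1)] by blast
  obtain D n where 2: "D \<ge> 0" "\<And>x. \<bar>\<Phi> x\<bar> \<le> D * (1 + (\<Sum>k\<in>A. \<bar>x k\<bar>)) ^ n"
    using poly_growthE[OF assms(2)] by blast
  have "\<bar>\<Psi> x * \<Phi> x\<bar> \<le> (C * D) * (1 + (\<Sum>k\<in>A. \<bar>x k\<bar>)) ^ (m + n)" for x
  proof -
    have "\<bar>\<Psi> x\<bar> * \<bar>\<Phi> x\<bar> \<le> (C * (1 + (\<Sum>k\<in>A. \<bar>x k\<bar>)) ^ m) * (D * (1 + (\<Sum>k\<in>A. \<bar>x k\<bar>)) ^ n)"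
      using 1 2 by (intro mult_mono) (auto intro!: mult_nonneg_nonneg zero_le_power add_nonneg_nonneg sum_nonneg)
    then show ?thesis by (simp add: abs_mult power_add mult_ac)
  qed
  then show ?thesis unfolding poly_growth_def by blast
qed

lemma poly_growth_coordinate:
  assumes "finite A" "k \<in> A"
  shows "poly_growth A (\<lambda>x. x k)"
  unfolding poly_growth_def
proof (intro exI[of _ 1] allI)
  fix x :: "'a \<Rightarrow> real"
  show "\<bar>x k\<bar> \<le> 1 * (1 + (\<Sum>k\<in>A. \<bar>x k\<bar>)) ^ 1"
    using member_le_sum[OF assms(2), of "\<lambda>k. \<bar>x k\<bar>"] assms(1) by simp
qed

lemma poly_growth_bounded: "(\<And>x. \<bar>\<Psi> x\<bar> \<le> c) \<Longrightarrow> poly_growth A \<Psi>"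
  unfolding poly_growth_def by (intro exI[of _ c] exI[of _ 0]) simp

lemma (in gaussian_family) all_moments_poly_growth:
  assumes A: "finite A" and m: "\<Psi> \<in> borel_measurable (paths A)" and g: "poly_growth A \<Psi>"
  shows "all_moments M (\<lambda>w. \<Psi> (\<lambda>k\<in>A. Y k w))"
proof -
  obtain C n where 1: "C \<ge> 0" "\<And>x. \<bar>\<Psi> x\<bar> \<le> C * (1 + (\<Sum>k\<in>A. \<bar>x k\<bar>)) ^ n"
    using poly_growthE[OF g] by blast
  have "all_moments M (\<lambda>w. \<bar>Y k w\<bar>)" for k using all_moments_Y[of k] by (simp add: all_moments_def)
  then have "all_moments M (\<lambda>w. C * (1 + (\<Sum>k\<in>A. \<bar>Y k w\<bar>)) ^ n)"
    by (intro all_moments_cmult all_moments_power all_moments_add all_moments_const all_moments_sum)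
  moreover have "(\<lambda>w. \<Psi> (\<lambda>k\<in>A. Y k w)) \<in> borel_measurable M"
    by (rule measurable_compose[OF _ m]) (intro measurable_restrict measurable_Y)
  moreover have "\<bar>\<Psi> (\<lambda>k\<in>A. Y k w)\<bar> \<le> \<bar>C * (1 + (\<Sum>k\<in>A. \<bar>Y k w\<bar>)) ^ n\<bar>" for w
  proof -
    have "\<bar>\<Psi> (\<lambda>k\<in>A. Y k w)\<bar> \<le> C * (1 + (\<Sum>k\<in>A. \<bar>Y k w\<bar>)) ^ n" using 1(2)[of "\<lambda>k\<in>A. Y k w"] by simp
    then show ?thesis by linarith
  qed
  ultimately show ?thesis by (rule all_moments_bound)
qed

text \<open>\<open>\<Psi>'\<close> is the derivative of \<open>\<Psi>\<close> in the single
  direction \<open>v\<close>. With \<open>v k = h \<bullet> k\<close> it is the Malliavin derivative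
  in the direction \<open>h\<close>, since \<open>h \<bullet> k\<close> is the derivative of
  \<open>X k\<close>. The growth bounds make all expectations exist; points are restricted to
  \<open>A\<close> to stay in the product space.\<close>

definition smooth_along ::
  "'i set \<Rightarrow> ('i \<Rightarrow> real) \<Rightarrow> (('i \<Rightarrow> real) \<Rightarrow> real) \<Rightarrow> (('i \<Rightarrow> real) \<Rightarrow> real) \<Rightarrow> bool" where
  "smooth_along A v \<Psi> \<Psi>' \<longleftrightarrow>
     \<Psi> \<in> borel_measurable (paths A) \<and> \<Psi>' \<in> borel_measurable (paths A) \<and>
     poly_growth A \<Psi> \<and> poly_growth A \<Psi>' \<and>
     (\<forall>x t. ((\<lambda>s. \<Psi> (\<lambda>k\<in>A. x k + s * v k)) has_real_derivative \<Psi>' (\<lambda>k\<in>A. x k + t * v k)) (at t)) \<and>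
     (\<forall>x. continuous_on UNIV (\<lambda>t. \<Psi>' (\<lambda>k\<in>A. x k + t * v k)))"

lemma smooth_alongD:
  assumes "smooth_along A v \<Psi> \<Psi>'"
  shows "\<Psi> \<in> borel_measurable (paths A)" "\<Psi>' \<in> borel_measurable (paths A)"
    "poly_growth A \<Psi>" "poly_growth A \<Psi>'"
    "((\<lambda>s. \<Psi> (\<lambda>k\<in>A. x k + s * v k)) has_real_derivative \<Psi>' (\<lambda>k\<in>A. x k + t * v k)) (at t)"
    "continuous_on UNIV (\<lambda>t. \<Psi>' (\<lambda>k\<in>A. x k + t * v k))"
    "continuous_on UNIV (\<lambda>t. \<Psi> (\<lambda>k\<in>A. x k + t * v k))"
proof -
  show 1: "\<Psi> \<in> borel_measurable (paths A)" "\<Psi>' \<in> borel_measurable (paths A)"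
    "poly_growth A \<Psi>" "poly_growth A \<Psi>'"
    "((\<lambda>s. \<Psi> (\<lambda>k\<in>A. x k + s * v k)) has_real_derivative \<Psi>' (\<lambda>k\<in>A. x k + t * v k)) (at t)"
    "continuous_on UNIV (\<lambda>t. \<Psi>' (\<lambda>k\<in>A. x k + t * v k))" for t
    using assms by (auto simp: smooth_along_def)
  show "continuous_on UNIV (\<lambda>t. \<Psi> (\<lambda>k\<in>A. x k + t * v k))"
    using 1(5) by (meson DERIV_isCont continuous_at_imp_continuous_on)
qed

lemma smooth_along_const: "smooth_along A v (\<lambda>_. c) (\<lambda>_. 0)"
  by (simp add: smooth_along_def poly_growth_const)

lemma smooth_along_coordinate:
  assumes "finite A" "k \<in> A"
  shows "smooth_along A v (\<lambda>x. x k) (\<lambda>_. v k)"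
  using assms unfolding smooth_along_def
  by (auto intro!: poly_growth_const poly_growth_coordinate derivative_eq_intros measurable_component_singleton)

lemma smooth_along_add:
  assumes "smooth_along A v \<Psi> \<Psi>'" "smooth_along A v \<Phi> \<Phi>'"
  shows "smooth_along A v (\<lambda>x. \<Psi> x + \<Phi> x) (\<lambda>x. \<Psi>' x + \<Phi>' x)"
  using smooth_alongD[OF assms(1)] smooth_alongD[OF assms(2)] unfolding smooth_along_def
  by (auto intro!: poly_growth_add DERIV_add continuous_on_add)

lemma smooth_along_mult:
  assumes "smooth_along A v \<Psi> \<Psi>'" "smooth_along A v \<Phi> \<Phi>'"
  shows "smooth_along A v (\<lambda>x. \<Psi> x * \<Phi> x) (\<lambda>x. \<Psi>' x * \<Phi> x + \<Psi> x * \<Phi>' x)"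
  unfolding smooth_along_def
proof (intro conjI allI)
  note a = smooth_alongD[OF assms(1)] and b = smooth_alongD[OF assms(2)]
  show "poly_growth A (\<lambda>x. \<Psi> x * \<Phi> x)" "poly_growth A (\<lambda>x. \<Psi>' x * \<Phi> x + \<Psi> x * \<Phi>' x)"
    by (intro poly_growth_add poly_growth_mult a b)+
  show "((\<lambda>s. \<Psi> (\<lambda>k\<in>A. x k + s * v k) * \<Phi> (\<lambda>k\<in>A. x k + s * v k)) has_real_derivative
      \<Psi>' (\<lambda>k\<in>A. x k + t * v k) * \<Phi> (\<lambda>k\<in>A. x k + t * v k) + \<Psi> (\<lambda>k\<in>A. x k + t * v k) * \<Phi>' (\<lambda>k\<in>A. x k + t * v k)) (at t)" for x t
    using DERIV_mult[OF a(5)[of x t] b(5)[of x t]] by (simp add: mult.commute add.commute)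
  show "continuous_on UNIV (\<lambda>t. \<Psi>' (\<lambda>k\<in>A. x k + t * v k) * \<Phi> (\<lambda>k\<in>A. x k + t * v k) + \<Psi> (\<lambda>k\<in>A. x k + t * v k) * \<Phi>' (\<lambda>k\<in>A. x k + t * v k))" for x
    by (intro continuous_on_add continuous_on_mult a b)
qed (use smooth_alongD[OF assms(1)] smooth_alongD[OF assms(2)] in \<open>auto intro!: borel_measurable_add borel_measurable_times\<close>)

lemma smooth_along_cmult:
  "smooth_along A v \<Psi> \<Psi>' \<Longrightarrow> smooth_along A v (\<lambda>x. c * \<Psi> x) (\<lambda>x. c * \<Psi>' x)"
  using smooth_along_mult[OF smooth_along_const] by fastforce

lemma smooth_along_sum:
  "(\<And>i. i \<in> F \<Longrightarrow> smooth_along A v (\<Psi> i) (\<Psi>' i)) \<Longrightarrow>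
    smooth_along A v (\<lambda>x. \<Sum>i\<in>F. \<Psi> i x) (\<lambda>x. \<Sum>i\<in>F. \<Psi>' i x)"
  by (induction F rule: infinite_finite_induct) (simp_all add: smooth_along_add smooth_along_const)

text \<open>Bounded \<open>g\<close> and \<open>g'\<close> keep the composition within polynomial
  growth whatever \<open>\<Psi>\<close> is; sines and cosines are the intended choice.\<close>

lemma smooth_along_compose_bounded:
  assumes s: "smooth_along A v \<Psi> \<Psi>'"
    and d: "\<And>x. (g has_real_derivative g' x) (at x)" and c: "continuous_on UNIV g'"
    and b: "\<And>x. \<bar>g x\<bar> \<le> B" "\<And>x. \<bar>g' x\<bar> \<le> B"
  shows "smooth_along A v (\<lambda>x. g (\<Psi> x)) (\<lambda>x. g' (\<Psi> x) * \<Psi>' x)"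
  unfolding smooth_along_def
proof (intro conjI allI)
  note a = smooth_alongD[OF s]
  have cg: "continuous_on UNIV g" using d by (meson DERIV_isCont continuous_at_imp_continuous_on)
  have m: "g \<in> borel_measurable borel" "g' \<in> borel_measurable borel"
    using c cg by (auto intro: borel_measurable_continuous_onI)
  show "(\<lambda>x. g (\<Psi> x)) \<in> borel_measurable (paths A)"
    by (rule measurable_compose[OF a(1) m(1)])
  show "(\<lambda>x. g' (\<Psi> x) * \<Psi>' x) \<in> borel_measurable (paths A)"
    by (intro borel_measurable_times measurable_compose[OF a(1) m(2)] a)
  show "poly_growth A (\<lambda>x. g (\<Psi> x))" by (rule poly_growth_bounded) (rule b)
  show "poly_growth A (\<lambda>x. g' (\<Psi> x) * \<Psi>' x)"
    by (intro poly_growth_mult a) (rule poly_growth_bounded, rule b)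
  show "((\<lambda>s. g (\<Psi> (\<lambda>k\<in>A. x k + s * v k))) has_real_derivative
      g' (\<Psi> (\<lambda>k\<in>A. x k + t * v k)) * \<Psi>' (\<lambda>k\<in>A. x k + t * v k)) (at t)" for x t
    by (rule DERIV_chain2[OF d a(5)])
  show "continuous_on UNIV (\<lambda>t. g' (\<Psi> (\<lambda>k\<in>A. x k + t * v k)) * \<Psi>' (\<lambda>k\<in>A. x k + t * v k))" for x
    by (intro continuous_on_mult a continuous_on_compose2[OF c a(7)]) auto
qed

context isonormal begin

text \<open>\<open>X k\<close> splits into its part along \<open>X h\<close> and a remainder
  uncorrelated with \<open>X h\<close>. For Gaussian families this means independence, so the part
  along \<open>X h\<close> may be replaced by a fresh standard normal variable. On characteristic
  functions the identity is Pythagoras' theorem \<open>nv\<close>.\<close>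

lemma joint_law_rotate:
  assumes A: "finite A" and h: "h \<in> A" "norm h = 1"
  shows "distr M (paths A) (\<lambda>w. \<lambda>k\<in>A. X k w) =
    distr (M \<Otimes>\<^sub>M std_normal_distribution) (paths A)
      (\<lambda>z. \<lambda>k\<in>A. (X k (fst z) - (h \<bullet> k) * X h (fst z)) + snd z * (h \<bullet> k))"
proof (rule joint_law_unique[OF prob_space_axioms _ A])
  interpret N: real_distribution std_normal_distribution by (rule real_dist_normal_dist)
  interpret P: pair_prob_space M std_normal_distribution ..
  show "prob_space (M \<Otimes>\<^sub>M std_normal_distribution)" by (rule P.prob_space_axioms)
  show m: "(\<lambda>z. (X k (fst z) - (h \<bullet> k) * X h (fst z)) + snd z * (h \<bullet> k)) \<in> borel_measurable (M \<Otimes>\<^sub>M std_normal_distribution)" for k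
    by measurable
  fix c :: "'h \<Rightarrow> real"
  define v where "v = (\<Sum>k\<in>A. c k *\<^sub>R k)"
  \<comment> \<open>Lowering the coefficient of \<open>h\<close> by \<open>h \<bullet> v\<close>
    projects \<open>v\<close> onto the orthogonal complement of \<open>h\<close>; this uses that
    \<open>h\<close> belongs to \<open>A\<close>.\<close>
  define c' where "c' k = c k - (if k = h then h \<bullet> v else 0)" for k
  have v': "(\<Sum>k\<in>A. c' k *\<^sub>R k) = v - (h \<bullet> v) *\<^sub>R h"
    using A h unfolding c'_def v_def
    by (simp add: scaleR_diff_left sum_subtractf if_distrib[of "\<lambda>x. x *\<^sub>R _"] cong: if_cong)
  have Xc': "(\<Sum>k\<in>A. c' k * X k w) = (\<Sum>k\<in>A. c k * X k w) - (h \<bullet> v) * X h w" for w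
    using A h unfolding c'_def
    by (simp add: left_diff_distrib sum_subtractf if_distrib[of "\<lambda>x. x * _"] cong: if_cong)
  have hv: "(\<Sum>k\<in>A. c k * (h \<bullet> k)) = h \<bullet> v" unfolding v_def by (simp add: inner_sum_right)
  have split: "(\<Sum>k\<in>A. c k * ((X k w - (h \<bullet> k) * X h w) + x * (h \<bullet> k))) =
      (\<Sum>k\<in>A. c' k * X k w) + (h \<bullet> v) * x" for w x
  proof -
    have "(\<Sum>k\<in>A. c k * ((X k w - (h \<bullet> k) * X h w) + x * (h \<bullet> k))) =
        (\<Sum>k\<in>A. c k * X k w) - (\<Sum>k\<in>A. c k * (h \<bullet> k)) * X h w + (\<Sum>k\<in>A. c k * (h \<bullet> k)) * x"
      by (simp add: algebra_simps sum.distrib sum_subtractf sum_distrib_left)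
    then show ?thesis unfolding hv Xc' by simp
  qed
  have nv: "(norm (v - (h \<bullet> v) *\<^sub>R h))\<^sup>2 + (h \<bullet> v)\<^sup>2 = (norm v)\<^sup>2"
  proof -
    have "h \<bullet> h = 1" using h(2) by (simp add: norm_eq_1)
    then show ?thesis
      unfolding power2_norm_eq_inner
      by (simp add: inner_diff_left inner_diff_right inner_commute power2_eq_square)
  qed
  have mm: "(\<lambda>z. \<Sum>k\<in>A. c k * ((X k (fst z) - (h \<bullet> k) * X h (fst z)) + snd z * (h \<bullet> k))) \<in> borel_measurable (M \<Otimes>\<^sub>M std_normal_distribution)"
    by (intro borel_measurable_sum borel_measurable_times borel_measurable_const m)
  have "(LINT z|(M \<Otimes>\<^sub>M std_normal_distribution). iexp (\<Sum>k\<in>A. c k * ((X k (fst z) - (h \<bullet> k) * X h (fst z)) + snd z * (h \<bullet> k)))) =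
      (LINT w|M. LINT x|std_normal_distribution. iexp (\<Sum>k\<in>A. c k * ((X k w - (h \<bullet> k) * X h w) + x * (h \<bullet> k))))"
    by (subst P.integral_fst'[symmetric]) (use P.integrable_iexp[of "\<lambda>z. complex_of_real (\<Sum>k\<in>A. c k * ((X k (fst z) - (h \<bullet> k) * X h (fst z)) + snd z * (h \<bullet> k)))"] mm in \<open>simp_all add: split_beta\<close>)
  also have "\<dots> = (LINT w|M. iexp (\<Sum>k\<in>A. c' k * X k w) * char std_normal_distribution (h \<bullet> v))"
    unfolding split char_def by (simp add: distrib_left exp_add)
  also have "\<dots> = complex_of_real (exp (- (norm (v - (h \<bullet> v) *\<^sub>R h))\<^sup>2 / 2) * exp (- (h \<bullet> v)\<^sup>2 / 2))"
    unfolding char_std_normal_distribution using expectation_iexp_X[OF A, of c'] unfolding v' by simp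
  also have "\<dots> = complex_of_real (exp (- (norm v)\<^sup>2 / 2))"
    unfolding nv[symmetric] exp_add[symmetric] by (simp add: add_divide_distrib diff_divide_distrib)
  finally show "(LINT w|M. iexp (\<Sum>k\<in>A. c k * X k w)) =
    (LINT z|(M \<Otimes>\<^sub>M std_normal_distribution). iexp (\<Sum>k\<in>A. c k * ((X k (fst z) - (h \<bullet> k) * X h (fst z)) + snd z * (h \<bullet> k))))"
    using expectation_iexp_X[OF A, of c] unfolding v_def by simp
qed measurable

text \<open>With \<open>w\<close> fixed, the rotated vector runs through a line in the direction
  \<open>h \<bullet> k\<close> as the fresh normal variable \<open>x\<close> varies, and its
  coordinate at \<open>h\<close> is \<open>x\<close> itself. The one-dimensional identity applies on
  this line, and Fubini's theorem integrates over \<open>w\<close>.\<close>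

lemma integration_by_parts:
  assumes A: "finite A" and h: "h \<in> A" "norm h = 1"
    and s: "smooth_along A (\<lambda>k. h \<bullet> k) \<Psi> \<Psi>'"
  shows "(LINT w|M. X h w * \<Psi> (\<lambda>k\<in>A. X k w)) = (LINT w|M. \<Psi>' (\<lambda>k\<in>A. X k w))"
proof -
  interpret N: real_distribution std_normal_distribution by (rule real_dist_normal_dist)
  interpret P: pair_prob_space M std_normal_distribution ..
  note d = smooth_alongD[OF s]
  define Z where "Z z = (\<lambda>k\<in>A. (X k (fst z) - (h \<bullet> k) * X h (fst z)) + snd z * (h \<bullet> k))" for z :: "'w \<times> real"
  have mX: "(\<lambda>w. \<lambda>k\<in>A. X k w) \<in> measurable M (paths A)" by (intro measurable_restrict measurable_Y)
  have mZ: "Z \<in> measurable (M \<Otimes>\<^sub>M std_normal_distribution) (paths A)"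
    unfolding Z_def by (rule measurable_restrict) measurable
  have law: "distr M (paths A) (\<lambda>w. \<lambda>k\<in>A. X k w) = distr (M \<Otimes>\<^sub>M std_normal_distribution) (paths A) Z"
    unfolding Z_def by (rule joint_law_rotate[OF A h])
  have tr: "(LINT w|M. \<Phi> (\<lambda>k\<in>A. X k w)) = (LINT w|M. LINT x|std_normal_distribution. \<Phi> (Z (w, x)))"
    if m: "\<Phi> \<in> borel_measurable (paths A)" and g: "poly_growth A \<Phi>" for \<Phi> :: "('h \<Rightarrow> real) \<Rightarrow> real"
  proof -
    have "integrable M (\<lambda>w. \<Phi> (\<lambda>k\<in>A. X k w))"
      by (rule all_moments_integrable[OF all_moments_poly_growth[OF A m g]])
    then have i: "integrable (M \<Otimes>\<^sub>M std_normal_distribution) (\<lambda>z. \<Phi> (Z z))"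
      using integrable_distr_eq[OF mX m] integrable_distr_eq[OF mZ m] law by simp
    have "(LINT w|M. \<Phi> (\<lambda>k\<in>A. X k w)) = (LINT z|(M \<Otimes>\<^sub>M std_normal_distribution). \<Phi> (Z z))"
      using integral_distr[OF mX m] integral_distr[OF mZ m] law by simp
    also have "\<dots> = (LINT w|M. LINT x|std_normal_distribution. \<Phi> (Z (w, x)))"
      using P.integral_fst'[OF i] by simp
    finally show ?thesis .
  qed
  have hh: "h \<bullet> h = 1" using h(2) by (simp add: norm_eq_1)
  have mh: "(\<lambda>x. x h) \<in> borel_measurable (paths A)" by (rule measurable_component_singleton) (rule h)
  have "(LINT w|M. X h w * \<Psi> (\<lambda>k\<in>A. X k w)) = (LINT w|M. LINT x|std_normal_distribution. Z (w, x) h * \<Psi> (Z (w, x)))"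
    using tr[of "\<lambda>x. x h * \<Psi> x"] d mh h A by (simp add: poly_growth_mult poly_growth_coordinate)
  also have "\<dots> = (LINT w|M. LINT x|std_normal_distribution. \<Psi>' (Z (w, x)))"
  proof (rule Bochner_Integration.integral_cong[OF refl])
    fix w
    define y where "y k = X k w - (h \<bullet> k) * X h w" for k
    have Z: "Z (w, x) = (\<lambda>k\<in>A. y k + x * (h \<bullet> k))" for x unfolding Z_def y_def by simp
    have Zh: "Z (w, x) h = x" for x unfolding Z y_def using h hh by simp
    have growth: "\<exists>C m. \<forall>x. \<bar>\<Phi> (Z (w, x))\<bar> \<le> C * (1 + \<bar>x\<bar>) ^ m" if g: "poly_growth A \<Phi>" for \<Phi>
    proof -
      obtain C m where 1: "C \<ge> 0" "\<And>x. \<bar>\<Phi> x\<bar> \<le> C * (1 + (\<Sum>k\<in>A. \<bar>x k\<bar>)) ^ m"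
        using poly_growthE[OF g] by blast
      define K where "K = 1 + (\<Sum>k\<in>A. \<bar>y k\<bar>) + (\<Sum>k\<in>A. \<bar>h \<bullet> k\<bar>)"
      have "\<bar>\<Phi> (Z (w, x))\<bar> \<le> (C * K ^ m) * (1 + \<bar>x\<bar>) ^ m" for x
      proof -
        have "1 + (\<Sum>k\<in>A. \<bar>y k + x * (h \<bullet> k)\<bar>) \<le> 1 + ((\<Sum>k\<in>A. \<bar>y k\<bar>) + (\<Sum>k\<in>A. \<bar>x\<bar> * \<bar>h \<bullet> k\<bar>))"
          unfolding sum.distrib[symmetric]
          by (intro add_mono sum_mono order_refl) (simp add: abs_mult[symmetric])
        also have "\<dots> \<le> K * (1 + \<bar>x\<bar>)"
          unfolding K_def sum_distrib_left[symmetric]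
          by (simp add: algebra_simps sum_nonneg add_nonneg_nonneg)
        finally have "(1 + (\<Sum>k\<in>A. \<bar>y k + x * (h \<bullet> k)\<bar>)) ^ m \<le> (K * (1 + \<bar>x\<bar>)) ^ m"
          by (intro power_mono) (auto intro!: add_nonneg_nonneg sum_nonneg)
        then have "C * (1 + (\<Sum>k\<in>A. \<bar>y k + x * (h \<bullet> k)\<bar>)) ^ m \<le> C * (K * (1 + \<bar>x\<bar>)) ^ m"
          using 1(1) by (intro mult_left_mono)
        then show ?thesis using 1(2)[of "Z (w, x)"] unfolding Z by (simp add: power_mult_distrib mult_ac)
      qed
      then show ?thesis by blast
    qed
    obtain C m where 1: "\<And>x. \<bar>\<Psi> (Z (w, x))\<bar> \<le> C * (1 + \<bar>x\<bar>) ^ m" using growth[OF d(3)] by blast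
    obtain C' m' where 2: "\<And>x. \<bar>\<Psi>' (Z (w, x))\<bar> \<le> C' * (1 + \<bar>x\<bar>) ^ m'" using growth[OF d(4)] by blast
    show "(LINT x|std_normal_distribution. Z (w, x) h * \<Psi> (Z (w, x))) = (LINT x|std_normal_distribution. \<Psi>' (Z (w, x)))"
      unfolding Zh
      by (rule std_normal_integration_by_parts[where C=C and m=m and C'=C' and m'=m'])
        (use d(5,6)[of y] 1 2 in \<open>simp_all add: Z\<close>)
  qed
  also have "\<dots> = (LINT w|M. \<Psi>' (\<lambda>k\<in>A. X k w))" using tr[OF d(2,4)] by simp
  finally show ?thesis .
qed

end

section \<open>Hermite polynomials of Gaussian variables\<close>

text \<open>One formula for both recursive equations: at \<open>n = 0\<close> the truncated
  \<open>n - 1\<close> is multiplied by 0.\<close>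

lemma hermite_Suc: "hermite (Suc n) x = x * hermite n x - real n * hermite (n - 1) x"
  by (cases n) simp_all

lemma smooth_along_hermite:
  assumes A: "finite A" and k: "k \<in> A"
  shows "smooth_along A v (\<lambda>x. hermite n (x k)) (\<lambda>x. real n * hermite (n - 1) (x k) * v k)"
proof (induction n rule: less_induct)
  case (less n)
  show ?case
  proof (cases n)
    case 0
    then show ?thesis by (simp add: smooth_along_const)
  next
    case (Suc m)
    have h: "hermite n (x k) = x k * hermite m (x k) + - real m * hermite (m - 1) (x k)" for x
      unfolding Suc hermite_Suc by simp
    \<comment> \<open>The right-hand side is what the product rule makes of the recurrence; a second
      use of the recurrence, one degree lower, collapses it.\<close>
    have d: "real n * hermite (n - 1) (x k) * v k =
        (v k * hermite m (x k) + x k * (real m * hermite (m - 1) (x k) * v k)) +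
        - real m * (real (m - 1) * hermite (m - 1 - 1) (x k) * v k)" for x
    proof (cases m)
      case 0
      then show ?thesis using Suc by simp
    next
      case (Suc j)
      have "x k * hermite j (x k) = hermite m (x k) + real j * hermite (j - 1) (x k)" unfolding Suc hermite_Suc by simp
      then have "x k * (real m * hermite (m - 1) (x k) * v k) = real m * v k * (hermite m (x k) + real j * hermite (j - 1) (x k))"
        using Suc by (simp add: mult_ac)
      moreover have "real n = real m + 1" "n - 1 = m" "m - 1 = j" "real (m - 1) = real j" using \<open>n = Suc m\<close> Suc by auto
      ultimately show ?thesis by (simp only:) (simp add: algebra_simps)
    qed
    show ?thesis unfolding h d
      by (intro smooth_along_add smooth_along_mult smooth_along_cmult smooth_along_coordinate A k less) (use Suc in auto)
  qed
qed

context isonormal begin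

lemma all_moments_hermite: "all_moments M (\<lambda>w. hermite n (X h w))"
proof (induction n rule: less_induct)
  case (less n)
  show ?case
  proof (cases n)
    case 0
    then show ?thesis by (simp add: all_moments_const)
  next
    case (Suc m)
    then show ?thesis
      by (cases m) (auto simp: hermite_Suc[of m] all_moments_Y
        intro!: all_moments_diff all_moments_mult all_moments_const all_moments_Y less)
  qed
qed

text \<open>Ordinary integration by parts of \<open>hermite n (X h w) * \<Psi>\<close> produces an
  extra term with \<open>n * hermite (n - 1)\<close>, and this is precisely what the recurrence
  subtracts. Hence one leg is removed from the polynomial without a combinatorial factor.\<close>

lemma hermite_integration_by_parts:
  assumes A: "finite A" and h: "h \<in> A" "norm h = 1"
    and s: "smooth_along A (\<lambda>k. h \<bullet> k) \<Psi> \<Psi>'"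
  shows "(LINT w|M. hermite (Suc n) (X h w) * \<Psi> (\<lambda>k\<in>A. X k w)) =
    (LINT w|M. hermite n (X h w) * \<Psi>' (\<lambda>k\<in>A. X k w))"
proof -
  have hh: "h \<bullet> h = 1" using h by (simp add: norm_eq_1)
  note d = smooth_alongD[OF s]
  note sm = smooth_along_mult[OF smooth_along_hermite[OF A h(1)] s]
  have am: "all_moments M (\<lambda>w. \<Psi> (\<lambda>k\<in>A. X k w))" "all_moments M (\<lambda>w. \<Psi>' (\<lambda>k\<in>A. X k w))"
    by (rule all_moments_poly_growth[OF A d(1,3)] all_moments_poly_growth[OF A d(2,4)])+
  have i: "integrable M (\<lambda>w. X h w * (hermite n (X h w) * \<Psi> (\<lambda>k\<in>A. X k w)))"
    "integrable M (\<lambda>w. hermite m (X h w) * \<Psi> (\<lambda>k\<in>A. X k w))"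
    "integrable M (\<lambda>w. hermite n (X h w) * \<Psi>' (\<lambda>k\<in>A. X k w))" for m
    by (intro all_moments_integrable all_moments_mult all_moments_Y all_moments_hermite am)+
  have "(LINT w|M. X h w * (hermite n (X h w) * \<Psi> (\<lambda>k\<in>A. X k w))) =
    (LINT w|M. real n * (hermite (n - 1) (X h w) * \<Psi> (\<lambda>k\<in>A. X k w)) + hermite n (X h w) * \<Psi>' (\<lambda>k\<in>A. X k w))"
    using integration_by_parts[OF A h sm, of n] h hh by (simp add: mult.assoc)
  also have "\<dots> = real n * (LINT w|M. hermite (n - 1) (X h w) * \<Psi> (\<lambda>k\<in>A. X k w)) + (LINT w|M. hermite n (X h w) * \<Psi>' (\<lambda>k\<in>A. X k w))"
    using i by simp
  moreover have "(LINT w|M. hermite (Suc n) (X h w) * \<Psi> (\<lambda>k\<in>A. X k w)) =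
      (LINT w|M. X h w * (hermite n (X h w) * \<Psi> (\<lambda>k\<in>A. X k w)) - real n * (hermite (n - 1) (X h w) * \<Psi> (\<lambda>k\<in>A. X k w)))"
    unfolding hermite_Suc by (simp add: left_diff_distrib mult.assoc)
  moreover have "\<dots> = (LINT w|M. X h w * (hermite n (X h w) * \<Psi> (\<lambda>k\<in>A. X k w))) - real n * (LINT w|M. hermite (n - 1) (X h w) * \<Psi> (\<lambda>k\<in>A. X k w))"
    using i by simp
  ultimately show ?thesis by simp
qed

text \<open>Each step removes one leg on both sides at the price of
  \<open>m * (h \<bullet> g)\<close>. If the degrees differ, a Hermite polynomial of positive degree
  is finally integrated against 1, which gives 0.\<close>

lemma expectation_hermite_hermite:
  assumes "norm h = 1" "norm g = 1"
  shows "(LINT w|M. hermite n (X h w) * hermite m (X g w)) = (if n = m then fact n * (h \<bullet> g) ^ n else 0)"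
proof (induction n arbitrary: m)
  case 0
  show ?case
  proof (cases m)
    case 0
    then show ?thesis by (simp add: prob_space)
  next
    case (Suc j)
    then show ?thesis
      using hermite_integration_by_parts[of "{g}" g "\<lambda>_. 1" "\<lambda>_. 0" j] assms smooth_along_const[of "{g}" "\<lambda>k. g \<bullet> k" 1] by simp
  qed
next
  case (Suc n)
  have "(LINT w|M. hermite (Suc n) (X h w) * hermite m (X g w)) =
      (LINT w|M. hermite n (X h w) * (real m * hermite (m - 1) (X g w) * (h \<bullet> g)))"
    using hermite_integration_by_parts[OF _ _ assms(1) smooth_along_hermite, of "{h, g}" g n m] by simp
  also have "\<dots> = real m * (h \<bullet> g) * (LINT w|M. hermite n (X h w) * hermite (m - 1) (X g w))"
    by (subst integral_mult_right_zero[symmetric]) (simp add: mult_ac)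
  finally show ?case unfolding Suc by (cases m) auto
qed

end

text \<open>The arguments of \<open>\<Lambda>\<close> count the edges 12, 13, 14, 23, 24, 34 of a diagram on four vertices; \<open>n1\<close>, ..., \<open>n4\<close>
  are the numbers of legs still to be paired.\<close>

fun diagram_sum :: "(nat \<Rightarrow> nat \<Rightarrow> nat \<Rightarrow> nat \<Rightarrow> nat \<Rightarrow> nat \<Rightarrow> real) \<Rightarrow> nat \<Rightarrow> nat \<Rightarrow> nat \<Rightarrow> nat \<Rightarrow> real" where
  "diagram_sum \<Lambda> (Suc n1) n2 n3 n4 =
     real n2 * diagram_sum (\<lambda>a b c d e f. \<Lambda> (Suc a) b c d e f) n1 (n2 - 1) n3 n4 +
     real n3 * diagram_sum (\<lambda>a b c d e f. \<Lambda> a (Suc b) c d e f) n1 n2 (n3 - 1) n4 +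
     real n4 * diagram_sum (\<lambda>a b c d e f. \<Lambda> a b (Suc c) d e f) n1 n2 n3 (n4 - 1)"
| "diagram_sum \<Lambda> 0 (Suc n2) n3 n4 =
     real n3 * diagram_sum (\<lambda>a b c d e f. \<Lambda> a b c (Suc d) e f) 0 n2 (n3 - 1) n4 +
     real n4 * diagram_sum (\<lambda>a b c d e f. \<Lambda> a b c d (Suc e) f) 0 n2 n3 (n4 - 1)"
| "diagram_sum \<Lambda> 0 0 (Suc n3) n4 =
     real n4 * diagram_sum (\<lambda>a b c d e f. \<Lambda> a b c d e (Suc f)) 0 0 n3 (n4 - 1)"
| "diagram_sum \<Lambda> 0 0 0 (Suc n4) = 0"
| "diagram_sum \<Lambda> 0 0 0 0 = \<Lambda> 0 0 0 0 0 0"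

text \<open>Linearity in \<open>\<Lambda>\<close>; it moves the finite sums over the vectors of a
  Hermite sum inside the diagrams.\<close>

lemma diagram_sum_sum:
  "diagram_sum (\<lambda>a b c d e f. \<Sum>i\<in>I. \<Lambda> i a b c d e f) n1 n2 n3 n4 = (\<Sum>i\<in>I. diagram_sum (\<Lambda> i) n1 n2 n3 n4)"
proof -
  \<comment> \<open>\<open>\<Lambda>'\<close> is a variable tied to the sum by an equation, because
    the recursion replaces it by shifted functions.\<close>
  have "diagram_sum \<Lambda>' n1 n2 n3 n4 = (\<Sum>i\<in>I. diagram_sum (\<Lambda> i) n1 n2 n3 n4)"
    if "\<Lambda>' = (\<lambda>a b c d e f. \<Sum>i\<in>I. \<Lambda> i a b c d e f)" for \<Lambda>'
    using that
    by (induction \<Lambda>' n1 n2 n3 n4 arbitrary: \<Lambda> rule: diagram_sum.induct)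
      (simp_all add: sum.distrib sum_distrib_left)
  then show ?thesis by blast
qed

text \<open>The premise \<open>0 < n\<close> matters: for \<open>n = 0\<close> the truncated leg
  count \<open>n - 1\<close> describes no diagram, but its term is multiplied by 0.\<close>

lemma abs_multiple_le: "(0 < n \<Longrightarrow> \<bar>x\<bar> \<le> y) \<Longrightarrow> \<bar>real n * x\<bar> \<le> real n * y"
  by (cases n) (simp_all add: abs_mult mult_left_mono)

text \<open>For constant \<open>\<Lambda> = 1\<close> the recursion counts the complete pairings
  without loops, and each of them contributes at most \<open>\<epsilon>\<close>. The bound is asked
  only for exponents with the correct row sums, since no others are reached.\<close>

lemma diagram_sum_bound:
  assumes "\<And>a b c d e f. a + b + c = n1 \<Longrightarrow> a + d + e = n2 \<Longrightarrow> b + d + f = n3 \<Longrightarrow> c + e + f = n4 \<Longrightarrow>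
      \<bar>\<Lambda> a b c d e f\<bar> \<le> \<epsilon>"
  shows "\<bar>diagram_sum \<Lambda> n1 n2 n3 n4\<bar> \<le> diagram_sum (\<lambda>_ _ _ _ _ _. 1) n1 n2 n3 n4 * \<epsilon>"
  using assms
proof (induction \<Lambda> n1 n2 n3 n4 rule: diagram_sum.induct)
  case (1 \<Lambda> n1 n2 n3 n4)
  have "\<bar>real n2 * diagram_sum (\<lambda>a b c d e f. \<Lambda> (Suc a) b c d e f) n1 (n2 - 1) n3 n4\<bar> \<le>
      real n2 * (diagram_sum (\<lambda>_ _ _ _ _ _. 1) n1 (n2 - 1) n3 n4 * \<epsilon>)"
    by (rule abs_multiple_le, rule 1(1), rule 1(4)) simp_all
  moreover have "\<bar>real n3 * diagram_sum (\<lambda>a b c d e f. \<Lambda> a (Suc b) c d e f) n1 n2 (n3 - 1) n4\<bar> \<le>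
      real n3 * (diagram_sum (\<lambda>_ _ _ _ _ _. 1) n1 n2 (n3 - 1) n4 * \<epsilon>)"
    by (rule abs_multiple_le, rule 1(2), rule 1(4)) simp_all
  moreover have "\<bar>real n4 * diagram_sum (\<lambda>a b c d e f. \<Lambda> a b (Suc c) d e f) n1 n2 n3 (n4 - 1)\<bar> \<le>
      real n4 * (diagram_sum (\<lambda>_ _ _ _ _ _. 1) n1 n2 n3 (n4 - 1) * \<epsilon>)"
    by (rule abs_multiple_le, rule 1(3), rule 1(4)) simp_all
  ultimately show ?case by (simp add: distrib_right mult.assoc) linarith
next
  case (2 \<Lambda> n2 n3 n4)
  have "\<bar>real n3 * diagram_sum (\<lambda>a b c d e f. \<Lambda> a b c (Suc d) e f) 0 n2 (n3 - 1) n4\<bar> \<le>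
      real n3 * (diagram_sum (\<lambda>_ _ _ _ _ _. 1) 0 n2 (n3 - 1) n4 * \<epsilon>)"
    by (rule abs_multiple_le, rule 2(1), rule 2(3)) simp_all
  moreover have "\<bar>real n4 * diagram_sum (\<lambda>a b c d e f. \<Lambda> a b c d (Suc e) f) 0 n2 n3 (n4 - 1)\<bar> \<le>
      real n4 * (diagram_sum (\<lambda>_ _ _ _ _ _. 1) 0 n2 n3 (n4 - 1) * \<epsilon>)"
    by (rule abs_multiple_le, rule 2(2), rule 2(3)) simp_all
  ultimately show ?case by (simp add: distrib_right mult.assoc) linarith
next
  case (3 \<Lambda> n3 n4)
  have "\<bar>real n4 * diagram_sum (\<lambda>a b c d e f. \<Lambda> a b c d e (Suc f)) 0 0 n3 (n4 - 1)\<bar> \<le>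
      real n4 * (diagram_sum (\<lambda>_ _ _ _ _ _. 1) 0 0 n3 (n4 - 1) * \<epsilon>)"
    by (rule abs_multiple_le, rule 3(1), rule 3(2)) simp_all
  then show ?case by (simp add: mult.assoc)
next
  case (5 \<Lambda>)
  then show ?case using 5[of 0 0 0 0 0 0] by simp
qed simp

text \<open>Without edges between the pairs 12 and 34 a pairing exists only for
  \<open>n1 = n2\<close> and \<open>n3 = n4\<close>; there are \<open>fact n1 * fact n3\<close> of
  them. While legs of vertex 1 are joined to vertex 2 the exceptional term survives; after the first
  edge to vertex 3 or 4 every completion crosses and \<open>diagram_sum_bound\<close> takes
  over.\<close>

lemma diagram_sum_cross_bound:
  assumes "\<And>a b c d e f. a + b + c = n1 \<Longrightarrow> a + d + e = n2 \<Longrightarrow> b + d + f = n3 \<Longrightarrow> c + e + f = n4 \<Longrightarrow>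
      b + c + d + e > 0 \<Longrightarrow> \<bar>\<Lambda> a b c d e f\<bar> \<le> \<epsilon>" and "0 \<le> \<epsilon>"
  shows "\<bar>diagram_sum \<Lambda> n1 n2 n3 n4 -
      (if n1 = n2 \<and> n3 = n4 then fact n1 * fact n3 * \<Lambda> n1 0 0 0 0 n3 else 0)\<bar>
    \<le> diagram_sum (\<lambda>_ _ _ _ _ _. 1) n1 n2 n3 n4 * \<epsilon>"
  using assms(1)
proof (induction \<Lambda> n1 n2 n3 n4 rule: diagram_sum.induct)
  case (1 \<Lambda> n1 n2 n3 n4)
  have "\<bar>real n2 * diagram_sum (\<lambda>a b c d e f. \<Lambda> (Suc a) b c d e f) n1 (n2 - 1) n3 n4 -
       (if Suc n1 = n2 \<and> n3 = n4 then fact (Suc n1) * fact n3 * \<Lambda> (Suc n1) 0 0 0 0 n3 else 0)\<bar> \<le>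
      real n2 * (diagram_sum (\<lambda>_ _ _ _ _ _. 1) n1 (n2 - 1) n3 n4 * \<epsilon>)"
  proof (cases n2)
    case (Suc m)
    have "\<bar>diagram_sum (\<lambda>a b c d e f. \<Lambda> (Suc a) b c d e f) n1 (n2 - 1) n3 n4 -
       (if n1 = n2 - 1 \<and> n3 = n4 then fact n1 * fact n3 * \<Lambda> (Suc n1) 0 0 0 0 n3 else 0)\<bar> \<le>
      diagram_sum (\<lambda>_ _ _ _ _ _. 1) n1 (n2 - 1) n3 n4 * \<epsilon>"
      by (intro 1) (use Suc in \<open>auto intro!: 1(4)\<close>)
    then have "real n2 * \<bar>diagram_sum (\<lambda>a b c d e f. \<Lambda> (Suc a) b c d e f) n1 (n2 - 1) n3 n4 -
       (if n1 = n2 - 1 \<and> n3 = n4 then fact n1 * fact n3 * \<Lambda> (Suc n1) 0 0 0 0 n3 else 0)\<bar> \<le>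
      real n2 * (diagram_sum (\<lambda>_ _ _ _ _ _. 1) n1 (n2 - 1) n3 n4 * \<epsilon>)"
      by (intro mult_left_mono) auto
    moreover have "real n2 * \<bar>x\<bar> = \<bar>real n2 * x\<bar>" for x by (simp add: abs_mult)
    \<comment> \<open>If \<open>n2 = Suc n1\<close>, the factor \<open>n2\<close> completes
      \<open>fact n1\<close> to \<open>fact (Suc n1)\<close>.\<close>
    moreover have "real n2 * (if n1 = n2 - 1 \<and> n3 = n4 then fact n1 * fact n3 * \<Lambda> (Suc n1) 0 0 0 0 n3 else 0) =
      (if Suc n1 = n2 \<and> n3 = n4 then fact (Suc n1) * fact n3 * \<Lambda> (Suc n1) 0 0 0 0 n3 else 0)"
      using Suc by auto
    ultimately show ?thesis by (simp only: right_diff_distrib)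
  qed simp
  moreover have "\<bar>real n3 * diagram_sum (\<lambda>a b c d e f. \<Lambda> a (Suc b) c d e f) n1 n2 (n3 - 1) n4\<bar> \<le>
      real n3 * (diagram_sum (\<lambda>_ _ _ _ _ _. 1) n1 n2 (n3 - 1) n4 * \<epsilon>)"
    by (rule abs_multiple_le, rule diagram_sum_bound, rule 1(4)) simp_all
  moreover have "\<bar>real n4 * diagram_sum (\<lambda>a b c d e f. \<Lambda> a b (Suc c) d e f) n1 n2 n3 (n4 - 1)\<bar> \<le>
      real n4 * (diagram_sum (\<lambda>_ _ _ _ _ _. 1) n1 n2 n3 (n4 - 1) * \<epsilon>)"
    by (rule abs_multiple_le, rule diagram_sum_bound, rule 1(4)) simp_all
  ultimately show ?case unfolding diagram_sum.simps distrib_right mult.assoc by linarith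
next
  case (2 \<Lambda> n2 n3 n4)
  have "\<bar>real n3 * diagram_sum (\<lambda>a b c d e f. \<Lambda> a b c (Suc d) e f) 0 n2 (n3 - 1) n4\<bar> \<le>
      real n3 * (diagram_sum (\<lambda>_ _ _ _ _ _. 1) 0 n2 (n3 - 1) n4 * \<epsilon>)"
    by (rule abs_multiple_le, rule diagram_sum_bound, rule 2(3)) simp_all
  moreover have "\<bar>real n4 * diagram_sum (\<lambda>a b c d e f. \<Lambda> a b c d (Suc e) f) 0 n2 n3 (n4 - 1)\<bar> \<le>
      real n4 * (diagram_sum (\<lambda>_ _ _ _ _ _. 1) 0 n2 n3 (n4 - 1) * \<epsilon>)"
    by (rule abs_multiple_le, rule diagram_sum_bound, rule 2(3)) simp_all
  ultimately show ?case unfolding diagram_sum.simps distrib_right mult.assoc by simp linarith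
next
  case (3 \<Lambda> n3 n4)
  show ?case
  proof (cases n4)
    case (Suc m)
    have "\<bar>diagram_sum (\<lambda>a b c d e f. \<Lambda> a b c d e (Suc f)) 0 0 n3 (n4 - 1) -
       (if (0::nat) = 0 \<and> n3 = n4 - 1 then fact 0 * fact n3 * \<Lambda> 0 0 0 0 0 (Suc n3) else 0)\<bar> \<le>
      diagram_sum (\<lambda>_ _ _ _ _ _. 1) 0 0 n3 (n4 - 1) * \<epsilon>"
      by (intro 3) (use Suc in \<open>auto intro!: 3(2)\<close>)
    then have "real n4 * \<bar>diagram_sum (\<lambda>a b c d e f. \<Lambda> a b c d e (Suc f)) 0 0 n3 (n4 - 1) -
       (if (0::nat) = 0 \<and> n3 = n4 - 1 then fact 0 * fact n3 * \<Lambda> 0 0 0 0 0 (Suc n3) else 0)\<bar> \<le>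
      real n4 * (diagram_sum (\<lambda>_ _ _ _ _ _. 1) 0 0 n3 (n4 - 1) * \<epsilon>)"
      by (intro mult_left_mono) auto
    moreover have "real n4 * \<bar>x\<bar> = \<bar>real n4 * x\<bar>" for x by (simp add: abs_mult)
    moreover have "real n4 * (if (0::nat) = 0 \<and> n3 = n4 - 1 then fact 0 * fact n3 * \<Lambda> 0 0 0 0 0 (Suc n3) else 0) =
      (if (0::nat) = 0 \<and> Suc n3 = n4 then fact 0 * fact (Suc n3) * \<Lambda> 0 0 0 0 0 (Suc n3) else 0)"
      using Suc by auto
    ultimately show ?thesis unfolding diagram_sum.simps mult.assoc by (simp only: right_diff_distrib)
  qed simp
qed (use assms(2) in simp_all)

context isonormal begin

definition hermite_moment4 :: "nat \<Rightarrow> 'h \<Rightarrow> nat \<Rightarrow> 'h \<Rightarrow> nat \<Rightarrow> 'h \<Rightarrow> nat \<Rightarrow> 'h \<Rightarrow> real" where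
  "hermite_moment4 n1 h1 n2 h2 n3 h3 n4 h4 =
    (LINT w|M. hermite n1 (X h1 w) * (hermite n2 (X h2 w) * hermite n3 (X h3 w) * hermite n4 (X h4 w)))"

lemma hermite_moment4_Suc:
  assumes "norm h1 = 1"
  shows "hermite_moment4 (Suc n1) h1 n2 h2 n3 h3 n4 h4 =
    real n2 * (h1 \<bullet> h2) * hermite_moment4 n1 h1 (n2 - 1) h2 n3 h3 n4 h4 +
    real n3 * (h1 \<bullet> h3) * hermite_moment4 n1 h1 n2 h2 (n3 - 1) h3 n4 h4 +
    real n4 * (h1 \<bullet> h4) * hermite_moment4 n1 h1 n2 h2 n3 h3 (n4 - 1) h4"
proof -
  let ?A = "{h1, h2, h3, h4}"
  have i: "integrable M (\<lambda>w. hermite n1 (X h1 w) * (hermite n2 (X h2 w) * hermite n3 (X h3 w) * hermite n4 (X h4 w)))" for n1 n2 n3 n4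
    by (intro all_moments_integrable all_moments_mult all_moments_hermite)
  have s: "smooth_along ?A (\<lambda>k. h1 \<bullet> k) (\<lambda>x. hermite n2 (x h2) * hermite n3 (x h3) * hermite n4 (x h4))
     (\<lambda>x. (real n2 * hermite (n2 - 1) (x h2) * (h1 \<bullet> h2) * hermite n3 (x h3) + hermite n2 (x h2) * (real n3 * hermite (n3 - 1) (x h3) * (h1 \<bullet> h3))) * hermite n4 (x h4)
        + (hermite n2 (x h2) * hermite n3 (x h3)) * (real n4 * hermite (n4 - 1) (x h4) * (h1 \<bullet> h4)))"
    by (intro smooth_along_mult smooth_along_hermite) auto
  have "hermite_moment4 (Suc n1) h1 n2 h2 n3 h3 n4 h4 =
     (LINT w|M. real n2 * (h1 \<bullet> h2) * (hermite n1 (X h1 w) * (hermite (n2 - 1) (X h2 w) * hermite n3 (X h3 w) * hermite n4 (X h4 w))) +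
       real n3 * (h1 \<bullet> h3) * (hermite n1 (X h1 w) * (hermite n2 (X h2 w) * hermite (n3 - 1) (X h3 w) * hermite n4 (X h4 w))) +
       real n4 * (h1 \<bullet> h4) * (hermite n1 (X h1 w) * (hermite n2 (X h2 w) * hermite n3 (X h3 w) * hermite (n4 - 1) (X h4 w))))"
    unfolding hermite_moment4_def
    using hermite_integration_by_parts[OF _ _ assms s, of n1] by (simp add: algebra_simps)
  also have "\<dots> = real n2 * (h1 \<bullet> h2) * hermite_moment4 n1 h1 (n2 - 1) h2 n3 h3 n4 h4 +
    real n3 * (h1 \<bullet> h3) * hermite_moment4 n1 h1 n2 h2 (n3 - 1) h3 n4 h4 +
    real n4 * (h1 \<bullet> h4) * hermite_moment4 n1 h1 n2 h2 n3 h3 (n4 - 1) h4"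
    unfolding hermite_moment4_def using i by simp
  finally show ?thesis .
qed

text \<open>When the first vertex has no legs left, the next one is moved to the place on which
  integration by parts acts.\<close>

lemma hermite_moment4_rotate: "hermite_moment4 n1 h1 n2 h2 n3 h3 n4 h4 = hermite_moment4 n2 h2 n3 h3 n4 h4 n1 h1"
  unfolding hermite_moment4_def by (simp add: mult_ac)

text \<open>The diagram formula (Wick's theorem) for four Hermite polynomials; every integration by
  parts draws one edge. The offsets \<open>a0\<close>, ..., \<open>f0\<close> stand for edges
  present from the start, such as the explicit inner products in
  \<open>malliavin_product\<close>.\<close>

lemma hermite_moment4_eq_diagram_sum:
  assumes h: "norm h1 = 1" "norm h2 = 1" "norm h3 = 1" "norm h4 = 1"
  shows "s * (h1 \<bullet> h2) ^ a0 * (h1 \<bullet> h3) ^ b0 * (h1 \<bullet> h4) ^ c0 * (h2 \<bullet> h3) ^ d0 * (h2 \<bullet> h4) ^ e0 * (h3 \<bullet> h4) ^ f0 *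
      hermite_moment4 n1 h1 n2 h2 n3 h3 n4 h4 =
    diagram_sum (\<lambda>a b c d e f. s * (h1 \<bullet> h2) ^ (a + a0) * (h1 \<bullet> h3) ^ (b + b0) * (h1 \<bullet> h4) ^ (c + c0) *
      (h2 \<bullet> h3) ^ (d + d0) * (h2 \<bullet> h4) ^ (e + e0) * (h3 \<bullet> h4) ^ (f + f0)) n1 n2 n3 n4"
proof -
  \<comment> \<open>Drawing an edge only multiplies the scalar \<open>s\<close>, so this family is
    closed under the shifts in the recursion.\<close>
  define \<Lambda> where "\<Lambda> s = (\<lambda>a b c d e f. s * (h1 \<bullet> h2) ^ a * (h1 \<bullet> h3) ^ b * (h1 \<bullet> h4) ^ c *
      (h2 \<bullet> h3) ^ d * (h2 \<bullet> h4) ^ e * (h3 \<bullet> h4) ^ f)" for s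
  have main: "diagram_sum \<Lambda>' n1 n2 n3 n4 = s * hermite_moment4 n1 h1 n2 h2 n3 h3 n4 h4"
    if "\<Lambda>' = \<Lambda> s" for \<Lambda>' s
    using that
  proof (induction \<Lambda>' n1 n2 n3 n4 arbitrary: s rule: diagram_sum.induct)
    case (1 \<Lambda>' n1 n2 n3 n4)
    have "(\<lambda>a b c d e f. \<Lambda>' (Suc a) b c d e f) = \<Lambda> (s * (h1 \<bullet> h2))"
      "(\<lambda>a b c d e f. \<Lambda>' a (Suc b) c d e f) = \<Lambda> (s * (h1 \<bullet> h3))"
      "(\<lambda>a b c d e f. \<Lambda>' a b (Suc c) d e f) = \<Lambda> (s * (h1 \<bullet> h4))"
      unfolding 1 \<Lambda>_def by (simp_all add: mult_ac fun_eq_iff)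
    then show ?case unfolding diagram_sum.simps hermite_moment4_Suc[OF h(1)]
      using 1(1)[of "s * (h1 \<bullet> h2)"] 1(2)[of "s * (h1 \<bullet> h3)"] 1(3)[of "s * (h1 \<bullet> h4)"] by (simp add: algebra_simps)
  next
    case (2 \<Lambda>' n2 n3 n4)
    have "(\<lambda>a b c d e f. \<Lambda>' a b c (Suc d) e f) = \<Lambda> (s * (h2 \<bullet> h3))"
      "(\<lambda>a b c d e f. \<Lambda>' a b c d (Suc e) f) = \<Lambda> (s * (h2 \<bullet> h4))"
      unfolding 2 \<Lambda>_def by (simp_all add: mult_ac fun_eq_iff)
    then show ?case unfolding diagram_sum.simps hermite_moment4_rotate[of 0 h1] hermite_moment4_Suc[OF h(2)]
      using 2(1)[of "s * (h2 \<bullet> h3)"] 2(2)[of "s * (h2 \<bullet> h4)"]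
      by (simp add: algebra_simps hermite_moment4_rotate[of 0 h1])
  next
    case (3 \<Lambda>' n3 n4)
    have "(\<lambda>a b c d e f. \<Lambda>' a b c d e (Suc f)) = \<Lambda> (s * (h3 \<bullet> h4))"
      unfolding 3 \<Lambda>_def by (simp_all add: mult_ac fun_eq_iff)
    then show ?case
      unfolding diagram_sum.simps hermite_moment4_rotate[of 0 h1] hermite_moment4_rotate[of 0 h2] hermite_moment4_Suc[OF h(3)]
      using 3(1)[of "s * (h3 \<bullet> h4)"]
      by (simp add: algebra_simps hermite_moment4_rotate[of 0 h1] hermite_moment4_rotate[of 0 h2])
  next
    case (4 \<Lambda>' n4)
    show ?case
      unfolding diagram_sum.simps hermite_moment4_rotate[of 0 h1] hermite_moment4_rotate[of 0 h2]
        hermite_moment4_rotate[of 0 h3] hermite_moment4_Suc[OF h(4)] by simp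
  next
    case (5 \<Lambda>')
    then show ?case by (simp add: \<Lambda>_def hermite_moment4_def prob_space)
  qed
  show ?thesis
  proof -
    let ?S = "s * (h1 \<bullet> h2) ^ a0 * (h1 \<bullet> h3) ^ b0 * (h1 \<bullet> h4) ^ c0 * (h2 \<bullet> h3) ^ d0 * (h2 \<bullet> h4) ^ e0 * (h3 \<bullet> h4) ^ f0"
    have "(\<lambda>a b c d e f. s * (h1 \<bullet> h2) ^ (a + a0) * (h1 \<bullet> h3) ^ (b + b0) * (h1 \<bullet> h4) ^ (c + c0) *
      (h2 \<bullet> h3) ^ (d + d0) * (h2 \<bullet> h4) ^ (e + e0) * (h3 \<bullet> h4) ^ (f + f0)) = \<Lambda> ?S"
      by (simp add: \<Lambda>_def power_add mult_ac fun_eq_iff)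
    from main[OF this] show ?thesis by simp
  qed
qed

end

section \<open>A Stein bound for characteristic functions\<close>

lemma iexp_second_order:
  "cmod (iexp b - iexp a - \<i> * (b - a) * iexp a) \<le> (b - a)\<^sup>2"
proof -
  have "cmod (iexp (b - a) - (\<Sum>k\<le>1. (\<i> * complex_of_real (b - a)) ^ k / fact k)) \<le> \<bar>b - a\<bar> ^ Suc 1 / fact (Suc 1)"
    by (rule iexp_approx1)
  then have "cmod (iexp (b - a) - 1 - \<i> * (b - a)) \<le> (b - a)\<^sup>2 / 2"
    by (simp add: power2_eq_square diff_diff_eq)
  also have "\<dots> \<le> (b - a)\<^sup>2" by simp
  finally have 1: "cmod (iexp (b - a) - 1 - \<i> * (b - a)) \<le> (b - a)\<^sup>2" .
  have "iexp b = iexp a * iexp (b - a)" by (simp add: exp_add[symmetric] algebra_simps)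
  then have "iexp b - iexp a - \<i> * (b - a) * iexp a = iexp a * (iexp (b - a) - 1 - \<i> * (b - a))"
    by (simp add: algebra_simps)
  then show ?thesis using 1 by (simp add: norm_mult)
qed

text \<open>The pairs \<open>(cos, - sin)\<close> and \<open>(sin, cos)\<close> in the form in which
  a function and its derivative enter \<open>DERIV_expectation\<close>.\<close>

lemma cos_sin_second_order:
  fixes a b :: real
  shows "\<bar>cos b - cos a - (b - a) * (- sin a)\<bar> \<le> (b - a)\<^sup>2"
    and "\<bar>sin b - sin a - (b - a) * cos a\<bar> \<le> (b - a)\<^sup>2"
proof -
  have e: "iexp b - iexp a - \<i> * (b - a) * iexp a =
      Complex (cos b - cos a - (b - a) * (- sin a)) (sin b - sin a - (b - a) * cos a)"
    by (simp add: complex_eq_iff Re_exp Im_exp)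
  show "\<bar>cos b - cos a - (b - a) * (- sin a)\<bar> \<le> (b - a)\<^sup>2"
    using abs_Re_le_cmod[of "iexp b - iexp a - \<i> * (b - a) * iexp a"] iexp_second_order[of b a]
    unfolding e by simp
  show "\<bar>sin b - sin a - (b - a) * cos a\<bar> \<le> (b - a)\<^sup>2"
    using abs_Im_le_cmod[of "iexp b - iexp a - \<i> * (b - a) * iexp a"] iexp_second_order[of b a]
    unfolding e by simp
qed

lemma DERIV_of_quadratic_remainder:
  fixes f :: "real \<Rightarrow> real"
  assumes "\<And>s. \<bar>f s - f t - (s - t) * L\<bar> \<le> K * (s - t)\<^sup>2"
  shows "(f has_real_derivative L) (at t)"
  unfolding has_field_derivative_iff
proof (rule Lim_transform2[OF tendsto_const])
  show "((\<lambda>s. L - (f s - f t) / (s - t)) \<longlongrightarrow> 0) (at t)"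
  proof (rule Lim_null_comparison)
    show "((\<lambda>s. K * \<bar>s - t\<bar>) \<longlongrightarrow> 0) (at t)" by (auto intro!: tendsto_eq_intros)
    show "\<forall>\<^sub>F s in at t. norm (L - (f s - f t) / (s - t)) \<le> K * \<bar>s - t\<bar>"
      unfolding eventually_at_filter
    proof (intro always_eventually allI impI)
      fix s assume st: "s \<noteq> t"
      have "norm (L - (f s - f t) / (s - t)) = \<bar>f s - f t - (s - t) * L\<bar> / \<bar>s - t\<bar>"
      proof -
        have "(f s - f t) / (s - t) - L = (f s - f t - (s - t) * L) / (s - t)" using st by (simp add: diff_divide_distrib)
        then show ?thesis unfolding abs_divide[symmetric] real_norm_def by (metis abs_minus_commute)
      qed
      also have "\<dots> \<le> K * (s - t)\<^sup>2 / \<bar>s - t\<bar>" using assms by (intro divide_right_mono) auto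
      also have "(s - t)\<^sup>2 = \<bar>s - t\<bar> * \<bar>s - t\<bar>" by (simp add: power2_eq_square)
      also have "K * (\<bar>s - t\<bar> * \<bar>s - t\<bar>) / \<bar>s - t\<bar> = K * \<bar>s - t\<bar>" using st by (simp del: abs_mult_self_eq)
      finally show "norm (L - (f s - f t) / (s - t)) \<le> K * \<bar>s - t\<bar>" .
    qed
  qed
qed

text \<open>The Taylor remainder at \<open>w\<close> is at most
  \<open>(s - t)\<^sup>2 * (Z w)\<^sup>2\<close>. Integrating it leaves a multiple of
  \<open>(s - t)\<^sup>2\<close>, and differentiability follows without exchanging a limit with the
  expectation.\<close>

lemma (in prob_space) DERIV_expectation:
  assumes Z: "all_moments M Z"
    and g: "\<And>a b. \<bar>g b - g a - (b - a) * g' a\<bar> \<le> (b - a)\<^sup>2" and b: "\<And>x. \<bar>g x\<bar> \<le> 1" "\<And>x. \<bar>g' x\<bar> \<le> 1"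
    and [measurable]: "g \<in> borel_measurable borel" "g' \<in> borel_measurable borel"
  shows "((\<lambda>t. LINT w|M. g (t * Z w)) has_real_derivative (LINT w|M. Z w * g' (t * Z w))) (at t)"
proof (rule DERIV_of_quadratic_remainder)
  fix s
  have [measurable]: "Z \<in> borel_measurable M" using Z by (rule all_moments_measurable)
  have i: "integrable M (\<lambda>w. g (s * Z w))" for s
  proof (rule integrable_const_bound)
    show "AE w in M. norm (g (s * Z w)) \<le> 1" by (simp add: b)
  qed measurable
  have "all_moments M (\<lambda>w. Z w * g' (t * Z w))"
  proof (rule all_moments_bound[OF Z])
    show "\<bar>Z w * g' (t * Z w)\<bar> \<le> \<bar>Z w\<bar>" for w
      unfolding abs_mult by (rule mult_left_le[OF b(2) abs_ge_zero])
  qed measurable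
  then have i': "integrable M (\<lambda>w. Z w * g' (t * Z w))" by (rule all_moments_integrable)
  have i2: "integrable M (\<lambda>w. (Z w)\<^sup>2)" by (rule all_moments_integrable[OF all_moments_power[OF Z]])
  have "\<bar>(LINT w|M. g (s * Z w)) - (LINT w|M. g (t * Z w)) - (s - t) * (LINT w|M. Z w * g' (t * Z w))\<bar> =
    \<bar>LINT w|M. g (s * Z w) - g (t * Z w) - (s - t) * (Z w * g' (t * Z w))\<bar>"
    using i i' by simp
  also have "\<dots> \<le> (LINT w|M. \<bar>g (s * Z w) - g (t * Z w) - (s - t) * (Z w * g' (t * Z w))\<bar>)"
    by (rule integral_abs_bound)
  also have "\<dots> \<le> (LINT w|M. (s - t)\<^sup>2 * (Z w)\<^sup>2)"
  proof (rule integral_mono)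
    show "\<bar>g (s * Z w) - g (t * Z w) - (s - t) * (Z w * g' (t * Z w))\<bar> \<le> (s - t)\<^sup>2 * (Z w)\<^sup>2" for w
      using g[of "s * Z w" "t * Z w"] unfolding left_diff_distrib[symmetric] power_mult_distrib mult.assoc .
    show "integrable M (\<lambda>w. \<bar>g (s * Z w) - g (t * Z w) - (s - t) * (Z w * g' (t * Z w))\<bar>)"
      by (intro integrable_abs Bochner_Integration.integrable_diff integrable_mult_right i i')
    show "integrable M (\<lambda>w. (s - t)\<^sup>2 * (Z w)\<^sup>2)" by (intro integrable_mult_right i2)
  qed
  also have "\<dots> = (LINT w|M. (Z w)\<^sup>2) * (s - t)\<^sup>2" by simp
  finally show "\<bar>(LINT w|M. g (s * Z w)) - (LINT w|M. g (t * Z w)) - (s - t) * (LINT w|M. Z w * g' (t * Z w))\<bar> \<le>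
    (LINT w|M. (Z w)\<^sup>2) * (s - t)\<^sup>2" .
qed

text \<open>With \<open>C t\<close> the expectation of \<open>g (t * Z)\<close>, the function \<open>exp (v t\<^sup>2 / 2) * C t\<close> has derivative
  \<open>t * exp (v t\<^sup>2 / 2)\<close> times the expectation of \<open>(v - \<Gamma>) * g (t * Z)\<close>.\<close>

lemma (in prob_space) stein_ode_bound:
  assumes Z: "all_moments M Z" and \<Gamma>: "all_moments M \<Gamma>" and v: "0 \<le> v"
    and g: "\<And>a b. \<bar>g b - g a - (b - a) * g' a\<bar> \<le> (b - a)\<^sup>2" and b: "\<And>x. \<bar>g x\<bar> \<le> 1" "\<And>x. \<bar>g' x\<bar> \<le> 1"
    and [measurable]: "g \<in> borel_measurable borel" "g' \<in> borel_measurable borel"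
    and s: "\<And>t. (LINT w|M. Z w * g' (t * Z w)) = - t * (LINT w|M. g (t * Z w) * \<Gamma> w)"
  shows "\<bar>(LINT w|M. g (Z w)) - exp (- v / 2) * g 0\<bar> \<le> (LINT w|M. \<bar>\<Gamma> w - v\<bar>)"
proof -
  have [measurable]: "Z \<in> borel_measurable M" "\<Gamma> \<in> borel_measurable M" using Z \<Gamma> by (auto intro: all_moments_measurable)
  define C where "C t = (LINT w|M. g (t * Z w))" for t
  define D where "D = (LINT w|M. \<bar>\<Gamma> w - v\<bar>)"
  have D0: "0 \<le> D" unfolding D_def by simp
  have iG: "integrable M (\<lambda>w. \<Gamma> w - v)" using \<Gamma> by (intro all_moments_integrable all_moments_diff all_moments_const)
  have ig: "integrable M (\<lambda>w. g (t * Z w))" for t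
  proof (rule integrable_const_bound)
    show "AE w in M. norm (g (t * Z w)) \<le> 1" by (simp add: b)
  qed measurable
  have igG: "integrable M (\<lambda>w. g (t * Z w) * \<Gamma> w)" for t
  proof (rule all_moments_integrable, rule all_moments_bound[OF \<Gamma>])
    show "\<bar>g (t * Z w) * \<Gamma> w\<bar> \<le> \<bar>\<Gamma> w\<bar>" for w
      unfolding abs_mult by (rule mult_left_le_one_le[OF abs_ge_zero abs_ge_zero b(1)])
  qed measurable
  have dC: "(C has_real_derivative - t * (LINT w|M. g (t * Z w) * \<Gamma> w)) (at t)" for t
    using DERIV_expectation[OF Z g b, of t] unfolding C_def s by simp
  define E where "E t = (LINT w|M. g (t * Z w) * (v - \<Gamma> w))" for t
  have E: "E t = v * C t - (LINT w|M. g (t * Z w) * \<Gamma> w)" for t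
  proof -
    have "E t = (LINT w|M. v * g (t * Z w) - g (t * Z w) * \<Gamma> w)"
      unfolding E_def by (simp only: right_diff_distrib mult.commute[of v])
    then show ?thesis unfolding C_def using ig igG by simp
  qed
  have dF: "((\<lambda>t. exp (v * t\<^sup>2 / 2) * C t) has_real_derivative t * exp (v * t\<^sup>2 / 2) * E t) (at t)" for t
  proof -
    have "((\<lambda>t. exp (v * t\<^sup>2 / 2)) has_real_derivative exp (v * t\<^sup>2 / 2) * (v * t)) (at t)"
      by (auto intro!: derivative_eq_intros)
    from DERIV_mult[OF this dC[of t]] show ?thesis unfolding E by (simp add: algebra_simps)
  qed
  \<comment> \<open>The mean value theorem on \<open>[0, 1]\<close>. Since \<open>z < 1\<close> and
    \<open>v \<ge> 0\<close>, the factor \<open>z * exp (v * z\<^sup>2 / 2)\<close> is at most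
    \<open>exp (v / 2)\<close>, which cancels at the end.\<close>
  have "\<exists>z>0. z < 1 \<and> exp (v * 1\<^sup>2 / 2) * C 1 - exp (v * 0\<^sup>2 / 2) * C 0 = (1 - 0) * (z * exp (v * z\<^sup>2 / 2) * E z)"
    by (rule MVT2) (use dF in auto)
  then obtain z where z: "0 < z" "z < 1" and eq: "exp (v / 2) * C 1 - C 0 = z * exp (v * z\<^sup>2 / 2) * E z" by auto
  have "\<bar>E z\<bar> \<le> (LINT w|M. \<bar>g (z * Z w) * (v - \<Gamma> w)\<bar>)" unfolding E_def by (rule integral_abs_bound)
  also have "\<dots> \<le> D" unfolding D_def
  proof (rule integral_mono)
    show "\<bar>g (z * Z w) * (v - \<Gamma> w)\<bar> \<le> \<bar>\<Gamma> w - v\<bar>" for w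
      unfolding abs_mult abs_minus_commute[of "\<Gamma> w" v] by (rule mult_left_le_one_le[OF abs_ge_zero abs_ge_zero b(1)])
    have "integrable M (\<lambda>w. g (z * Z w) * v - g (z * Z w) * \<Gamma> w)"
      by (intro Bochner_Integration.integrable_diff integrable_mult_left igG ig)
    then show "integrable M (\<lambda>w. \<bar>g (z * Z w) * (v - \<Gamma> w)\<bar>)"
      unfolding right_diff_distrib by (rule integrable_abs)
    show "integrable M (\<lambda>w. \<bar>\<Gamma> w - v\<bar>)" using iG by (rule integrable_abs)
  qed
  finally have Ez: "\<bar>E z\<bar> \<le> D" .
  have "z\<^sup>2 \<le> 1" using z by (simp add: power_le_one)
  then have "v * z\<^sup>2 \<le> v * 1" using v by (intro mult_left_mono)
  then have "z * exp (v * z\<^sup>2 / 2) * \<bar>E z\<bar> \<le> 1 * exp (v / 2) * D"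
    using z Ez D0 by (intro mult_mono) auto
  then have "\<bar>exp (v / 2) * C 1 - C 0\<bar> \<le> exp (v / 2) * D" unfolding eq using z by (simp add: abs_mult)
  then have "exp (- v / 2) * \<bar>exp (v / 2) * C 1 - C 0\<bar> \<le> exp (- v / 2) * (exp (v / 2) * D)"
    by (intro mult_left_mono) auto
  moreover have "exp (- v / 2) * \<bar>exp (v / 2) * C 1 - C 0\<bar> = \<bar>exp (- v / 2) * (exp (v / 2) * C 1 - C 0)\<bar>" by (simp add: abs_mult)
  moreover have cancel: "exp (- v / 2) * (exp (v / 2) * x) = x" for x :: real
    unfolding mult.assoc[symmetric] exp_add[symmetric] by simp
  ultimately have "\<bar>exp (- v / 2) * (exp (v / 2) * C 1 - C 0)\<bar> \<le> D" by metis
  then have "\<bar>C 1 - exp (- v / 2) * C 0\<bar> \<le> D" unfolding right_diff_distrib cancel .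
  moreover have C0: "C 0 = g 0" unfolding C_def by (simp add: prob_space)
  ultimately have "\<bar>C 1 - exp (- v / 2) * g 0\<bar> \<le> D" by simp
  then show ?thesis unfolding C_def D_def by simp
qed

text \<open>The real and the imaginary part are bounded separately, hence the factor 2; the initial
  values \<open>cos 0 = 1\<close> and \<open>sin 0 = 0\<close> yield the Gaussian characteristic
  function.\<close>

lemma (in prob_space) char_stein_bound:
  assumes Z: "all_moments M Z" and \<Gamma>: "all_moments M \<Gamma>" and v: "0 \<le> v"
    and c: "\<And>t. (LINT w|M. Z w * cos (t * Z w)) = - t * (LINT w|M. sin (t * Z w) * \<Gamma> w)"
    and s: "\<And>t. (LINT w|M. Z w * sin (t * Z w)) = t * (LINT w|M. cos (t * Z w) * \<Gamma> w)"
  shows "cmod ((LINT w|M. iexp (Z w)) - complex_of_real (exp (- v / 2))) \<le> 2 * (LINT w|M. \<bar>\<Gamma> w - v\<bar>)"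
proof -
  have m: "Z \<in> borel_measurable M" using Z by (rule all_moments_measurable)
  have 1: "\<bar>(LINT w|M. sin (Z w)) - exp (- v / 2) * sin 0\<bar> \<le> (LINT w|M. \<bar>\<Gamma> w - v\<bar>)"
    by (rule stein_ode_bound[OF Z \<Gamma> v cos_sin_second_order(2)]) (use c in auto)
  have 2: "\<bar>(LINT w|M. cos (Z w)) - exp (- v / 2) * cos 0\<bar> \<le> (LINT w|M. \<bar>\<Gamma> w - v\<bar>)"
    by (rule stein_ode_bound[OF Z \<Gamma> v cos_sin_second_order(1)]) (use s in auto)
  have "(LINT w|M. iexp (Z w)) - complex_of_real (exp (- v / 2)) = Complex ((LINT w|M. cos (Z w)) - exp (- v / 2)) (LINT w|M. sin (Z w))"
    using integral_iexp_eq[OF m, of "\<lambda>_. 1"] by (simp add: complex_eq_iff)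
  then have "cmod ((LINT w|M. iexp (Z w)) - complex_of_real (exp (- v / 2))) \<le> \<bar>(LINT w|M. cos (Z w)) - exp (- v / 2)\<bar> + \<bar>LINT w|M. sin (Z w)\<bar>"
    using cmod_le[of "(LINT w|M. iexp (Z w)) - complex_of_real (exp (- v / 2))"] by simp
  then show ?thesis using 1 2 by simp
qed

section \<open>Finite Hermite sums\<close>

lemma integral_sum4:
  fixes f :: "'b \<Rightarrow> 'c \<Rightarrow> 'd \<Rightarrow> 'e \<Rightarrow> 'w \<Rightarrow> real"
  assumes "\<And>i j k l. integrable M (f i j k l)"
  shows "(LINT w|M. (\<Sum>i\<in>A. \<Sum>j\<in>B. \<Sum>k\<in>C. \<Sum>l\<in>D. f i j k l w)) =
    (\<Sum>i\<in>A. \<Sum>j\<in>B. \<Sum>k\<in>C. \<Sum>l\<in>D. LINT w|M. f i j k l w)"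
  using assms by (simp add: Bochner_Integration.integral_sum)

text \<open>The kernel \<open>\<kappa>\<close> is a parameter because moments involve the inner
  product, while the coordinate estimates are made for its truncation
  \<open>partial_sum_kernel S\<close> to finitely many basis vectors.\<close>

definition diagram_value ::
  "('h \<Rightarrow> 'h \<Rightarrow> real) \<Rightarrow> 'h set \<Rightarrow> ('h \<Rightarrow> real) \<Rightarrow> 'h set \<Rightarrow> ('h \<Rightarrow> real) \<Rightarrow>
    nat \<Rightarrow> nat \<Rightarrow> nat \<Rightarrow> nat \<Rightarrow> nat \<Rightarrow> nat \<Rightarrow> real" where
  "diagram_value \<kappa> A1 c1 A2 c2 a b c d e f =
    (\<Sum>h1\<in>A1. \<Sum>h2\<in>A2. \<Sum>h3\<in>A1. \<Sum>h4\<in>A2. c1 h1 * c2 h2 * c1 h3 * c2 h4 *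
      \<kappa> h1 h2 ^ a * \<kappa> h1 h3 ^ b * \<kappa> h1 h4 ^ c * \<kappa> h2 h3 ^ d * \<kappa> h2 h4 ^ e * \<kappa> h3 h4 ^ f)"

context isonormal begin

definition hermite_sum :: "nat \<Rightarrow> 'h set \<Rightarrow> ('h \<Rightarrow> real) \<Rightarrow> 'w \<Rightarrow> real" where
  "hermite_sum D A c w = (\<Sum>h\<in>A. c h * hermite D (X h w))"

text \<open>The inner product of the Malliavin derivative of the first Hermite sum with that of the second, over \<open>D1\<close>.\<close>

definition malliavin_product ::
  "nat \<Rightarrow> 'h set \<Rightarrow> ('h \<Rightarrow> real) \<Rightarrow> nat \<Rightarrow> 'h set \<Rightarrow> ('h \<Rightarrow> real) \<Rightarrow> 'w \<Rightarrow> real" where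
  "malliavin_product D1 A1 c1 D2 A2 c2 w =
     (\<Sum>h\<in>A1. \<Sum>g\<in>A2. real D2 * (c1 h * c2 g * (h \<bullet> g)) * (hermite (D1 - 1) (X h w) * hermite (D2 - 1) (X g w)))"

lemma all_moments_hermite_sum: "all_moments M (hermite_sum D A c)"
  unfolding hermite_sum_def by (intro all_moments_sum all_moments_cmult all_moments_hermite)

lemma all_moments_malliavin_product: "all_moments M (malliavin_product D1 A1 c1 D2 A2 c2)"
  unfolding malliavin_product_def by (intro all_moments_sum all_moments_cmult all_moments_mult all_moments_hermite)

text \<open>Both expectations reduce to the orthogonality of Hermite polynomials; they agree because
  \<open>D2\<close> times the factorial of \<open>D2 - 1\<close> is the factorial of
  \<open>D2\<close>.\<close>

lemma expectation_malliavin_product: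
  assumes "D1 \<ge> 1" "D2 \<ge> 1" "\<And>h. h \<in> A1 \<Longrightarrow> norm h = 1" "\<And>h. h \<in> A2 \<Longrightarrow> norm h = 1"
  shows "(LINT w|M. malliavin_product D1 A1 c1 D2 A2 c2 w) =
      (if D1 = D2 then (\<Sum>h\<in>A1. \<Sum>g\<in>A2. fact D1 * (c1 h * c2 g * (h \<bullet> g) ^ D1)) else 0)" (is "?l = ?r")
    and "(LINT w|M. hermite_sum D1 A1 c1 w * hermite_sum D2 A2 c2 w) = (LINT w|M. malliavin_product D1 A1 c1 D2 A2 c2 w)"
proof -
  have i: "integrable M (\<lambda>w. hermite n (X h w) * hermite m (X g w))" for n m h g
    by (intro all_moments_integrable all_moments_mult all_moments_hermite)
  have "?l = (\<Sum>h\<in>A1. \<Sum>g\<in>A2. real D2 * (c1 h * c2 g * (h \<bullet> g)) * (LINT w|M. hermite (D1 - 1) (X h w) * hermite (D2 - 1) (X g w)))"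
    unfolding malliavin_product_def using i by simp
  also have "\<dots> = (\<Sum>h\<in>A1. \<Sum>g\<in>A2. if D1 = D2 then fact D1 * (c1 h * c2 g * (h \<bullet> g) ^ D1) else 0)"
  proof (intro sum.cong refl)
    fix h g assume "h \<in> A1" "g \<in> A2"
    then have "norm h = 1" "norm g = 1" using assms by auto
    then show "real D2 * (c1 h * c2 g * (h \<bullet> g)) * (LINT w|M. hermite (D1 - 1) (X h w) * hermite (D2 - 1) (X g w)) =
      (if D1 = D2 then fact D1 * (c1 h * c2 g * (h \<bullet> g) ^ D1) else 0)"
      using assms(1,2) by (subst expectation_hermite_hermite) (auto simp: fact_reduce[of D2] power_eq_if[of _ D2])
  qed
  also have "\<dots> = ?r" by simp
  finally show 1: "?l = ?r" .
  have "(LINT w|M. hermite_sum D1 A1 c1 w * hermite_sum D2 A2 c2 w) =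
      (LINT w|M. (\<Sum>h\<in>A1. \<Sum>g\<in>A2. c1 h * c2 g * (hermite D1 (X h w) * hermite D2 (X g w))))"
    unfolding hermite_sum_def sum_product by (simp add: mult_ac)
  also have "\<dots> = (\<Sum>h\<in>A1. \<Sum>g\<in>A2. c1 h * c2 g * (LINT w|M. hermite D1 (X h w) * hermite D2 (X g w)))"
    using i by simp
  also have "\<dots> = (\<Sum>h\<in>A1. \<Sum>g\<in>A2. if D1 = D2 then fact D1 * (c1 h * c2 g * (h \<bullet> g) ^ D1) else 0)"
    by (intro sum.cong refl, subst expectation_hermite_hermite) (auto simp: assms)
  also have "\<dots> = ?r" by simp
  finally show "(LINT w|M. hermite_sum D1 A1 c1 w * hermite_sum D2 A2 c2 w) = ?l" using 1 by simp
qed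

text \<open>Each term of \<open>Z\<close> is integrated by parts along its own unit vector
  \<open>h\<close>; the derivative of \<open>g (Z w)\<close> in that direction is
  \<open>g' (Z w)\<close> times a sum over all terms of \<open>Z\<close>. The first polynomial loses
  a leg without a factor and the second is differentiated, which is why
  \<open>malliavin_product\<close> carries the factor \<open>D2\<close> only.\<close>

lemma expectation_times_function_hermite_sum:
  fixes \<xi> :: "'j \<Rightarrow> real" and c :: "'j \<Rightarrow> 'h \<Rightarrow> real"
  assumes J: "finite J" and D: "\<And>j. j \<in> J \<Longrightarrow> D j \<ge> 1" and A: "\<And>j. j \<in> J \<Longrightarrow> finite (A j)"
    and u: "\<And>j h. j \<in> J \<Longrightarrow> h \<in> A j \<Longrightarrow> norm h = 1"
    and d: "\<And>x. (g has_real_derivative g' x) (at x)" and c: "continuous_on UNIV g'"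
    and b: "\<And>x. \<bar>g x\<bar> \<le> B" "\<And>x. \<bar>g' x\<bar> \<le> B"
  defines "Z \<equiv> \<lambda>w. \<Sum>j\<in>J. \<xi> j * hermite_sum (D j) (A j) (c j) w"
  shows "(LINT w|M. Z w * g (Z w)) =
    (LINT w|M. g' (Z w) * (\<Sum>i\<in>J. \<Sum>j\<in>J. \<xi> i * \<xi> j * malliavin_product (D i) (A i) (c i) (D j) (A j) (c j) w))"
proof -
  \<comment> \<open>One finite index set for all components, so that every term is a function of the
    same coordinates.\<close>
  define AA where "AA = (\<Union>j\<in>J. A j)"
  have AA: "finite AA" "\<And>j h. j \<in> J \<Longrightarrow> h \<in> A j \<Longrightarrow> h \<in> AA" unfolding AA_def using J A by auto
  define z where "z x = (\<Sum>j\<in>J. \<xi> j * (\<Sum>h\<in>A j. c j h * hermite (D j) (x h)))" for x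
  define z' where "z' h x = (\<Sum>j\<in>J. \<xi> j * (\<Sum>g\<in>A j. c j g * (real (D j) * hermite (D j - 1) (x g) * (h \<bullet> g))))" for h x
  have sz: "smooth_along AA (\<lambda>k. h \<bullet> k) z (z' h)" for h
    unfolding z_def z'_def by (intro smooth_along_sum smooth_along_cmult smooth_along_hermite AA)
  have sg: "smooth_along AA (\<lambda>k. h \<bullet> k) (\<lambda>x. g (z x)) (\<lambda>x. g' (z x) * z' h x)" for h
    by (rule smooth_along_compose_bounded[OF sz d c b])
  have zX: "z (\<lambda>k\<in>AA. X k w) = Z w" for w
    unfolding z_def Z_def hermite_sum_def using AA(2) by (intro sum.cong refl arg_cong2[where f="(*)"]) auto
  have am: "all_moments M (\<lambda>w. g (Z w))" "all_moments M (\<lambda>w. g' (Z w) * z' h (\<lambda>k\<in>AA. X k w))" for h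
    using all_moments_poly_growth[OF AA(1) smooth_alongD(1,3)[OF sg]] all_moments_poly_growth[OF AA(1) smooth_alongD(2,4)[OF sg[of h]]]
    unfolding zX by auto
  have i: "integrable M (\<lambda>w. hermite n (X h w) * g (Z w))" "integrable M (\<lambda>w. hermite n (X h w) * (g' (Z w) * z' h (\<lambda>k\<in>AA. X k w)))" for n h
    by (intro all_moments_integrable all_moments_mult all_moments_hermite am)+
  have "(LINT w|M. Z w * g (Z w)) = (LINT w|M. (\<Sum>i\<in>J. \<Sum>h\<in>A i. \<xi> i * c i h * (hermite (D i) (X h w) * g (Z w))))"
  proof -
    have "Z w * y = (\<Sum>i\<in>J. \<Sum>h\<in>A i. \<xi> i * c i h * (hermite (D i) (X h w) * y))" for w y
      unfolding Z_def hermite_sum_def sum_distrib_left sum_distrib_right by (simp add: mult_ac)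
    then show ?thesis by simp
  qed
  also have "\<dots> = (\<Sum>i\<in>J. \<Sum>h\<in>A i. \<xi> i * c i h * (LINT w|M. hermite (D i) (X h w) * g (Z w)))"
    using i by simp
  also have "\<dots> = (\<Sum>i\<in>J. \<Sum>h\<in>A i. \<xi> i * c i h * (LINT w|M. hermite (D i - 1) (X h w) * (g' (Z w) * z' h (\<lambda>k\<in>AA. X k w))))"
  proof (intro sum.cong refl arg_cong2[where f="(*)"])
    fix i h assume ih: "i \<in> J" "h \<in> A i"
    have "Suc (D i - 1) = D i" using D[OF ih(1)] by simp
    then show "(LINT w|M. hermite (D i) (X h w) * g (Z w)) = (LINT w|M. hermite (D i - 1) (X h w) * (g' (Z w) * z' h (\<lambda>k\<in>AA. X k w)))"
      using hermite_integration_by_parts[OF AA(1) AA(2)[OF ih] u[OF ih] sg, of "D i - 1"] unfolding zX by simp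
  qed
  also have "\<dots> = (LINT w|M. (\<Sum>i\<in>J. \<Sum>h\<in>A i. \<xi> i * c i h * (hermite (D i - 1) (X h w) * (g' (Z w) * z' h (\<lambda>k\<in>AA. X k w)))))"
    using i by simp
  also have "\<dots> = (LINT w|M. g' (Z w) * (\<Sum>i\<in>J. \<Sum>j\<in>J. \<xi> i * \<xi> j * malliavin_product (D i) (A i) (c i) (D j) (A j) (c j) w))"
  proof (intro Bochner_Integration.integral_cong refl)
    fix w
    have zz: "z' h (\<lambda>k\<in>AA. X k w) = (\<Sum>j\<in>J. \<Sum>g\<in>A j. \<xi> j * (c j g * (real (D j) * hermite (D j - 1) (X g w) * (h \<bullet> g))))" for h
      unfolding z'_def sum_distrib_left using AA(2) by (intro sum.cong refl) auto
    have "(\<Sum>i\<in>J. \<Sum>h\<in>A i. \<xi> i * c i h * (hermite (D i - 1) (X h w) * (y * z' h (\<lambda>k\<in>AA. X k w)))) =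
      (\<Sum>i\<in>J. \<Sum>j\<in>J. \<Sum>h\<in>A i. \<Sum>g\<in>A j. y * (\<xi> i * \<xi> j * (real (D j) * (c i h * c j g * (h \<bullet> g)) * (hermite (D i - 1) (X h w) * hermite (D j - 1) (X g w)))))" for y
      unfolding zz sum_distrib_left
      by (rule sum.cong[OF refl], subst sum.swap, intro sum.cong refl) (simp add: mult_ac)
    then show "(\<Sum>i\<in>J. \<Sum>h\<in>A i. \<xi> i * c i h * (hermite (D i - 1) (X h w) * (g' (Z w) * z' h (\<lambda>k\<in>AA. X k w)))) =
       g' (Z w) * (\<Sum>i\<in>J. \<Sum>j\<in>J. \<xi> i * \<xi> j * malliavin_product (D i) (A i) (c i) (D j) (A j) (c j) w)"
      unfolding malliavin_product_def sum_distrib_left by simp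
  qed
  finally show ?thesis .
qed

text \<open>The mean of each \<open>G i j\<close> is the covariance of \<open>F i\<close> and
  \<open>F j\<close>, so the square roots are standard deviations. They replace the first absolute
  moments of the Stein bound because second moments of \<open>G i j\<close> can be computed by
  diagrams.\<close>

lemma char_hermite_sum_bound:
  fixes \<xi> :: "'j \<Rightarrow> real" and c :: "'j \<Rightarrow> 'h \<Rightarrow> real"
  assumes J: "finite J" and D: "\<And>j. j \<in> J \<Longrightarrow> D j \<ge> 1" and A: "\<And>j. j \<in> J \<Longrightarrow> finite (A j)"
    and u: "\<And>j h. j \<in> J \<Longrightarrow> h \<in> A j \<Longrightarrow> norm h = 1"
  defines "F \<equiv> \<lambda>j. hermite_sum (D j) (A j) (c j)"
  defines "G \<equiv> \<lambda>i j. malliavin_product (D i) (A i) (c i) (D j) (A j) (c j)"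
  shows "cmod ((LINT w|M. iexp (\<Sum>j\<in>J. \<xi> j * F j w)) -
      complex_of_real (exp (- (\<Sum>i\<in>J. \<Sum>j\<in>J. \<xi> i * \<xi> j * (LINT w|M. F i w * F j w)) / 2)))
    \<le> 2 * (\<Sum>i\<in>J. \<Sum>j\<in>J. \<bar>\<xi> i\<bar> * \<bar>\<xi> j\<bar> * sqrt (LINT w|M. (G i j w - (LINT w|M. F i w * F j w))\<^sup>2))"
proof -
  define Z where "Z w = (\<Sum>j\<in>J. \<xi> j * F j w)" for w
  define \<Gamma> where "\<Gamma> w = (\<Sum>i\<in>J. \<Sum>j\<in>J. \<xi> i * \<xi> j * G i j w)" for w
  define C where "C i j = (LINT w|M. F i w * F j w)" for i j
  define v where "v = (\<Sum>i\<in>J. \<Sum>j\<in>J. \<xi> i * \<xi> j * C i j)"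
  have amF: "all_moments M (F j)" and amG: "all_moments M (G i j)" for i j
    unfolding F_def G_def by (rule all_moments_hermite_sum all_moments_malliavin_product)+
  have amZ: "all_moments M Z" and am\<Gamma>: "all_moments M \<Gamma>"
    unfolding Z_def \<Gamma>_def by (intro all_moments_sum all_moments_cmult amF amG)+
  have "v = (LINT w|M. (Z w)\<^sup>2)"
    unfolding v_def C_def Z_def by (rule second_moment_linear_combination[symmetric]) (rule amF)
  then have v0: "0 \<le> v" by simp
  have st: "(LINT w|M. Z w * g (Z w)) = (LINT w|M. g' (Z w) * \<Gamma> w)"
    if "\<And>x. (g has_real_derivative g' x) (at x)" "continuous_on UNIV g'" "\<And>x. \<bar>g x\<bar> \<le> B" "\<And>x. \<bar>g' x\<bar> \<le> B" for g g' B
    unfolding Z_def \<Gamma>_def F_def G_def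
    by (rule expectation_times_function_hermite_sum[OF J D A u that])
  \<comment> \<open>A common bound for \<open>cos (t * x)\<close>, \<open>sin (t * x)\<close> and
    their derivatives in \<open>x\<close>.\<close>
  have tb: "\<bar>t * sin x\<bar> \<le> max 1 \<bar>t\<bar>" "\<bar>t * cos x\<bar> \<le> max 1 \<bar>t\<bar>"
    "\<bar>sin x\<bar> \<le> max 1 \<bar>t\<bar>" "\<bar>cos x\<bar> \<le> max 1 \<bar>t\<bar>" for t x :: real
    using mult_left_mono[OF abs_sin_le_one[of x], of "\<bar>t\<bar>"] mult_left_mono[OF abs_cos_le_one[of x], of "\<bar>t\<bar>"]
      abs_sin_le_one[of x] abs_cos_le_one[of x] unfolding abs_mult by linarith+
  have "cmod ((LINT w|M. iexp (Z w)) - complex_of_real (exp (- v / 2))) \<le> 2 * (LINT w|M. \<bar>\<Gamma> w - v\<bar>)"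
  proof (rule char_stein_bound[OF amZ am\<Gamma> v0])
    fix t
    have "(LINT w|M. Z w * cos (t * Z w)) = (LINT w|M. (- t * sin (t * Z w)) * \<Gamma> w)"
      by (rule st[of "\<lambda>x. cos (t * x)" "\<lambda>x. - t * sin (t * x)" "max 1 \<bar>t\<bar>"])
        (auto intro!: derivative_eq_intros continuous_intros simp: tb)
    also have "\<dots> = - t * (LINT w|M. sin (t * Z w) * \<Gamma> w)"
      unfolding mult.assoc by (rule integral_mult_right_zero)
    finally show "(LINT w|M. Z w * cos (t * Z w)) = - t * (LINT w|M. sin (t * Z w) * \<Gamma> w)" .
    have "(LINT w|M. Z w * sin (t * Z w)) = (LINT w|M. (t * cos (t * Z w)) * \<Gamma> w)"
      by (rule st[of "\<lambda>x. sin (t * x)" "\<lambda>x. t * cos (t * x)" "max 1 \<bar>t\<bar>"])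
        (auto intro!: derivative_eq_intros continuous_intros simp: tb)
    also have "\<dots> = t * (LINT w|M. cos (t * Z w) * \<Gamma> w)"
      unfolding mult.assoc by (rule integral_mult_right_zero)
    finally show "(LINT w|M. Z w * sin (t * Z w)) = t * (LINT w|M. cos (t * Z w) * \<Gamma> w)" .
  qed
  also have "(LINT w|M. \<bar>\<Gamma> w - v\<bar>) \<le> (LINT w|M. (\<Sum>i\<in>J. \<Sum>j\<in>J. \<bar>\<xi> i\<bar> * \<bar>\<xi> j\<bar> * \<bar>G i j w - C i j\<bar>))"
  proof (rule integral_mono)
    show "integrable M (\<lambda>w. \<bar>\<Gamma> w - v\<bar>)"
      by (intro integrable_abs all_moments_integrable all_moments_diff am\<Gamma> all_moments_const)
    show "integrable M (\<lambda>w. \<Sum>i\<in>J. \<Sum>j\<in>J. \<bar>\<xi> i\<bar> * \<bar>\<xi> j\<bar> * \<bar>G i j w - C i j\<bar>)"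
      by (intro Bochner_Integration.integrable_sum integrable_mult_right integrable_abs all_moments_integrable all_moments_diff amG all_moments_const)
    fix w
    have "\<Gamma> w - v = (\<Sum>i\<in>J. \<Sum>j\<in>J. \<xi> i * \<xi> j * (G i j w - C i j))"
      unfolding \<Gamma>_def v_def by (simp add: right_diff_distrib sum_subtractf)
    also have "\<bar>\<dots>\<bar> \<le> (\<Sum>i\<in>J. \<Sum>j\<in>J. \<bar>\<xi> i * \<xi> j * (G i j w - C i j)\<bar>)"
      by (rule order_trans[OF sum_abs sum_mono[OF sum_abs]])
    finally show "\<bar>\<Gamma> w - v\<bar> \<le> (\<Sum>i\<in>J. \<Sum>j\<in>J. \<bar>\<xi> i\<bar> * \<bar>\<xi> j\<bar> * \<bar>G i j w - C i j\<bar>)" by (simp add: abs_mult)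
  qed
  also have "\<dots> = (\<Sum>i\<in>J. \<Sum>j\<in>J. \<bar>\<xi> i\<bar> * \<bar>\<xi> j\<bar> * (LINT w|M. \<bar>G i j w - C i j\<bar>))"
  proof -
    have "integrable M (\<lambda>w. \<bar>G i j w - C i j\<bar>)" for i j
      by (intro integrable_abs all_moments_integrable all_moments_diff amG all_moments_const)
    then show ?thesis by simp
  qed
  also have "\<dots> \<le> (\<Sum>i\<in>J. \<Sum>j\<in>J. \<bar>\<xi> i\<bar> * \<bar>\<xi> j\<bar> * sqrt (LINT w|M. (G i j w - C i j)\<^sup>2))"
  proof (intro sum_mono mult_left_mono)
    fix i j
    have am: "all_moments M (\<lambda>w. G i j w - C i j)" by (intro all_moments_diff amG all_moments_const)
    show "(LINT w|M. \<bar>G i j w - C i j\<bar>) \<le> sqrt (LINT w|M. (G i j w - C i j)\<^sup>2)"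
      by (rule expectation_abs_le(2)[OF all_moments_measurable[OF am] all_moments_integrable[OF all_moments_power[OF am]]])
  qed auto
  finally show ?thesis unfolding Z_def v_def C_def by simp
qed

text \<open>The diagrams that connect only \<open>h1\<close> with \<open>h2\<close> and \<open>h3\<close> with \<open>h4\<close> contribute the squared mean.\<close>

lemma variance_malliavin_product:
  assumes D: "D1 \<ge> 1" "D2 \<ge> 1" and u: "\<And>h. h \<in> A1 \<Longrightarrow> norm h = 1" "\<And>h. h \<in> A2 \<Longrightarrow> norm h = 1"
    and \<epsilon>: "0 \<le> \<epsilon>" and b: "\<And>a b c d e f. a \<ge> 1 \<Longrightarrow> f \<ge> 1 \<Longrightarrow> a + b + c = D1 \<Longrightarrow> a + d + e = D2 \<Longrightarrow>
      b + d + f = D1 \<Longrightarrow> c + e + f = D2 \<Longrightarrow> b + c + d + e > 0 \<Longrightarrow> \<bar>diagram_value inner A1 c1 A2 c2 a b c d e f\<bar> \<le> \<epsilon>"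
  shows "(LINT w|M. (malliavin_product D1 A1 c1 D2 A2 c2 w - (LINT w|M. hermite_sum D1 A1 c1 w * hermite_sum D2 A2 c2 w))\<^sup>2)
    \<le> (real D2)\<^sup>2 * diagram_sum (\<lambda>_ _ _ _ _ _. 1) (D1 - 1) (D2 - 1) (D1 - 1) (D2 - 1) * \<epsilon>"
proof -
  define G where "G = malliavin_product D1 A1 c1 D2 A2 c2"
  define m where "m = (LINT w|M. G w)"
  \<comment> \<open>The inner products in the two copies of \<open>malliavin_product\<close> are an
    edge 12 and an edge 34 drawn in advance, hence \<open>Suc a\<close> and \<open>Suc f\<close>;
    each vertex has one leg less to pair.\<close>
  define \<Lambda> where "\<Lambda> = (\<lambda>a b c d e f. diagram_value inner A1 c1 A2 c2 (Suc a) b c d e (Suc f))"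
  have am: "all_moments M G" unfolding G_def by (rule all_moments_malliavin_product)
  have i: "integrable M G" "integrable M (\<lambda>w. (G w)\<^sup>2)"
    by (intro all_moments_integrable all_moments_power am)+
  have mm: "(LINT w|M. hermite_sum D1 A1 c1 w * hermite_sum D2 A2 c2 w) = m"
    unfolding m_def G_def using expectation_malliavin_product(2)[OF D u] by simp
  have "(x - m)\<^sup>2 = x\<^sup>2 - 2 * m * x + m\<^sup>2" for x
    by (simp add: power2_eq_square algebra_simps)
  then have "(LINT w|M. (G w - m)\<^sup>2) = (LINT w|M. (G w)\<^sup>2 - 2 * m * G w + m\<^sup>2)" by simp
  also have "\<dots> = (LINT w|M. (G w)\<^sup>2) - 2 * m * (LINT w|M. G w) + m\<^sup>2"
    using i by (simp add: prob_space)
  also have "\<dots> = (LINT w|M. (G w)\<^sup>2) - m\<^sup>2" unfolding m_def[symmetric] by (simp add: power2_eq_square)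
  finally have var: "(LINT w|M. (G w - m)\<^sup>2) = (LINT w|M. (G w)\<^sup>2) - m\<^sup>2" .
  have i4: "integrable M (\<lambda>w. hermite n1 (X h1 w) * (hermite n2 (X h2 w) * hermite n3 (X h3 w) * hermite n4 (X h4 w)))" for n1 n2 n3 n4 h1 h2 h3 h4
    by (intro all_moments_integrable all_moments_mult all_moments_hermite)
  have "(LINT w|M. (G w)\<^sup>2) = (LINT w|M. (\<Sum>h1\<in>A1. \<Sum>h2\<in>A2. \<Sum>h3\<in>A1. \<Sum>h4\<in>A2.
      (real D2)\<^sup>2 * (c1 h1 * c2 h2 * (h1 \<bullet> h2) * (c1 h3 * c2 h4 * (h3 \<bullet> h4))) *
      (hermite (D1 - 1) (X h1 w) * (hermite (D2 - 1) (X h2 w) * hermite (D1 - 1) (X h3 w) * hermite (D2 - 1) (X h4 w)))))"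
    unfolding G_def malliavin_product_def power2_eq_square sum_distrib_right
    unfolding sum_distrib_left by (intro Bochner_Integration.integral_cong sum.cong refl) (simp add: mult_ac)
  also have "\<dots> = (\<Sum>h1\<in>A1. \<Sum>h2\<in>A2. \<Sum>h3\<in>A1. \<Sum>h4\<in>A2.
      (real D2)\<^sup>2 * (c1 h1 * c2 h2 * (h1 \<bullet> h2) * (c1 h3 * c2 h4 * (h3 \<bullet> h4))) *
      hermite_moment4 (D1 - 1) h1 (D2 - 1) h2 (D1 - 1) h3 (D2 - 1) h4)"
    unfolding hermite_moment4_def
    by (subst integral_sum4, intro integrable_mult_right i4) (simp only: integral_mult_right_zero)
  also have "\<dots> = (\<Sum>h1\<in>A1. \<Sum>h2\<in>A2. \<Sum>h3\<in>A1. \<Sum>h4\<in>A2.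
      (real D2)\<^sup>2 * diagram_sum (\<lambda>a b c d e f. c1 h1 * c2 h2 * c1 h3 * c2 h4 *
      (h1 \<bullet> h2) ^ Suc a * (h1 \<bullet> h3) ^ b * (h1 \<bullet> h4) ^ c * (h2 \<bullet> h3) ^ d * (h2 \<bullet> h4) ^ e * (h3 \<bullet> h4) ^ Suc f)
        (D1 - 1) (D2 - 1) (D1 - 1) (D2 - 1))"
  proof (intro sum.cong refl)
    fix h1 h2 h3 h4 assume "h1 \<in> A1" "h2 \<in> A2" "h3 \<in> A1" "h4 \<in> A2"
    then have "norm h1 = 1" "norm h2 = 1" "norm h3 = 1" "norm h4 = 1" using u by auto
    from hermite_moment4_eq_diagram_sum[OF this, of "c1 h1 * c2 h2 * c1 h3 * c2 h4" 1 0 0 0 0 1 "D1 - 1" "D2 - 1" "D1 - 1" "D2 - 1"]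
    show "(real D2)\<^sup>2 * (c1 h1 * c2 h2 * (h1 \<bullet> h2) * (c1 h3 * c2 h4 * (h3 \<bullet> h4))) *
        hermite_moment4 (D1 - 1) h1 (D2 - 1) h2 (D1 - 1) h3 (D2 - 1) h4 =
      (real D2)\<^sup>2 * diagram_sum (\<lambda>a b c d e f. c1 h1 * c2 h2 * c1 h3 * c2 h4 *
        (h1 \<bullet> h2) ^ Suc a * (h1 \<bullet> h3) ^ b * (h1 \<bullet> h4) ^ c * (h2 \<bullet> h3) ^ d * (h2 \<bullet> h4) ^ e * (h3 \<bullet> h4) ^ Suc f)
        (D1 - 1) (D2 - 1) (D1 - 1) (D2 - 1)"
      by (simp add: mult_ac)
  qed
  also have "\<dots> = (real D2)\<^sup>2 * diagram_sum \<Lambda> (D1 - 1) (D2 - 1) (D1 - 1) (D2 - 1)"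
    by (simp only: \<Lambda>_def diagram_value_def diagram_sum_sum sum_distrib_left)
  finally have sq: "(LINT w|M. (G w)\<^sup>2) = (real D2)\<^sup>2 * diagram_sum \<Lambda> (D1 - 1) (D2 - 1) (D1 - 1) (D2 - 1)" .
  \<comment> \<open>For \<open>D1 = D2\<close> the exceptional term is the squared mean, since the
    double sum in the mean squares to a four-fold sum with exponent \<open>D1\<close> on 12 and on
    34. For \<open>D1 \<noteq> D2\<close> both vanish.\<close>
  have main: "(real D2)\<^sup>2 * (if D1 - 1 = D2 - 1 \<and> D1 - 1 = D2 - 1 then fact (D1 - 1) * fact (D1 - 1) * \<Lambda> (D1 - 1) 0 0 0 0 (D1 - 1) else 0) = m\<^sup>2"
  proof (cases "D1 = D2")
    case True
    have "m = fact D1 * (\<Sum>h\<in>A1. \<Sum>g\<in>A2. c1 h * c2 g * (h \<bullet> g) ^ D1)"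
      unfolding m_def G_def sum_distrib_left
      by (subst expectation_malliavin_product(1)[OF D u]) (use True in simp_all)
    moreover have "(\<Sum>h\<in>A1. \<Sum>g\<in>A2. c1 h * c2 g * (h \<bullet> g) ^ D1)\<^sup>2 = \<Lambda> (D1 - 1) 0 0 0 0 (D1 - 1)"
      unfolding \<Lambda>_def diagram_value_def power2_eq_square sum_distrib_right
      unfolding sum_distrib_left using D by (intro sum.cong refl) (simp add: mult_ac)
    moreover have "real D2 * fact (D1 - 1) = fact D1" using D True by (simp add: fact_reduce[of D2])
    moreover have "(real D2)\<^sup>2 * (fact (D1 - 1) * fact (D1 - 1) * x) = (real D2 * fact (D1 - 1))\<^sup>2 * x" for x
      by (simp only: power2_eq_square mult_ac)
    ultimately have "(real D2)\<^sup>2 * (fact (D1 - 1) * fact (D1 - 1) * \<Lambda> (D1 - 1) 0 0 0 0 (D1 - 1)) = m\<^sup>2"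
      by (simp only: power_mult_distrib)
    then show ?thesis using True by (simp only: simp_thms if_True)
  next
    case False
    then have "m = 0" unfolding m_def G_def
      by (subst expectation_malliavin_product(1)[OF D u]) simp_all
    moreover have "D1 - 1 \<noteq> D2 - 1" using False D by linarith
    ultimately show ?thesis by simp
  qed
  define S where "S = diagram_sum \<Lambda> (D1 - 1) (D2 - 1) (D1 - 1) (D2 - 1)"
  define T where "T = (if D1 - 1 = D2 - 1 \<and> D1 - 1 = D2 - 1 then fact (D1 - 1) * fact (D1 - 1) * \<Lambda> (D1 - 1) 0 0 0 0 (D1 - 1) else 0)"
  define U where "U = diagram_sum (\<lambda>_ _ _ _ _ _. 1) (D1 - 1) (D2 - 1) (D1 - 1) (D2 - 1) * \<epsilon>"
  have "\<bar>S - T\<bar> \<le> U"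
    unfolding S_def T_def U_def
  proof (rule diagram_sum_cross_bound[OF _ \<epsilon>])
    fix a b c d e f
    assume "a + b + c = D1 - 1" "a + d + e = D2 - 1" "b + d + f = D1 - 1" "c + e + f = D2 - 1" "0 < b + c + d + e"
    with D show "\<bar>\<Lambda> a b c d e f\<bar> \<le> \<epsilon>" unfolding \<Lambda>_def by (intro assms(6)) linarith+
  qed
  then have "S \<le> T + U" by linarith
  then have "(real D2)\<^sup>2 * S \<le> (real D2)\<^sup>2 * (T + U)" by (rule mult_left_mono) simp
  then have "(LINT w|M. (G w)\<^sup>2) - m\<^sup>2 \<le> (real D2)\<^sup>2 * U"
    unfolding sq S_def[symmetric] main[folded T_def, symmetric] by (simp add: distrib_left)
  then have "(LINT w|M. (G w - m)\<^sup>2) \<le> (real D2)\<^sup>2 * U" unfolding var .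
  then show ?thesis unfolding mm U_def G_def by (simp only: mult.assoc)
qed

end

section \<open>Coordinates in an orthonormal system\<close>

text \<open>For finite orthonormal \<open>S\<close>, the inner product of the projections of
  \<open>h\<close> and \<open>g\<close> onto the span of \<open>S\<close>.\<close>

definition partial_sum_kernel :: "'h::real_inner set \<Rightarrow> 'h \<Rightarrow> 'h \<Rightarrow> real" where
  "partial_sum_kernel S h g = (\<Sum>b\<in>S. (h \<bullet> b) * (g \<bullet> b))"

text \<open>The coordinate of the \<open>n\<close>-fold tensor power of \<open>h\<close> at the
  basis tensor given by \<open>bs\<close>, where \<open>n\<close> is the length of
  \<open>bs\<close>.\<close>

definition power_coordinate :: "'h::real_inner \<Rightarrow> 'h list \<Rightarrow> real" where
  "power_coordinate h bs = prod_list (map (\<lambda>b. h \<bullet> b) bs)"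

lemma power_coordinate_simps [simp]:
  "power_coordinate h [] = 1"
  "power_coordinate h (b # bs) = (h \<bullet> b) * power_coordinate h bs"
  "power_coordinate h (bs @ cs) = power_coordinate h bs * power_coordinate h cs"
  by (simp_all add: power_coordinate_def)

lemma tuples_0: "tuples S 0 = {[]}"
  by (auto simp: tuples_def)

lemma tuples_Suc: "tuples S (Suc n) = (\<lambda>(b, bs). b # bs) ` (S \<times> tuples S n)"
  by (auto simp: tuples_def length_Suc_conv image_iff)

lemma tuples_add: "tuples S (m + n) = (\<lambda>(xs, ys). xs @ ys) ` (tuples S m \<times> tuples S n)"
proof (intro equalityI subsetI)
  fix zs assume "zs \<in> tuples S (m + n)"
  then have "take m zs \<in> tuples S m" "drop m zs \<in> tuples S n"
    by (auto simp: tuples_def dest: in_set_takeD in_set_dropD)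
  then show "zs \<in> (\<lambda>(xs, ys). xs @ ys) ` (tuples S m \<times> tuples S n)"
    by (intro image_eqI[of _ _ "(take m zs, drop m zs)"]) auto
qed (auto simp: tuples_def)

lemma finite_tuples: "finite S \<Longrightarrow> finite (tuples S n)"
  by (induction n) (auto simp: tuples_0 tuples_Suc)

lemma tuples_mono: "S \<subseteq> S' \<Longrightarrow> tuples S n \<subseteq> tuples S' n"
  by (auto simp: tuples_def)

lemma sum_tuples_Suc: "(\<Sum>bs\<in>tuples S (Suc n). F bs) = (\<Sum>b\<in>S. \<Sum>bs\<in>tuples S n. F (b # bs))"
  unfolding tuples_Suc sum.cartesian_product
  by (subst sum.reindex) (auto simp: inj_on_def intro!: sum.cong)

lemma sum_tuples_add: "(\<Sum>bs\<in>tuples S (m + n). F bs) = (\<Sum>xs\<in>tuples S m. \<Sum>ys\<in>tuples S n. F (xs @ ys))"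
  unfolding tuples_add sum.cartesian_product
  by (subst sum.reindex) (auto simp: inj_on_def tuples_def intro!: sum.cong)

text \<open>A power of the kernel is an inner product of tensor powers in coordinates. This opens
  each group of parallel edges into a sum over tuples.\<close>

lemma sum_power_coordinate:
  "(\<Sum>bs\<in>tuples S n. power_coordinate h bs * power_coordinate g bs) = partial_sum_kernel S h g ^ n"
proof (induction n)
  case 0
  then show ?case by (simp add: tuples_0)
next
  case (Suc n)
  have "(\<Sum>bs\<in>tuples S (Suc n). power_coordinate h bs * power_coordinate g bs) =
      (\<Sum>b\<in>S. ((h \<bullet> b) * (g \<bullet> b)) * (\<Sum>bs\<in>tuples S n. power_coordinate h bs * power_coordinate g bs))"
    unfolding sum_tuples_Suc sum_distrib_left by (simp add: mult_ac)
  also have "\<dots> = partial_sum_kernel S h g * partial_sum_kernel S h g ^ n"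
    unfolding Suc sum_distrib_right[symmetric] by (simp add: partial_sum_kernel_def)
  finally show ?case by simp
qed

definition coordinates :: "'h::real_inner set \<Rightarrow> ('h \<Rightarrow> real) \<Rightarrow> 'h list \<Rightarrow> real" where
  "coordinates A c bs = (\<Sum>h\<in>A. c h * power_coordinate h bs)"

text \<open>The contracted arguments stand last, whereas \<open>contraction\<close> puts them first;
  for symmetric tensors the two conventions agree.\<close>

definition partial_contraction :: "'h set \<Rightarrow> nat \<Rightarrow> ('h list \<Rightarrow> real) \<Rightarrow> 'h list \<Rightarrow> 'h list \<Rightarrow> real" where
  "partial_contraction S p T \<beta> \<beta>' = (\<Sum>xs\<in>tuples S p. T (\<beta> @ xs) * T (\<beta>' @ xs))"

lemma partial_contraction_coordinates:
  "partial_contraction S p (coordinates A c) \<beta> \<beta>' =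
    (\<Sum>h\<in>A. \<Sum>g\<in>A. c h * c g * partial_sum_kernel S h g ^ p * power_coordinate h \<beta> * power_coordinate g \<beta>')"
proof -
  have "partial_contraction S p (coordinates A c) \<beta> \<beta>' =
      (\<Sum>xs\<in>tuples S p. \<Sum>h\<in>A. \<Sum>g\<in>A. c h * c g * power_coordinate h \<beta> * power_coordinate g \<beta>' * (power_coordinate h xs * power_coordinate g xs))"
    unfolding partial_contraction_def coordinates_def sum_product by (simp add: mult_ac)
  also have "\<dots> = (\<Sum>h\<in>A. \<Sum>g\<in>A. \<Sum>xs\<in>tuples S p. c h * c g * power_coordinate h \<beta> * power_coordinate g \<beta>' * (power_coordinate h xs * power_coordinate g xs))"
    by (subst sum.swap, rule sum.cong[OF refl], rule sum.swap)
  also have "\<dots> = (\<Sum>h\<in>A. \<Sum>g\<in>A. c h * c g * partial_sum_kernel S h g ^ p * power_coordinate h \<beta> * power_coordinate g \<beta>')"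
    unfolding sum_distrib_left[symmetric] sum_power_coordinate by (simp add: mult_ac)
  finally show ?thesis .
qed

text \<open>A bilinear form whose kernel factors through an index \<open>i\<close> becomes a sum
  over \<open>i\<close> of products of two linear sums, the form in which Cauchy-Schwarz can be
  used.\<close>

lemma bilinear_feature_sum:
  fixes u v :: "'p \<Rightarrow> real"
  shows "(\<Sum>p\<in>P. \<Sum>q\<in>Q. u p * v q * (\<Sum>i\<in>I. \<phi> i p * \<psi> i q)) =
    (\<Sum>i\<in>I. (\<Sum>p\<in>P. u p * \<phi> i p) * (\<Sum>q\<in>Q. v q * \<psi> i q))"
proof -
  have "(\<Sum>p\<in>P. \<Sum>q\<in>Q. u p * v q * (\<Sum>i\<in>I. \<phi> i p * \<psi> i q)) =
      (\<Sum>p\<in>P. \<Sum>q\<in>Q. \<Sum>i\<in>I. (u p * \<phi> i p) * (v q * \<psi> i q))"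
    unfolding sum_distrib_left by (simp add: mult_ac)
  also have "\<dots> = (\<Sum>p\<in>P. \<Sum>i\<in>I. \<Sum>q\<in>Q. (u p * \<phi> i p) * (v q * \<psi> i q))"
    by (rule sum.cong[OF refl], rule sum.swap)
  also have "\<dots> = (\<Sum>i\<in>I. \<Sum>p\<in>P. \<Sum>q\<in>Q. (u p * \<phi> i p) * (v q * \<psi> i q))" by (rule sum.swap)
  also have "\<dots> = (\<Sum>i\<in>I. (\<Sum>p\<in>P. u p * \<phi> i p) * (\<Sum>q\<in>Q. v q * \<psi> i q))"
    unfolding sum_product ..
  finally show ?thesis .
qed

lemma sum_times4:
  fixes f :: "'p \<Rightarrow> real"
  shows "(\<Sum>i\<in>W \<times> X \<times> Y \<times> Z. f (fst i) * g (fst (snd i)) * h (fst (snd (snd i))) * k (snd (snd (snd i)))) =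
    sum f W * sum g X * sum h Y * sum k Z"
proof -
  have "(\<Sum>i\<in>W \<times> X \<times> Y \<times> Z. f (fst i) * g (fst (snd i)) * h (fst (snd (snd i))) * k (snd (snd (snd i)))) =
      (\<Sum>w\<in>W. \<Sum>x\<in>X. \<Sum>y\<in>Y. \<Sum>z\<in>Z. f w * g x * h y * k z)"
    unfolding sum.cartesian_product' by simp
  also have "\<dots> = sum f W * sum g X * sum h Y * sum k Z"
    unfolding sum_distrib_left[symmetric] sum_distrib_right[symmetric] ..
  finally show ?thesis .
qed

text \<open>The exponents of a diagram with prescribed row sums are determined by \<open>s\<close> and \<open>q\<close>; exchanging the
  roles of the two middle tuples is an isometry, so Cauchy-Schwarz removes the edges counted by \<open>q\<close>.\<close>

lemma diagram_value_partial_bound: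
  assumes S: "finite S"
  defines "\<kappa> \<equiv> partial_sum_kernel S"
  shows "\<bar>diagram_value \<kappa> A1 c1 A2 c2 s b q q e s\<bar> \<le>
    (\<Sum>\<beta>\<in>tuples S s. \<Sum>\<beta>'\<in>tuples S s.
      partial_contraction S (b + q) (coordinates A1 c1) \<beta> \<beta>' * partial_contraction S (q + e) (coordinates A2 c2) \<beta> \<beta>')"
proof -
  let ?I = "tuples S b \<times> tuples S q \<times> tuples S q \<times> tuples S e"
  \<comment> \<open>\<open>p\<close> is the pair of vectors at vertices 1 and 2 or at 3 and 4. The
    \<open>s\<close> edges inside a pair go into the weight \<open>u\<close>; the remaining edges
    run between the pairs.\<close>
  define u where "u p = c1 (fst p) * c2 (snd p) * \<kappa> (fst p) (snd p) ^ s" for p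
  define \<phi> where "\<phi> i p = power_coordinate (fst p) (fst i) * power_coordinate (fst p) (fst (snd i)) *
    power_coordinate (snd p) (fst (snd (snd i))) * power_coordinate (snd p) (snd (snd (snd i)))" for i :: "'a list \<times> 'a list \<times> 'a list \<times> 'a list" and p
  define \<psi> where "\<psi> i p = power_coordinate (fst p) (fst i) * power_coordinate (snd p) (fst (snd i)) *
    power_coordinate (fst p) (fst (snd (snd i))) * power_coordinate (snd p) (snd (snd (snd i)))" for i :: "'a list \<times> 'a list \<times> 'a list \<times> 'a list" and p
  \<comment> \<open>\<open>\<phi>\<close> gives the second tuple to the first vector of a pair and
    the third tuple to the second vector, \<open>\<psi>\<close> does the opposite;
    \<open>\<sigma>\<close> exchanges these tuples, which have the same length
    \<open>q\<close>.\<close>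
  define \<sigma> :: "'a list \<times> 'a list \<times> 'a list \<times> 'a list \<Rightarrow> 'a list \<times> 'a list \<times> 'a list \<times> 'a list"
    where "\<sigma> = (\<lambda>(w, x, y, z). (w, y, x, z))"
  define \<alpha> where "\<alpha> i = (\<Sum>p\<in>A1 \<times> A2. u p * \<phi> i p)" for i
  have "\<psi> i p = \<phi> (\<sigma> i) p" for i p unfolding \<phi>_def \<psi>_def \<sigma>_def by (simp add: split_beta mult_ac)
  then have \<psi>: "(\<Sum>p\<in>A1 \<times> A2. u p * \<psi> i p) = \<alpha> (\<sigma> i)" for i unfolding \<alpha>_def by simp
  have f1: "(\<Sum>i\<in>?I. \<phi> i p * \<psi> i p') = \<kappa> (fst p) (fst p') ^ b * \<kappa> (fst p) (snd p') ^ q * \<kappa> (snd p) (fst p') ^ q * \<kappa> (snd p) (snd p') ^ e" for p p'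
    unfolding \<kappa>_def sum_power_coordinate[symmetric] sum_times4[symmetric] \<phi>_def \<psi>_def by (simp add: mult_ac)
  have f2: "(\<Sum>i\<in>?I. \<phi> i p * \<phi> i p') = \<kappa> (fst p) (fst p') ^ b * \<kappa> (fst p) (fst p') ^ q * \<kappa> (snd p) (snd p') ^ q * \<kappa> (snd p) (snd p') ^ e" for p p'
    unfolding \<kappa>_def sum_power_coordinate[symmetric] sum_times4[symmetric] \<phi>_def by (simp add: mult_ac)
  have "diagram_value \<kappa> A1 c1 A2 c2 s b q q e s = (\<Sum>p\<in>A1 \<times> A2. \<Sum>p'\<in>A1 \<times> A2. u p * u p' * (\<Sum>i\<in>?I. \<phi> i p * \<psi> i p'))"
    unfolding diagram_value_def f1 u_def unfolding sum.cartesian_product' by (simp add: mult_ac)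
  also have "\<dots> = (\<Sum>i\<in>?I. \<alpha> i * \<alpha> (\<sigma> i))"
    unfolding bilinear_feature_sum \<psi> \<alpha>_def ..
  finally have d: "diagram_value \<kappa> A1 c1 A2 c2 s b q q e s = (\<Sum>i\<in>?I. \<alpha> i * \<alpha> (\<sigma> i))" .
  have "(\<Sum>i\<in>?I. (\<alpha> (\<sigma> i))\<^sup>2) = (\<Sum>i\<in>?I. (\<alpha> i)\<^sup>2)"
    by (rule sum.reindex_bij_witness[of _ \<sigma> \<sigma>]) (auto simp: \<sigma>_def)
  moreover have "\<bar>\<Sum>i\<in>?I. \<alpha> i * \<alpha> (\<sigma> i)\<bar> \<le> (\<Sum>i\<in>?I. ((\<alpha> i)\<^sup>2 + (\<alpha> (\<sigma> i))\<^sup>2) / 2)"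
  proof (rule order_trans[OF sum_abs sum_mono])
    show "\<bar>\<alpha> i * \<alpha> (\<sigma> i)\<bar> \<le> ((\<alpha> i)\<^sup>2 + (\<alpha> (\<sigma> i))\<^sup>2) / 2" for i
      using sum_squares_bound[of "\<bar>\<alpha> i\<bar>" "\<bar>\<alpha> (\<sigma> i)\<bar>"] by (simp add: abs_mult)
  qed
  ultimately have "\<bar>diagram_value \<kappa> A1 c1 A2 c2 s b q q e s\<bar> \<le> (\<Sum>i\<in>?I. (\<alpha> i)\<^sup>2)"
    unfolding d by (simp add: add_divide_distrib sum.distrib sum_divide_distrib[symmetric])
  also have "\<dots> = (\<Sum>p\<in>A1 \<times> A2. \<Sum>p'\<in>A1 \<times> A2. u p * u p' * (\<Sum>i\<in>?I. \<phi> i p * \<phi> i p'))"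
    unfolding bilinear_feature_sum \<alpha>_def power2_eq_square ..
  \<comment> \<open>The edges 14 and 23 have become \<open>q\<close> more edges 13 and
    \<open>q\<close> more edges 24. Only the edges 12 and 34 still join the two kernels.\<close>
  also have "\<dots> = (\<Sum>h1\<in>A1. \<Sum>h2\<in>A2. \<Sum>h3\<in>A1. \<Sum>h4\<in>A2.
      (c1 h1 * c1 h3 * \<kappa> h1 h3 ^ (b + q)) * (c2 h2 * c2 h4 * \<kappa> h2 h4 ^ (q + e)) * (\<kappa> h1 h2 ^ s * \<kappa> h3 h4 ^ s))"
    unfolding f2 u_def unfolding sum.cartesian_product' by (simp add: mult_ac power_add)
  also have "\<dots> = (\<Sum>h1\<in>A1. \<Sum>h3\<in>A1. \<Sum>h2\<in>A2. \<Sum>h4\<in>A2.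
      (c1 h1 * c1 h3 * \<kappa> h1 h3 ^ (b + q)) * (c2 h2 * c2 h4 * \<kappa> h2 h4 ^ (q + e)) * (\<kappa> h1 h2 ^ s * \<kappa> h3 h4 ^ s))"
    by (rule sum.cong[OF refl], rule sum.swap)
  \<comment> \<open>Opening the edges 12 and 34 in coordinates separates the kernels; the two tuples
    become their free arguments.\<close>
  also have "\<dots> = (\<Sum>p\<in>A1 \<times> A1. \<Sum>p'\<in>A2 \<times> A2.
      (c1 (fst p) * c1 (snd p) * \<kappa> (fst p) (snd p) ^ (b + q)) * (c2 (fst p') * c2 (snd p') * \<kappa> (fst p') (snd p') ^ (q + e)) *
      (\<Sum>i\<in>tuples S s \<times> tuples S s. (power_coordinate (fst p) (fst i) * power_coordinate (snd p) (snd i)) *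
        (power_coordinate (fst p') (fst i) * power_coordinate (snd p') (snd i))))"
  proof -
    have "(\<Sum>i\<in>tuples S s \<times> tuples S s. (power_coordinate h1 (fst i) * power_coordinate h3 (snd i)) *
        (power_coordinate h2 (fst i) * power_coordinate h4 (snd i))) = \<kappa> h1 h2 ^ s * \<kappa> h3 h4 ^ s" for h1 h2 h3 h4
      unfolding \<kappa>_def sum_power_coordinate[symmetric] sum_product sum.cartesian_product' by (simp add: mult_ac)
    then show ?thesis unfolding sum.cartesian_product'[of _ A1] sum.cartesian_product'[of _ A2] by simp
  qed
  also have "\<dots> = (\<Sum>i\<in>tuples S s \<times> tuples S s.
      partial_contraction S (b + q) (coordinates A1 c1) (fst i) (snd i) * partial_contraction S (q + e) (coordinates A2 c2) (fst i) (snd i))"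
    unfolding bilinear_feature_sum
    unfolding partial_contraction_coordinates \<kappa>_def sum.cartesian_product'[of _ A1] sum.cartesian_product'[of _ A2]
    by (simp add: mult_ac)
  also have "\<dots> = (\<Sum>\<beta>\<in>tuples S s. \<Sum>\<beta>'\<in>tuples S s.
      partial_contraction S (b + q) (coordinates A1 c1) \<beta> \<beta>' * partial_contraction S (q + e) (coordinates A2 c2) \<beta> \<beta>')"
    unfolding sum.cartesian_product' by simp
  finally show ?thesis .
qed

text \<open>A second Cauchy-Schwarz step, over the free arguments, leaves one factor for each
  kernel.\<close>

lemma diagram_value_partial_le:
  assumes S: "finite S"
    and R1: "(\<Sum>\<beta>\<in>tuples S s. \<Sum>\<beta>'\<in>tuples S s. (partial_contraction S (b + q) (coordinates A1 c1) \<beta> \<beta>')\<^sup>2) \<le> R1"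
    and R2: "(\<Sum>\<beta>\<in>tuples S s. \<Sum>\<beta>'\<in>tuples S s. (partial_contraction S (q + e) (coordinates A2 c2) \<beta> \<beta>')\<^sup>2) \<le> R2"
  shows "\<bar>diagram_value (partial_sum_kernel S) A1 c1 A2 c2 s b q q e s\<bar> \<le> sqrt (R1 * R2)"
proof -
  define G1 where "G1 i = partial_contraction S (b + q) (coordinates A1 c1) (fst i) (snd i)" for i
  define G2 where "G2 i = partial_contraction S (q + e) (coordinates A2 c2) (fst i) (snd i)" for i
  let ?T = "tuples S s \<times> tuples S s"
  have r: "(\<Sum>i\<in>?T. (G1 i)\<^sup>2) \<le> R1" "(\<Sum>i\<in>?T. (G2 i)\<^sup>2) \<le> R2"
    using R1 R2 unfolding sum.cartesian_product' G1_def G2_def by simp_all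
  have "(\<Sum>i\<in>?T. G1 i * G2 i)\<^sup>2 \<le> (\<Sum>i\<in>?T. (G1 i)\<^sup>2) * (\<Sum>i\<in>?T. (G2 i)\<^sup>2)" by (rule Cauchy_Schwarz_ineq_sum)
  also have "\<dots> \<le> R1 * R2" using r by (intro mult_mono) (auto intro: sum_nonneg order_trans[OF sum_nonneg r(1)])
  finally have "\<bar>\<Sum>i\<in>?T. G1 i * G2 i\<bar> \<le> sqrt (R1 * R2)" by (rule real_le_rsqrt[of "\<bar>_\<bar>", simplified])
  moreover have "\<bar>diagram_value (partial_sum_kernel S) A1 c1 A2 c2 s b q q e s\<bar> \<le> (\<Sum>i\<in>?T. G1 i * G2 i)"
    using diagram_value_partial_bound[OF S, of A1 c1 A2 c2 s b q e] unfolding sum.cartesian_product' G1_def G2_def by simp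
  ultimately show ?thesis by linarith
qed

text \<open>Parseval's identity as a limit over finite subsets of \<open>B\<close>. The projection
  \<open>p S\<close> is at least as close to \<open>h\<close> as any \<open>y\<close> in the span of
  \<open>S\<close>, and the span of \<open>B\<close> is dense.\<close>

lemma partial_sum_kernel_tendsto:
  fixes B :: "'h::real_inner set"
  assumes "complete_orthonormal B"
  shows "((\<lambda>S. partial_sum_kernel S h g) \<longlongrightarrow> h \<bullet> g) (finite_subsets_at_top B)"
proof -
  have o: "a \<bullet> b = (if a = b then 1 else 0)" if "a \<in> B" "b \<in> B" for a b
    using assms that by (auto simp: complete_orthonormal_def pairwise_def orthogonal_def norm_eq_1)
  define p where "p S = (\<Sum>b\<in>S. (h \<bullet> b) *\<^sub>R b)" for S
  have "(p \<longlongrightarrow> h) (finite_subsets_at_top B)"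
  proof (rule tendstoI)
    fix \<epsilon> :: real assume "\<epsilon> > 0"
    have "h \<in> closure (span B)" using assms by (simp add: complete_orthonormal_def)
    then obtain y where y: "y \<in> span B" "dist y h < \<epsilon>" using \<open>\<epsilon> > 0\<close> closure_approachable by blast
    then obtain t r where t: "finite t" "t \<subseteq> B" "y = (\<Sum>a\<in>t. r a *\<^sub>R a)" unfolding span_explicit by blast
    show "\<forall>\<^sub>F S in finite_subsets_at_top B. dist (p S) h < \<epsilon>"
      unfolding eventually_finite_subsets_at_top
    proof (intro exI[of _ t] conjI allI impI t)
      fix S assume S: "finite S \<and> t \<subseteq> S \<and> S \<subseteq> B"
      define r' where "r' a = (if a \<in> t then r a else 0)" for a
      have y': "y = (\<Sum>a\<in>S. r' a *\<^sub>R a)" unfolding t(3) r'_def using S t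
        by (intro sum.mono_neutral_cong_left) auto
      have orth: "(h - p S) \<bullet> a = 0" if "a \<in> S" for a
      proof -
        have "p S \<bullet> a = (\<Sum>b\<in>S. if b = a then h \<bullet> a else 0)"
          unfolding p_def inner_sum_left using S that by (intro sum.cong refl) (auto simp: o subset_iff)
        then show ?thesis using S that by (simp add: inner_diff_left)
      qed
      have "p S - y = (\<Sum>a\<in>S. ((h \<bullet> a) - r' a) *\<^sub>R a)"
        unfolding p_def y' by (simp add: scaleR_diff_left sum_subtractf)
      then have "(h - p S) \<bullet> (p S - y) = 0" using orth by (simp add: inner_sum_right)
      then have "(norm ((h - p S) + (p S - y)))\<^sup>2 = (norm (h - p S))\<^sup>2 + (norm (p S - y))\<^sup>2"
        by (intro norm_add_Pythagorean) (simp add: orthogonal_def)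
      then have "(norm (h - p S))\<^sup>2 \<le> (norm (h - y))\<^sup>2" by simp
      then have "norm (h - p S) \<le> norm (h - y)" by (rule power2_le_imp_le) simp
      then show "dist (p S) h < \<epsilon>" using y(2) by (simp add: dist_norm norm_minus_commute)
    qed
  qed
  then have "((\<lambda>S. p S \<bullet> g) \<longlongrightarrow> h \<bullet> g) (finite_subsets_at_top B)" by (intro tendsto_inner tendsto_const)
  moreover have "p S \<bullet> g = partial_sum_kernel S h g" for S
    unfolding p_def partial_sum_kernel_def inner_sum_left by (simp add: inner_commute)
  ultimately show ?thesis by simp
qed

text \<open>The bounds \<open>R1\<close> and \<open>R2\<close> hold for every finite
  \<open>S\<close>, so the limit over finite subsets of \<open>B\<close> replaces the truncated
  kernel by the inner product.\<close>

lemma diagram_value_le: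
  fixes B :: "'h::real_inner set"
  assumes B: "complete_orthonormal B"
    and e: "a + b + c = D1" "a + d + e = D2" "b + d + f = D1" "c + e + f = D2"
    and R: "\<And>S. finite S \<Longrightarrow> S \<subseteq> B \<Longrightarrow>
        (\<Sum>\<beta>\<in>tuples S a. \<Sum>\<beta>'\<in>tuples S a. (partial_contraction S (D1 - a) (coordinates A1 c1) \<beta> \<beta>')\<^sup>2) \<le> R1"
      "\<And>S. finite S \<Longrightarrow> S \<subseteq> B \<Longrightarrow>
        (\<Sum>\<beta>\<in>tuples S a. \<Sum>\<beta>'\<in>tuples S a. (partial_contraction S (D2 - a) (coordinates A2 c2) \<beta> \<beta>')\<^sup>2) \<le> R2"
  shows "\<bar>diagram_value inner A1 c1 A2 c2 a b c d e f\<bar> \<le> sqrt (R1 * R2)"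
proof -
  \<comment> \<open>The four row sums force equally many edges 12 and 34 and equally many edges 14
    and 23.\<close>
  have eq: "f = a" "d = c" "D1 - a = b + c" "D2 - a = c + e" using e by linarith+
  have "((\<lambda>S. diagram_value (partial_sum_kernel S) A1 c1 A2 c2 a b c d e f) \<longlongrightarrow> diagram_value inner A1 c1 A2 c2 a b c d e f) (finite_subsets_at_top B)"
    unfolding diagram_value_def
    by (intro tendsto_sum tendsto_mult tendsto_power tendsto_const partial_sum_kernel_tendsto B)
  then have "((\<lambda>S. \<bar>diagram_value (partial_sum_kernel S) A1 c1 A2 c2 a b c d e f\<bar>) \<longlongrightarrow> \<bar>diagram_value inner A1 c1 A2 c2 a b c d e f\<bar>) (finite_subsets_at_top B)"
    by (rule tendsto_rabs)
  then show ?thesis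
  proof (rule tendsto_upperbound)
    show "\<forall>\<^sub>F S in finite_subsets_at_top B. \<bar>diagram_value (partial_sum_kernel S) A1 c1 A2 c2 a b c d e f\<bar> \<le> sqrt (R1 * R2)"
    proof (rule eventually_finite_subsets_at_top_weakI)
      fix S assume S: "finite S" "S \<subseteq> B"
      show "\<bar>diagram_value (partial_sum_kernel S) A1 c1 A2 c2 a b c d e f\<bar> \<le> sqrt (R1 * R2)"
        unfolding eq(1,2) by (rule diagram_value_partial_le) (use R[OF S] S in \<open>simp_all add: eq(3,4)\<close>)
    qed
  qed simp
qed

section \<open>Coordinates of symmetric tensors\<close>

lemma tensor_norm_square: "(tensor_norm B n T)\<^sup>2 = (\<Sum>\<^sub>\<infinity>bs\<in>tuples B n. (T bs)\<^sup>2)"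
  unfolding tensor_norm_def by (intro real_sqrt_pow2 infsum_nonneg) simp

lemma sum_square_le_tensor_norm:
  assumes "(\<lambda>bs. (T bs)\<^sup>2) summable_on tuples B n" "finite V" "V \<subseteq> tuples B n"
  shows "(\<Sum>bs\<in>V. (T bs)\<^sup>2) \<le> (tensor_norm B n T)\<^sup>2"
  unfolding tensor_norm_square using assms by (intro finite_sum_le_infsum) auto

lemma summable_square_append:
  assumes "(\<lambda>bs. (f bs)\<^sup>2) summable_on tuples B (s + p)" "\<beta> \<in> tuples B s"
  shows "(\<lambda>xs. (f (\<beta> @ xs))\<^sup>2 :: real) summable_on tuples B p"
proof -
  have "(\<lambda>bs. (f bs)\<^sup>2) summable_on (\<lambda>xs. \<beta> @ xs) ` tuples B p"
    by (rule summable_on_subset_banach[OF assms(1)]) (use assms(2) in \<open>auto simp: tuples_def\<close>)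
  then show ?thesis by (subst (asm) summable_on_reindex) (auto simp: inj_on_def o_def)
qed

lemma summable_on_nonneg_comparison:
  fixes f g :: "'a \<Rightarrow> real"
  assumes f: "f summable_on A" and g: "\<And>x. x \<in> A \<Longrightarrow> g x \<le> f x" "\<And>x. x \<in> A \<Longrightarrow> 0 \<le> g x"
  shows "g summable_on A"
proof (rule nonneg_bdd_above_summable_on)
  show "bdd_above (sum g ` {F. F \<subseteq> A \<and> finite F})"
  proof (rule bdd_aboveI2)
    fix F assume F: "F \<in> {F. F \<subseteq> A \<and> finite F}"
    have "sum g F \<le> sum f F" using F g by (intro sum_mono) auto
    also have "\<dots> \<le> infsum f A"
      using F by (intro finite_sum_le_infsum f) (auto intro: order_trans[OF g(2) g(1)])
    finally show "sum g F \<le> infsum f A" .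
  qed
qed (rule g)

lemma summable_product_of_squares:
  fixes f g :: "'a \<Rightarrow> real"
  assumes "(\<lambda>x. (f x)\<^sup>2) summable_on A" "(\<lambda>x. (g x)\<^sup>2) summable_on A"
  shows "(\<lambda>x. f x * g x) summable_on A"
proof -
  have "(\<lambda>x. (f x)\<^sup>2 + (g x)\<^sup>2) summable_on A" by (rule summable_on_add[OF assms])
  then have "(\<lambda>x. norm (f x * g x)) summable_on A"
  proof (rule summable_on_nonneg_comparison)
    show "norm (f x * g x) \<le> (f x)\<^sup>2 + (g x)\<^sup>2" for x
      using sum_squares_bound[of "\<bar>f x\<bar>" "\<bar>g x\<bar>"] abs_ge_zero[of "f x * g x"]
      unfolding power2_abs real_norm_def abs_mult by linarith
  qed auto
  then show ?thesis by (rule abs_summable_summable)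
qed

text \<open>With \<open>F\<close> read as a matrix, both sides are squared Hilbert-Schmidt norms, of
  the Gram matrix of the rows and of the Gram matrix of the columns.\<close>

lemma gram_square_swap:
  fixes F :: "'a \<Rightarrow> 'b \<Rightarrow> real"
  shows "(\<Sum>\<beta>\<in>U. \<Sum>\<beta>'\<in>U. (\<Sum>x\<in>V. F \<beta> x * F \<beta>' x)\<^sup>2) = (\<Sum>x\<in>V. \<Sum>y\<in>V. (\<Sum>\<beta>\<in>U. F \<beta> x * F \<beta> y)\<^sup>2)"
proof -
  have "(\<Sum>\<beta>\<in>U. \<Sum>\<beta>'\<in>U. (\<Sum>x\<in>V. F \<beta> x * F \<beta>' x)\<^sup>2) =
      (\<Sum>\<beta>\<in>U. \<Sum>\<beta>'\<in>U. 1 * 1 * (\<Sum>i\<in>V \<times> V. (F \<beta> (fst i) * F \<beta> (snd i)) * (F \<beta>' (fst i) * F \<beta>' (snd i))))"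
    unfolding power2_eq_square sum_product sum.cartesian_product' by (simp add: mult_ac)
  also have "\<dots> = (\<Sum>i\<in>V \<times> V. (\<Sum>\<beta>\<in>U. F \<beta> (fst i) * F \<beta> (snd i))\<^sup>2)"
    unfolding bilinear_feature_sum by (simp add: power2_eq_square)
  also have "\<dots> = (\<Sum>x\<in>V. \<Sum>y\<in>V. (\<Sum>\<beta>\<in>U. F \<beta> x * F \<beta> y)\<^sup>2)" unfolding sum.cartesian_product' by simp
  finally show ?thesis .
qed

text \<open>The inner sums have terms of either sign, so monotonicity in \<open>V\<close> is not
  visible termwise; after exchanging the Gram matrices a larger \<open>V\<close> only adds
  squares.\<close>

lemma gram_square_mono:
  fixes F :: "'a \<Rightarrow> 'b \<Rightarrow> real"
  assumes "finite V'" "V \<subseteq> V'"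
  shows "(\<Sum>\<beta>\<in>U. \<Sum>\<beta>'\<in>U. (\<Sum>x\<in>V. F \<beta> x * F \<beta>' x)\<^sup>2) \<le> (\<Sum>\<beta>\<in>U. \<Sum>\<beta>'\<in>U. (\<Sum>x\<in>V'. F \<beta> x * F \<beta>' x)\<^sup>2)"
proof -
  have "(\<Sum>i\<in>V \<times> V. (\<Sum>\<beta>\<in>U. F \<beta> (fst i) * F \<beta> (snd i))\<^sup>2) \<le> (\<Sum>i\<in>V' \<times> V'. (\<Sum>\<beta>\<in>U. F \<beta> (fst i) * F \<beta> (snd i))\<^sup>2)"
    using assms by (intro sum_mono2) auto
  then show ?thesis
    unfolding gram_square_swap[where U=U and V=V and F=F] gram_square_swap[where U=U and V=V' and F=F] sum.cartesian_product'
    by simp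
qed

lemma bilinear_square_sum_le:
  fixes F G :: "'a \<Rightarrow> 'b \<Rightarrow> real"
  shows "(\<Sum>\<beta>\<in>U. \<Sum>\<beta>'\<in>U. (\<Sum>x\<in>V. F \<beta> x * G \<beta>' x)\<^sup>2) \<le>
    (\<Sum>\<beta>\<in>U. \<Sum>x\<in>V. (F \<beta> x)\<^sup>2) * (\<Sum>\<beta>\<in>U. \<Sum>x\<in>V. (G \<beta> x)\<^sup>2)"
  unfolding sum_product by (intro sum_mono order_trans[OF Cauchy_Schwarz_ineq_sum]) (simp add: sum_product)

lemma symmetric_tensor_powerD:
  assumes "f \<in> symmetric_tensor_power B n"
  shows "multilinear_form n f"
    and "\<exists>C. \<forall>xs. length xs = n \<longrightarrow> \<bar>f xs\<bar> \<le> C * prod_list (map norm xs)"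
    and "(\<lambda>bs. (f bs)\<^sup>2) summable_on tuples B n"
    and "mset xs = mset ys \<Longrightarrow> f xs = f ys"
  using assms unfolding symmetric_tensor_power_def tensor_power_def by blast+

text \<open>The left side truncates the contracted and the free arguments to \<open>S\<close>.
  Letting the contracted ones range over all of \<open>B\<close> increases it by
  \<open>gram_square_mono\<close>, and releasing the free ones adds squares.\<close>

lemma partial_contraction_le_contraction:
  assumes f: "f \<in> symmetric_tensor_power B n" and s: "s \<le> n" and S: "finite S" "S \<subseteq> B"
  shows "(\<Sum>\<beta>\<in>tuples S s. \<Sum>\<beta>'\<in>tuples S s. (partial_contraction S (n - s) f \<beta> \<beta>')\<^sup>2) \<le>
    (tensor_norm B (2 * s) (contraction B n (n - s) f f))\<^sup>2"
proof -
  define p where "p = n - s"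
  have n: "n = s + p" "n - p = s" using s by (auto simp: p_def)
  have sm: "(\<lambda>bs. (f bs)\<^sup>2) summable_on tuples B (s + p)"
    using symmetric_tensor_powerD(3)[OF f] unfolding n(1) .
  have sym: "f (xs @ ys) = f (ys @ xs)" for xs ys
    by (rule symmetric_tensor_powerD(4)[OF f]) simp
  define c where "c \<beta> \<beta>' = (\<Sum>\<^sub>\<infinity>xs\<in>tuples B p. f (\<beta> @ xs) * f (\<beta>' @ xs))" for \<beta> \<beta>'
  define N where "N = (tensor_norm B n f)\<^sup>2"
  \<comment> \<open>Symmetry of \<open>f\<close> moves the contracted arguments behind the free
    ones.\<close>
  have con: "contraction B n p f f zs = c (take s zs) (drop s zs)" for zs
    unfolding contraction_def tensor_product_def partial_inner_def c_def n(2) by (simp add: sym)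
  have tU: "tuples S' s \<subseteq> tuples B s" if "S' \<subseteq> B" for S' using that by (rule tuples_mono)
  have lim: "((\<lambda>V. \<Sum>\<beta>\<in>U. \<Sum>\<beta>'\<in>U. (\<Sum>xs\<in>V. f (\<beta> @ xs) * f (\<beta>' @ xs))\<^sup>2) \<longlongrightarrow> (\<Sum>\<beta>\<in>U. \<Sum>\<beta>'\<in>U. (c \<beta> \<beta>')\<^sup>2)) (finite_subsets_at_top (tuples B p))"
    if U: "U \<subseteq> tuples B s" for U
    unfolding c_def
    by (intro tendsto_sum tendsto_power infsum_tendsto summable_product_of_squares summable_square_append[OF sm]) (use U in auto)
  have upper: "(\<Sum>\<beta>\<in>U. \<Sum>\<beta>'\<in>U. (c \<beta> \<beta>')\<^sup>2) \<le> N\<^sup>2" if U: "finite U" "U \<subseteq> tuples B s" for U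
  proof (rule tendsto_upperbound[OF lim[OF U(2)]])
    show "\<forall>\<^sub>F V in finite_subsets_at_top (tuples B p). (\<Sum>\<beta>\<in>U. \<Sum>\<beta>'\<in>U. (\<Sum>xs\<in>V. f (\<beta> @ xs) * f (\<beta>' @ xs))\<^sup>2) \<le> N\<^sup>2"
    proof (rule eventually_finite_subsets_at_top_weakI)
      fix V assume V: "finite V" "V \<subseteq> tuples B p"
      have "(\<Sum>\<beta>\<in>U. \<Sum>xs\<in>V. (f (\<beta> @ xs))\<^sup>2) = (\<Sum>bs\<in>(\<lambda>(\<beta>, xs). \<beta> @ xs) ` (U \<times> V). (f bs)\<^sup>2)"
        using U V unfolding sum.cartesian_product
        by (subst sum.reindex) (auto simp: inj_on_def tuples_def split_beta subset_iff)
      also have "\<dots> \<le> (tensor_norm B (s + p) f)\<^sup>2"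
        by (rule sum_square_le_tensor_norm[OF sm]) (use U V in \<open>auto simp: tuples_def subset_iff\<close>)
      finally have "(\<Sum>\<beta>\<in>U. \<Sum>xs\<in>V. (f (\<beta> @ xs))\<^sup>2) \<le> N" unfolding N_def n(1) .
      then have "(\<Sum>\<beta>\<in>U. \<Sum>xs\<in>V. (f (\<beta> @ xs))\<^sup>2) * (\<Sum>\<beta>\<in>U. \<Sum>xs\<in>V. (f (\<beta> @ xs))\<^sup>2) \<le> N * N"
        by (intro mult_mono) (auto intro!: sum_nonneg simp: N_def)
      with bilinear_square_sum_le[of "\<lambda>\<beta> xs. f (\<beta> @ xs)" "\<lambda>\<beta> xs. f (\<beta> @ xs)" V U]
      show "(\<Sum>\<beta>\<in>U. \<Sum>\<beta>'\<in>U. (\<Sum>xs\<in>V. f (\<beta> @ xs) * f (\<beta>' @ xs))\<^sup>2) \<le> N\<^sup>2"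
        by (simp add: power2_eq_square)
    qed
  qed simp
  have split: "(\<Sum>zs\<in>tuples S' (2 * s). (contraction B n p f f zs)\<^sup>2) = (\<Sum>\<beta>\<in>tuples S' s. \<Sum>\<beta>'\<in>tuples S' s. (c \<beta> \<beta>')\<^sup>2)" for S'
    unfolding con mult_2 sum_tuples_add by (intro sum.cong refl) (auto simp: tuples_def)
  \<comment> \<open>Summability has to be proved, since a divergent infinite sum is 0 by convention
    and \<open>tensor_norm\<close> would then be no upper bound. It follows from the bound
    \<open>N\<^sup>2\<close>, which is uniform over finite sets.\<close>
  have sc: "(\<lambda>zs. (contraction B n p f f zs)\<^sup>2) summable_on tuples B (2 * s)"
  proof (rule nonneg_bdd_above_summable_on)
    show "bdd_above (sum (\<lambda>zs. (contraction B n p f f zs)\<^sup>2) ` {F. F \<subseteq> tuples B (2 * s) \<and> finite F})"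
    proof (rule bdd_aboveI2)
      fix F assume F: "F \<in> {F. F \<subseteq> tuples B (2 * s) \<and> finite F}"
      define S' where "S' = (\<Union>zs\<in>F. set zs)"
      have S': "finite S'" "S' \<subseteq> B" "F \<subseteq> tuples S' (2 * s)" using F by (auto simp: S'_def tuples_def)
      have "(\<Sum>zs\<in>F. (contraction B n p f f zs)\<^sup>2) \<le> (\<Sum>zs\<in>tuples S' (2 * s). (contraction B n p f f zs)\<^sup>2)"
        using S' by (intro sum_mono2 finite_tuples) auto
      also have "\<dots> \<le> N\<^sup>2" unfolding split using S' by (intro upper finite_tuples tU)
      finally show "(\<Sum>zs\<in>F. (contraction B n p f f zs)\<^sup>2) \<le> N\<^sup>2" .
    qed
  qed simp
  have "(\<Sum>\<beta>\<in>tuples S s. \<Sum>\<beta>'\<in>tuples S s. (partial_contraction S p f \<beta> \<beta>')\<^sup>2) \<le> (\<Sum>\<beta>\<in>tuples S s. \<Sum>\<beta>'\<in>tuples S s. (c \<beta> \<beta>')\<^sup>2)"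
  proof (rule tendsto_lowerbound[OF lim[OF tU[OF S(2)]]])
    show "\<forall>\<^sub>F V in finite_subsets_at_top (tuples B p). (\<Sum>\<beta>\<in>tuples S s. \<Sum>\<beta>'\<in>tuples S s. (partial_contraction S p f \<beta> \<beta>')\<^sup>2) \<le>
        (\<Sum>\<beta>\<in>tuples S s. \<Sum>\<beta>'\<in>tuples S s. (\<Sum>xs\<in>V. f (\<beta> @ xs) * f (\<beta>' @ xs))\<^sup>2)"
      unfolding eventually_finite_subsets_at_top partial_contraction_def
      by (intro exI[of _ "tuples S p"] conjI allI impI finite_tuples tuples_mono S gram_square_mono) auto
  qed simp
  also have "\<dots> \<le> (tensor_norm B (2 * s) (contraction B n p f f))\<^sup>2"
    unfolding split[symmetric] by (rule sum_square_le_tensor_norm[OF sc finite_tuples[OF S(1)] tuples_mono[OF S(2)]])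
  finally show ?thesis unfolding p_def .
qed

text \<open>For the factor of a diagram that is merely kept bounded, for instance when no argument
  is contracted and smallness cannot be expected.\<close>

lemma partial_contraction_trivial_bound:
  "(\<Sum>\<beta>\<in>tuples S s. \<Sum>\<beta>'\<in>tuples S s. (partial_contraction S p T \<beta> \<beta>')\<^sup>2) \<le> (\<Sum>zs\<in>tuples S (s + p). (T zs)\<^sup>2)\<^sup>2"
  unfolding partial_contraction_def power2_eq_square[of "sum _ _ :: real"]
  unfolding sum_tuples_add
  using bilinear_square_sum_le[of "\<lambda>\<beta> xs. T (\<beta> @ xs)" "\<lambda>\<beta> xs. T (\<beta> @ xs)" "tuples S p" "tuples S s"]
  by (simp add: power2_eq_square)

text \<open>With \<open>u = T - f\<close>, the product of \<open>T\<close> with itself differs from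
  that of \<open>f\<close> by \<open>u\<close> times \<open>T\<close> plus \<open>f\<close> times
  \<open>u\<close>; each error is bounded by a product of Hilbert-Schmidt norms.\<close>

lemma partial_contraction_perturbation:
  fixes T f :: "'h list \<Rightarrow> real"
  defines "\<Delta> \<equiv> \<lambda>S m. \<Sum>zs\<in>tuples S m. (T zs - f zs)\<^sup>2"
  shows "(\<Sum>\<beta>\<in>tuples S s. \<Sum>\<beta>'\<in>tuples S s. (partial_contraction S p T \<beta> \<beta>')\<^sup>2) \<le>
    2 * (\<Sum>\<beta>\<in>tuples S s. \<Sum>\<beta>'\<in>tuples S s. (partial_contraction S p f \<beta> \<beta>')\<^sup>2) +
    4 * \<Delta> S (s + p) * ((\<Sum>zs\<in>tuples S (s + p). (f zs)\<^sup>2) + (\<Sum>zs\<in>tuples S (s + p). (T zs)\<^sup>2))"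
proof -
  let ?U = "tuples S s" and ?V = "tuples S p"
  define u where "u zs = T zs - f zs" for zs
  have e: "partial_contraction S p T \<beta> \<beta>' = partial_contraction S p f \<beta> \<beta>' +
      ((\<Sum>xs\<in>?V. u (\<beta> @ xs) * T (\<beta>' @ xs)) + (\<Sum>xs\<in>?V. f (\<beta> @ xs) * u (\<beta>' @ xs)))" for \<beta> \<beta>'
    unfolding partial_contraction_def u_def sum.distrib[symmetric] by (intro sum.cong refl) (simp add: algebra_simps)
  \<comment> \<open>The coefficients 2 and 4 come from applying
    \<open>(x + y)\<^sup>2 \<le> 2 * x\<^sup>2 + 2 * y\<^sup>2\<close> twice.\<close>
  have q: "(x + (y + z))\<^sup>2 \<le> 2 * x\<^sup>2 + 4 * y\<^sup>2 + 4 * z\<^sup>2" for x y z :: real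
    using zero_le_power2[of "x - (y + z)"] zero_le_power2[of "y - z"]
    by (simp add: power2_eq_square algebra_simps)
  have "(\<Sum>\<beta>\<in>?U. \<Sum>\<beta>'\<in>?U. (partial_contraction S p T \<beta> \<beta>')\<^sup>2) \<le>
      (\<Sum>\<beta>\<in>?U. \<Sum>\<beta>'\<in>?U. 2 * (partial_contraction S p f \<beta> \<beta>')\<^sup>2 + 4 * (\<Sum>xs\<in>?V. u (\<beta> @ xs) * T (\<beta>' @ xs))\<^sup>2 + 4 * (\<Sum>xs\<in>?V. f (\<beta> @ xs) * u (\<beta>' @ xs))\<^sup>2)"
    unfolding e by (intro sum_mono q)
  also have "\<dots> = 2 * (\<Sum>\<beta>\<in>?U. \<Sum>\<beta>'\<in>?U. (partial_contraction S p f \<beta> \<beta>')\<^sup>2) +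
      4 * (\<Sum>\<beta>\<in>?U. \<Sum>\<beta>'\<in>?U. (\<Sum>xs\<in>?V. u (\<beta> @ xs) * T (\<beta>' @ xs))\<^sup>2) + 4 * (\<Sum>\<beta>\<in>?U. \<Sum>\<beta>'\<in>?U. (\<Sum>xs\<in>?V. f (\<beta> @ xs) * u (\<beta>' @ xs))\<^sup>2)"
    unfolding sum.distrib sum_distrib_left ..
  also have "\<dots> \<le> 2 * (\<Sum>\<beta>\<in>?U. \<Sum>\<beta>'\<in>?U. (partial_contraction S p f \<beta> \<beta>')\<^sup>2) +
      4 * ((\<Sum>\<beta>\<in>?U. \<Sum>xs\<in>?V. (u (\<beta> @ xs))\<^sup>2) * (\<Sum>\<beta>\<in>?U. \<Sum>xs\<in>?V. (T (\<beta> @ xs))\<^sup>2)) +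
      4 * ((\<Sum>\<beta>\<in>?U. \<Sum>xs\<in>?V. (f (\<beta> @ xs))\<^sup>2) * (\<Sum>\<beta>\<in>?U. \<Sum>xs\<in>?V. (u (\<beta> @ xs))\<^sup>2))"
    by (intro add_mono mult_left_mono bilinear_square_sum_le) auto
  finally show ?thesis unfolding \<Delta>_def u_def sum_tuples_add by (simp add: algebra_simps)
qed

section \<open>Powers of vectors as symmetric tensors\<close>

lemma elementary_tensor_replicate:
  "elementary_tensor (replicate n h) xs = (if length xs = n then power_coordinate h xs else 0)"
proof -
  have "prod_list (map (\<lambda>b. h \<bullet> b) xs) = (\<Prod>i<length xs. h \<bullet> xs ! i)"
    by (induction xs) (simp_all add: prod.lessThan_Suc_shift del: prod.lessThan_Suc)
  then show ?thesis by (auto simp: elementary_tensor_def power_coordinate_def)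
qed

lemma abs_power_coordinate_le: "\<bar>power_coordinate h xs\<bar> \<le> norm h ^ length xs * prod_list (map norm xs)"
proof (induction xs)
  case (Cons x xs)
  have "\<bar>h \<bullet> x\<bar> * \<bar>power_coordinate h xs\<bar> \<le> (norm h * norm x) * (norm h ^ length xs * prod_list (map norm xs))"
    by (intro mult_mono Cons Cauchy_Schwarz_ineq2) auto
  then show ?case by (simp add: abs_mult mult_ac)
qed simp

text \<open>Bessel's inequality: the diagonal kernel grows with \<open>S\<close> and converges to
  \<open>h \<bullet> h\<close>.\<close>

lemma partial_sum_kernel_le:
  assumes B: "complete_orthonormal B" and S: "finite S" "S \<subseteq> B"
  shows "partial_sum_kernel S h h \<le> h \<bullet> h"
proof (rule tendsto_lowerbound[OF partial_sum_kernel_tendsto[OF B]])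
  show "\<forall>\<^sub>F S' in finite_subsets_at_top B. partial_sum_kernel S h h \<le> partial_sum_kernel S' h h"
    unfolding eventually_finite_subsets_at_top
  proof (intro exI[of _ S] conjI allI impI S)
    fix S' assume "finite S' \<and> S \<subseteq> S' \<and> S' \<subseteq> B"
    then show "partial_sum_kernel S h h \<le> partial_sum_kernel S' h h"
      unfolding partial_sum_kernel_def by (intro sum_mono2) auto
  qed
qed simp

lemma elementary_power_in_symmetric_tensor_power:
  assumes B: "complete_orthonormal B"
  shows "elementary_tensor (replicate n h) \<in> symmetric_tensor_power B n"
proof -
  let ?T = "elementary_tensor (replicate n h)"
  have "linear (\<lambda>x. ?T (xs[i := x]))" if "length xs = n" "i < n" for xs i
  proof -
    have "?T (xs[i := x]) = power_coordinate h (take i xs) * ((h \<bullet> x) * power_coordinate h (drop (Suc i) xs))" for x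
      using that by (simp add: elementary_tensor_replicate upd_conv_take_nth_drop)
    then show ?thesis by (auto intro!: linearI simp: inner_add_right algebra_simps)
  qed
  then have ml: "multilinear_form n ?T" by (simp add: multilinear_form_def elementary_tensor_replicate)
  have "\<exists>C. \<forall>xs. length xs = n \<longrightarrow> \<bar>?T xs\<bar> \<le> C * prod_list (map norm xs)"
    by (intro exI[of _ "norm h ^ n"]) (auto simp: elementary_tensor_replicate abs_power_coordinate_le)
  moreover have "(\<lambda>bs. (?T bs)\<^sup>2) summable_on tuples B n"
  proof (rule nonneg_bdd_above_summable_on)
    show "bdd_above (sum (\<lambda>bs. (?T bs)\<^sup>2) ` {F. F \<subseteq> tuples B n \<and> finite F})"
    proof (rule bdd_aboveI2)
      fix F assume F: "F \<in> {F. F \<subseteq> tuples B n \<and> finite F}"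
      \<comment> \<open>Finitely many tuples have finitely many entries, so they lie in a full power
        \<open>tuples S n\<close>, over which the sum factors into a power of the kernel.\<close>
      define S where "S = (\<Union>zs\<in>F. set zs)"
      have S: "finite S" "S \<subseteq> B" "F \<subseteq> tuples S n" using F by (auto simp: S_def tuples_def)
      have "(\<Sum>bs\<in>F. (?T bs)\<^sup>2) \<le> (\<Sum>bs\<in>tuples S n. (?T bs)\<^sup>2)"
        using S by (intro sum_mono2 finite_tuples) auto
      also have "\<dots> = (\<Sum>bs\<in>tuples S n. power_coordinate h bs * power_coordinate h bs)"
        by (intro sum.cong refl) (simp add: elementary_tensor_replicate tuples_def power2_eq_square)
      also have "\<dots> \<le> (h \<bullet> h) ^ n"
        unfolding sum_power_coordinate using S B
        by (intro power_mono partial_sum_kernel_le) (auto simp: partial_sum_kernel_def intro!: sum_nonneg)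
      finally show "(\<Sum>bs\<in>F. (?T bs)\<^sup>2) \<le> (h \<bullet> h) ^ n" .
    qed
  qed simp
  moreover have "?T xs = ?T ys" if "mset xs = mset ys" for xs ys
  proof -
    have "prod_mset (image_mset (\<lambda>b. h \<bullet> b) (mset xs)) = prod_mset (image_mset (\<lambda>b. h \<bullet> b) (mset ys))" using that by simp
    then have "power_coordinate h xs = power_coordinate h ys"
      unfolding power_coordinate_def by (simp add: prod_mset_prod_list flip: mset_map)
    moreover have "length xs = length ys" using that by (rule mset_eq_length)
    ultimately show ?thesis by (simp add: elementary_tensor_replicate)
  qed
  ultimately show ?thesis using ml unfolding symmetric_tensor_power_def tensor_power_def by blast
qed

lemma symmetric_tensor_power_combination:
  assumes f: "f \<in> symmetric_tensor_power B n" and g: "g \<in> symmetric_tensor_power B n"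
  shows "(\<lambda>xs. a * f xs + b * g xs) \<in> symmetric_tensor_power B n"
proof -
  have lf: "linear (\<lambda>x. f (xs[i := x]))" and lg: "linear (\<lambda>x. g (xs[i := x]))" if "length xs = n" "i < n" for xs i
    using symmetric_tensor_powerD(1)[OF f] symmetric_tensor_powerD(1)[OF g] that by (simp_all add: multilinear_form_def)
  have "linear (\<lambda>x. a * f (xs[i := x]) + b * g (xs[i := x]))" if "length xs = n" "i < n" for xs i
  proof (rule linearI)
    show "a * f (xs[i := x + y]) + b * g (xs[i := x + y]) = a * f (xs[i := x]) + b * g (xs[i := x]) + (a * f (xs[i := y]) + b * g (xs[i := y]))" for x y
      using linear_add[OF lf[OF that]] linear_add[OF lg[OF that]] by (simp add: algebra_simps)
    show "a * f (xs[i := r *\<^sub>R x]) + b * g (xs[i := r *\<^sub>R x]) = r *\<^sub>R (a * f (xs[i := x]) + b * g (xs[i := x]))" for r x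
      using linear_scale[OF lf[OF that]] linear_scale[OF lg[OF that]] by (simp add: algebra_simps)
  qed
  then have ml: "multilinear_form n (\<lambda>xs. a * f xs + b * g xs)"
    using symmetric_tensor_powerD(1)[OF f] symmetric_tensor_powerD(1)[OF g] by (simp add: multilinear_form_def)
  obtain C D where C: "\<And>xs. length xs = n \<Longrightarrow> \<bar>f xs\<bar> \<le> C * prod_list (map norm xs)"
    and D: "\<And>xs. length xs = n \<Longrightarrow> \<bar>g xs\<bar> \<le> D * prod_list (map norm xs)"
    using symmetric_tensor_powerD(2)[OF f] symmetric_tensor_powerD(2)[OF g] by blast
  have "\<bar>a * f xs + b * g xs\<bar> \<le> (\<bar>a\<bar> * C + \<bar>b\<bar> * D) * prod_list (map norm xs)" if "length xs = n" for xs
  proof -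
    have "\<bar>a * f xs + b * g xs\<bar> \<le> \<bar>a\<bar> * \<bar>f xs\<bar> + \<bar>b\<bar> * \<bar>g xs\<bar>" by (metis abs_mult abs_triangle_ineq)
    also have "\<dots> \<le> \<bar>a\<bar> * (C * prod_list (map norm xs)) + \<bar>b\<bar> * (D * prod_list (map norm xs))"
      by (intro add_mono mult_left_mono C D that) auto
    finally show ?thesis by (simp add: algebra_simps)
  qed
  then have bd: "\<exists>C. \<forall>xs. length xs = n \<longrightarrow> \<bar>a * f xs + b * g xs\<bar> \<le> C * prod_list (map norm xs)" by blast
  have sf: "(\<lambda>bs. (f bs)\<^sup>2) summable_on tuples B n" and sg: "(\<lambda>bs. (g bs)\<^sup>2) summable_on tuples B n"
    by (rule symmetric_tensor_powerD(3)[OF f] symmetric_tensor_powerD(3)[OF g])+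
  have "(\<lambda>bs. 2 * a\<^sup>2 * (f bs)\<^sup>2 + 2 * b\<^sup>2 * (g bs)\<^sup>2) summable_on tuples B n"
    by (intro summable_on_add summable_on_cmult_right sf sg)
  then have "(\<lambda>bs. (a * f bs + b * g bs)\<^sup>2) summable_on tuples B n"
  proof (rule summable_on_nonneg_comparison)
    fix bs
    have "(x + y)\<^sup>2 \<le> 2 * x\<^sup>2 + 2 * y\<^sup>2" for x y :: real
      using zero_le_power2[of "x - y"] by (simp add: power2_eq_square algebra_simps)
    from this[of "a * f bs" "b * g bs"] show "(a * f bs + b * g bs)\<^sup>2 \<le> 2 * a\<^sup>2 * (f bs)\<^sup>2 + 2 * b\<^sup>2 * (g bs)\<^sup>2"
      by (simp add: power_mult_distrib)
  qed simp
  moreover have "a * f xs + b * g xs = a * f ys + b * g ys" if "mset xs = mset ys" for xs ys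
  proof -
    have "f xs = f ys" "g xs = g ys"
      by (rule symmetric_tensor_powerD(4)[OF f that] symmetric_tensor_powerD(4)[OF g that])+
    then show ?thesis by simp
  qed
  ultimately show ?thesis using ml bd unfolding symmetric_tensor_power_def tensor_power_def by blast
qed

text \<open>The kernel of the Hermite sum with the same \<open>A\<close> and \<open>c\<close>: for
  unit vectors, the isometry maps it to \<open>hermite_sum n A c\<close> almost everywhere.\<close>

definition power_sum_tensor :: "nat \<Rightarrow> 'h::real_inner set \<Rightarrow> ('h \<Rightarrow> real) \<Rightarrow> 'h tensor" where
  "power_sum_tensor n A c xs = (\<Sum>h\<in>A. c h * elementary_tensor (replicate n h) xs)"

lemma power_sum_tensor_eq_coordinates: "length xs = n \<Longrightarrow> power_sum_tensor n A c xs = coordinates A c xs"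
  by (simp add: power_sum_tensor_def coordinates_def elementary_tensor_replicate)

lemma power_sum_tensor_insert:
  "finite A \<Longrightarrow> h \<notin> A \<Longrightarrow>
    power_sum_tensor n (insert h A) c = (\<lambda>xs. c h * elementary_tensor (replicate n h) xs + 1 * power_sum_tensor n A c xs)"
  by (simp add: power_sum_tensor_def fun_eq_iff)

lemma power_sum_tensor_in_symmetric_tensor_power:
  assumes B: "complete_orthonormal B"
  shows "power_sum_tensor n A c \<in> symmetric_tensor_power B n"
proof (induction A rule: infinite_finite_induct)
  case empty
  have "(\<lambda>xs. 0 * elementary_tensor (replicate n 0) xs + 0 * elementary_tensor (replicate n 0) xs) \<in> symmetric_tensor_power B n"
    by (intro symmetric_tensor_power_combination elementary_power_in_symmetric_tensor_power B)
  then show ?case by (simp add: power_sum_tensor_def[abs_def])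
next
  case (infinite A)
  have "(\<lambda>xs. 0 * elementary_tensor (replicate n 0) xs + 0 * elementary_tensor (replicate n 0) xs) \<in> symmetric_tensor_power B n"
    by (intro symmetric_tensor_power_combination elementary_power_in_symmetric_tensor_power B)
  then show ?case using infinite by (simp add: power_sum_tensor_def[abs_def])
next
  case (insert h A)
  then show ?case
    unfolding power_sum_tensor_insert[OF insert.hyps] by (intro symmetric_tensor_power_combination elementary_power_in_symmetric_tensor_power B)
qed

section \<open>Approximation of multiple integrals by Hermite sums\<close>

context isonormal begin

text \<open>Linearity of the isometry holds almost everywhere for each combination of two tensors;
  along a finite induction only finitely many null sets accumulate.\<close>

lemma isometry_power_sum_tensor:
  assumes B: "complete_orthonormal B" and W: "wiener_isometry M X B n J"
    and A: "finite A" "\<And>h. h \<in> A \<Longrightarrow> norm h = 1"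
  shows "AE w in M. J (power_sum_tensor n A c) w = hermite_sum n A c w"
  using A
proof (induction A rule: finite_induct)
  case empty
  let ?e = "elementary_tensor (replicate n 0) :: 'h tensor"
  have "?e \<in> symmetric_tensor_power B n" by (rule elementary_power_in_symmetric_tensor_power[OF B])
  then have "AE w in M. J (\<lambda>xs. 0 * ?e xs + 0 * ?e xs) w = 0 * J ?e w + 0 * J ?e w"
    using W unfolding wiener_isometry_def by blast
  then show ?case by (simp add: power_sum_tensor_def[abs_def] hermite_sum_def)
next
  case (insert h A)
  let ?e = "elementary_tensor (replicate n h) :: 'h tensor"
  have "?e \<in> symmetric_tensor_power B n" "power_sum_tensor n A c \<in> symmetric_tensor_power B n"
    by (rule elementary_power_in_symmetric_tensor_power[OF B] power_sum_tensor_in_symmetric_tensor_power[OF B])+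
  then have "AE w in M. J (\<lambda>xs. c h * ?e xs + 1 * power_sum_tensor n A c xs) w = c h * J ?e w + 1 * J (power_sum_tensor n A c) w"
    using W unfolding wiener_isometry_def by blast
  moreover have "AE w in M. J ?e w = hermite n (X h w)"
    using W insert.prems unfolding wiener_isometry_def by blast
  moreover have "AE w in M. J (power_sum_tensor n A c) w = hermite_sum n A c w" using insert by blast
  ultimately show ?case
    unfolding power_sum_tensor_insert[OF insert.hyps]
  proof eventually_elim
    case (elim w)
    then show ?case using insert.hyps by (simp add: hermite_sum_def)
  qed
qed

text \<open>The definition of the chaos approximates the random variable only. The isometry carries
  the error over to the kernels, with a factor \<open>fact n \<ge> 1\<close>, so one choice of
  \<open>A\<close> and \<open>c\<close> serves both; the sums over \<open>tuples S n\<close> are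
  below the squared tensor norm of the difference for every \<open>S\<close>.\<close>

lemma chaos_approximation:
  assumes B: "complete_orthonormal B" and W: "wiener_isometry M X B n J"
    and f: "f \<in> symmetric_tensor_power B n" and \<epsilon>: "\<epsilon> > 0"
  obtains A c where "finite A" "\<And>h. h \<in> A \<Longrightarrow> norm h = 1"
    "(LINT w|M. (J f w - hermite_sum n A c w)\<^sup>2) \<le> \<epsilon>"
    "\<And>S. finite S \<Longrightarrow> S \<subseteq> B \<Longrightarrow> (\<Sum>zs\<in>tuples S n. (coordinates A c zs - f zs)\<^sup>2) \<le> \<epsilon>"
proof -
  have "J f \<in> wiener_chaos M X n" using W f unfolding wiener_isometry_def by blast
  then obtain A c where A: "finite A" "\<forall>h\<in>A. norm h = 1"
    and e: "(LINT w|M. (J f w - (\<Sum>h\<in>A. c h * hermite n (X h w)))\<^sup>2) < \<epsilon>"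
    using \<epsilon> unfolding wiener_chaos_def by blast
  let ?g = "power_sum_tensor n A c"
  have g: "?g \<in> symmetric_tensor_power B n" by (rule power_sum_tensor_in_symmetric_tensor_power[OF B])
  \<comment> \<open>The difference of the kernels is written as a linear combination, in the shape
    of the linearity clause of \<open>wiener_isometry\<close>.\<close>
  have D: "(\<lambda>xs. 1 * f xs + (- 1) * ?g xs) \<in> symmetric_tensor_power B n" (is "?D \<in> _")
    by (rule symmetric_tensor_power_combination[OF f g])
  have m: "J f \<in> borel_measurable M" "J ?D \<in> borel_measurable M"
    using W f D unfolding wiener_isometry_def wiener_chaos_def by blast+
  have "AE w in M. J ?D w = 1 * J f w + (- 1) * J ?g w"
    using W f g unfolding wiener_isometry_def by blast
  moreover have "AE w in M. J ?g w = hermite_sum n A c w"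
    by (rule isometry_power_sum_tensor[OF B W A(1)]) (use A in blast)
  ultimately have "AE w in M. (J ?D w)\<^sup>2 = (J f w - hermite_sum n A c w)\<^sup>2"
    by eventually_elim simp
  then have "(LINT w|M. (J ?D w)\<^sup>2) = (LINT w|M. (J f w - hermite_sum n A c w)\<^sup>2)"
    by (intro integral_cong_AE borel_measurable_power borel_measurable_diff m all_moments_measurable all_moments_hermite_sum)
  then have 1: "(LINT w|M. (J ?D w)\<^sup>2) \<le> \<epsilon>" using e by (simp add: hermite_sum_def)
  have "(LINT w|M. (J ?D w)\<^sup>2) = (sqrt (fact n) * tensor_norm B n ?D)\<^sup>2"
    using W D unfolding wiener_isometry_def by blast
  also have "\<dots> = fact n * (tensor_norm B n ?D)\<^sup>2" by (simp add: power_mult_distrib)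
  finally have "1 * (tensor_norm B n ?D)\<^sup>2 \<le> \<epsilon>"
    using 1 mult_right_mono[OF fact_ge_1[of n], of "(tensor_norm B n ?D)\<^sup>2"] by simp
  moreover have "(\<Sum>zs\<in>tuples S n. (coordinates A c zs - f zs)\<^sup>2) \<le> (tensor_norm B n ?D)\<^sup>2" if S: "finite S" "S \<subseteq> B" for S
  proof -
    have "(\<Sum>zs\<in>tuples S n. (coordinates A c zs - f zs)\<^sup>2) = (\<Sum>zs\<in>tuples S n. (?D zs)\<^sup>2)"
      by (intro sum.cong refl) (simp add: tuples_def power_sum_tensor_eq_coordinates power2_commute)
    also have "\<dots> \<le> (tensor_norm B n ?D)\<^sup>2"
      by (rule sum_square_le_tensor_norm[OF symmetric_tensor_powerD(3)[OF D] finite_tuples[OF S(1)] tuples_mono[OF S(2)]])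
    finally show ?thesis .
  qed
  ultimately have "(\<Sum>zs\<in>tuples S n. (coordinates A c zs - f zs)\<^sup>2) \<le> \<epsilon>" if "finite S" "S \<subseteq> B" for S
    using that by fastforce
  with that[of A c] A e show ?thesis by (simp add: hermite_sum_def less_imp_le)
qed

end

section \<open>Stability under perturbations in mean square\<close>

lemma norm_iexp_diff_le: "cmod (iexp x - iexp y) \<le> \<bar>x - y\<bar>"
proof -
  have "iexp x - iexp y = iexp y * (iexp (x - y) - 1)"
    by (simp add: right_diff_distrib exp_add[symmetric])
  moreover have "cmod (iexp (x - y) - 1) \<le> \<bar>x - y\<bar>"
    using iexp_approx1[of "x - y" 0] by simp
  ultimately show ?thesis by (simp add: norm_mult)
qed

lemma abs_exp_minus_diff_le:
  assumes "0 \<le> x" "0 \<le> (y::real)"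
  shows "\<bar>exp (- x / 2) - exp (- y / 2)\<bar> \<le> \<bar>x - y\<bar>"
proof -
  have *: "exp (- a / 2) - exp (- b / 2) \<le> b - a" if "0 \<le> a" "a \<le> b" for a b :: real
  proof -
    have "1 + (a - b) / 2 \<le> exp ((a - b) / 2)" by (rule exp_ge_add_one_self)
    then have "1 - exp ((a - b) / 2) \<le> (b - a) / 2" by (simp add: field_simps)
    moreover have "0 \<le> 1 - exp ((a - b) / 2)" using that by simp
    moreover have "exp (- a / 2) \<le> 1" using that by simp
    ultimately have "exp (- a / 2) * (1 - exp ((a - b) / 2)) \<le> 1 * ((b - a) / 2)" by (intro mult_mono) auto
    moreover have "exp (- a / 2) * exp ((a - b) / 2) = exp (- b / 2)"
      unfolding exp_add[symmetric] by (simp add: field_simps)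
    ultimately show ?thesis using that by (simp add: right_diff_distrib)
  qed
  show ?thesis
  proof (cases "x \<le> y")
    case True
    then show ?thesis using *[of x y] assms by simp
  next
    case False
    then show ?thesis using *[of y x] assms by simp
  qed
qed

lemma (in prob_space) norm_expectation_iexp_diff_le:
  assumes Y: "Y \<in> borel_measurable M" and Z: "Z \<in> borel_measurable M" and i: "integrable M (\<lambda>w. Y w - Z w)"
  shows "cmod ((LINT w|M. iexp (Y w)) - (LINT w|M. iexp (Z w))) \<le> (LINT w|M. \<bar>Y w - Z w\<bar>)"
proof -
  have int: "integrable M (\<lambda>w. iexp (U w))" if "U \<in> borel_measurable M" for U
    using integrable_iexp[of "\<lambda>w. complex_of_real (U w)"] that by simp
  have "cmod ((LINT w|M. iexp (Y w)) - (LINT w|M. iexp (Z w))) = cmod (LINT w|M. iexp (Y w) - iexp (Z w))"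
    using int[OF Y] int[OF Z] by simp
  also have "\<dots> \<le> (LINT w|M. cmod (iexp (Y w) - iexp (Z w)))" by (rule integral_norm_bound)
  also have "\<dots> \<le> (LINT w|M. \<bar>Y w - Z w\<bar>)"
  proof (rule integral_mono)
    show "integrable M (\<lambda>w. cmod (iexp (Y w) - iexp (Z w)))"
      using int[OF Y] int[OF Z] by (intro integrable_norm Bochner_Integration.integrable_diff)
    show "integrable M (\<lambda>w. \<bar>Y w - Z w\<bar>)" using i by (rule integrable_abs)
  qed (rule norm_iexp_diff_le)
  finally show ?thesis .
qed

lemma (in prob_space) square_integrable_sum:
  fixes a b :: real
  assumes "Y \<in> borel_measurable M" "integrable M (\<lambda>w. (Y w)\<^sup>2)" "Z \<in> borel_measurable M" "integrable M (\<lambda>w. (Z w)\<^sup>2)"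
  shows "integrable M (\<lambda>w. (a * Y w + b * Z w)\<^sup>2)"
proof -
  have "(a * y + b * z)\<^sup>2 = a\<^sup>2 * y\<^sup>2 + 2 * a * b * (y * z) + b\<^sup>2 * z\<^sup>2" for y z :: real
    by (simp add: power2_eq_square algebra_simps)
  then show ?thesis using assms cauchy_schwarz(1)[OF assms] by simp
qed

text \<open>The difference splits into the expectations of \<open>(Y - Y') * Z\<close> and
  \<open>Y' * (Z - Z')\<close>. The constant \<open>2 * K + 2\<close> bounds the second moment of
  \<open>Y'\<close>, whose mean square distance from \<open>Y\<close> is at most 1.\<close>

lemma (in prob_space) second_moment_perturbation:
  assumes Y: "Y \<in> borel_measurable M" "integrable M (\<lambda>w. (Y w)\<^sup>2)"
    and Z: "Z \<in> borel_measurable M" "integrable M (\<lambda>w. (Z w)\<^sup>2)"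
    and Y': "Y' \<in> borel_measurable M" "integrable M (\<lambda>w. (Y' w)\<^sup>2)"
    and Z': "Z' \<in> borel_measurable M" "integrable M (\<lambda>w. (Z' w)\<^sup>2)"
    and e: "(LINT w|M. (Y w - Y' w)\<^sup>2) \<le> \<epsilon>" "(LINT w|M. (Z w - Z' w)\<^sup>2) \<le> \<epsilon>" "\<epsilon> \<le> 1"
    and K: "(LINT w|M. (Y w)\<^sup>2) \<le> K" "(LINT w|M. (Z w)\<^sup>2) \<le> K"
  shows "\<bar>(LINT w|M. Y w * Z w) - (LINT w|M. Y' w * Z' w)\<bar> \<le> sqrt \<epsilon> * (sqrt K + sqrt (2 * K + 2))"
proof -
  have dY: "(\<lambda>w. Y w - Y' w) \<in> borel_measurable M" "integrable M (\<lambda>w. (Y w - Y' w)\<^sup>2)"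
    using Y Y' square_integrable_sum[OF Y Y', of 1 "- 1"] by auto
  have dZ: "(\<lambda>w. Z w - Z' w) \<in> borel_measurable M" "integrable M (\<lambda>w. (Z w - Z' w)\<^sup>2)"
    using Z Z' square_integrable_sum[OF Z Z', of 1 "- 1"] by auto
  have e0: "0 \<le> \<epsilon>" by (rule order_trans[OF _ e(1)]) simp
  have K0: "0 \<le> K" by (rule order_trans[OF _ K(1)]) simp
  have "(LINT w|M. (Y' w)\<^sup>2) \<le> (LINT w|M. 2 * (Y w)\<^sup>2 + 2 * (Y w - Y' w)\<^sup>2)"
  proof (rule integral_mono)
    show "(Y' w)\<^sup>2 \<le> 2 * (Y w)\<^sup>2 + 2 * (Y w - Y' w)\<^sup>2" for w
      using zero_le_power2[of "2 * Y w - Y' w"] by (simp add: power2_eq_square algebra_simps)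
  qed (use Y Y' dY in auto)
  also have "\<dots> = 2 * (LINT w|M. (Y w)\<^sup>2) + 2 * (LINT w|M. (Y w - Y' w)\<^sup>2)"
    using Y dY by simp
  also have "\<dots> \<le> 2 * K + 2" using K(1) e by linarith
  finally have Y'2: "(LINT w|M. (Y' w)\<^sup>2) \<le> 2 * K + 2" .
  have "(LINT w|M. Y w * Z w) - (LINT w|M. Y' w * Z' w) = (LINT w|M. (Y w - Y' w) * Z w) + (LINT w|M. Y' w * (Z w - Z' w))"
  proof -
    have "(LINT w|M. (Y w - Y' w) * Z w) = (LINT w|M. Y w * Z w) - (LINT w|M. Y' w * Z w)"
      using cauchy_schwarz(1)[OF Y Z] cauchy_schwarz(1)[OF Y' Z] by (simp add: left_diff_distrib)
    moreover have "(LINT w|M. Y' w * (Z w - Z' w)) = (LINT w|M. Y' w * Z w) - (LINT w|M. Y' w * Z' w)"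
      using cauchy_schwarz(1)[OF Y' Z'] cauchy_schwarz(1)[OF Y' Z] by (simp add: right_diff_distrib)
    ultimately show ?thesis by simp
  qed
  moreover have "\<bar>LINT w|M. (Y w - Y' w) * Z w\<bar> \<le> sqrt \<epsilon> * sqrt K"
    by (rule order_trans[OF cauchy_schwarz(2)[OF dY Z]]) (intro mult_mono real_sqrt_le_mono e K, use e0 in auto)
  moreover have "\<bar>LINT w|M. Y' w * (Z w - Z' w)\<bar> \<le> sqrt (2 * K + 2) * sqrt \<epsilon>"
    by (rule order_trans[OF cauchy_schwarz(2)[OF Y' dZ]]) (intro mult_mono real_sqrt_le_mono e Y'2, use K0 in auto)
  ultimately show ?thesis by (simp add: distrib_left mult.commute)
qed

text \<open>\<open>T\<close> stands for the coordinates of the approximating Hermite sum. Its square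
  sum is at most \<open>2 * N + 2\<close>, whence the first bound; together with \<open>N\<close>
  for \<open>f\<close> this gives \<open>3 * N + 2\<close> in the second.\<close>

lemma partial_contraction_approximation:
  assumes f: "f \<in> symmetric_tensor_power B n" and N: "(tensor_norm B n f)\<^sup>2 \<le> N"
    and d: "\<And>S. finite S \<Longrightarrow> S \<subseteq> B \<Longrightarrow> (\<Sum>zs\<in>tuples S n. (T zs - f zs)\<^sup>2) \<le> \<epsilon>" and \<epsilon>: "\<epsilon> \<le> 1"
    and s: "s \<le> n" and S: "finite S" "S \<subseteq> B"
  shows "(\<Sum>\<beta>\<in>tuples S s. \<Sum>\<beta>'\<in>tuples S s. (partial_contraction S (n - s) T \<beta> \<beta>')\<^sup>2) \<le> (2 * N + 2)\<^sup>2"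
    and "(\<Sum>\<beta>\<in>tuples S s. \<Sum>\<beta>'\<in>tuples S s. (partial_contraction S (n - s) T \<beta> \<beta>')\<^sup>2) \<le>
      2 * (tensor_norm B (2 * s) (contraction B n (n - s) f f))\<^sup>2 + 4 * \<epsilon> * (3 * N + 2)"
proof -
  have n: "s + (n - s) = n" using s by simp
  have e0: "0 \<le> \<epsilon>" by (rule order_trans[OF sum_nonneg d[OF S]]) simp
  have N0: "0 \<le> N" by (rule order_trans[OF zero_le_power2 N])
  have F: "(\<Sum>zs\<in>tuples S n. (f zs)\<^sup>2) \<le> N"
    using sum_square_le_tensor_norm[OF symmetric_tensor_powerD(3)[OF f] finite_tuples[OF S(1)] tuples_mono[OF S(2)]] N
    by (rule order_trans)
  have "(\<Sum>zs\<in>tuples S n. (T zs)\<^sup>2) \<le> (\<Sum>zs\<in>tuples S n. 2 * (f zs)\<^sup>2 + 2 * (T zs - f zs)\<^sup>2)"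
  proof (rule sum_mono)
    show "(T zs)\<^sup>2 \<le> 2 * (f zs)\<^sup>2 + 2 * (T zs - f zs)\<^sup>2" for zs
      using zero_le_power2[of "T zs - 2 * f zs"] by (simp add: power2_eq_square algebra_simps)
  qed
  also have "\<dots> = 2 * (\<Sum>zs\<in>tuples S n. (f zs)\<^sup>2) + 2 * (\<Sum>zs\<in>tuples S n. (T zs - f zs)\<^sup>2)"
    by (simp add: sum.distrib sum_distrib_left)
  also have "\<dots> \<le> 2 * N + 2" using F d[OF S] \<epsilon> by linarith
  finally have T: "(\<Sum>zs\<in>tuples S n. (T zs)\<^sup>2) \<le> 2 * N + 2" .
  show "(\<Sum>\<beta>\<in>tuples S s. \<Sum>\<beta>'\<in>tuples S s. (partial_contraction S (n - s) T \<beta> \<beta>')\<^sup>2) \<le> (2 * N + 2)\<^sup>2"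
    by (rule order_trans[OF partial_contraction_trivial_bound]) (unfold n, intro power_mono T sum_nonneg, simp)
  have "4 * (\<Sum>zs\<in>tuples S n. (T zs - f zs)\<^sup>2) * ((\<Sum>zs\<in>tuples S n. (f zs)\<^sup>2) + (\<Sum>zs\<in>tuples S n. (T zs)\<^sup>2)) \<le> 4 * \<epsilon> * (3 * N + 2)"
    using F T d[OF S] e0 by (intro mult_mono mult_left_mono) (auto intro!: add_nonneg_nonneg sum_nonneg)
  with partial_contraction_perturbation[where S=S and s=s and p="n - s" and T=T and f=f] partial_contraction_le_contraction[OF f s S]
  show "(\<Sum>\<beta>\<in>tuples S s. \<Sum>\<beta>'\<in>tuples S s. (partial_contraction S (n - s) T \<beta> \<beta>')\<^sup>2) \<le>
      2 * (tensor_norm B (2 * s) (contraction B n (n - s) f f))\<^sup>2 + 4 * \<epsilon> * (3 * N + 2)"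
    unfolding n by linarith
qed

text \<open>One quantity that dominates every proper contraction, so that the diagrams need not be
  told apart; the second term is the cost of replacing the kernel by its approximation. For
  \<open>n = 1\<close> the sum is empty.\<close>

definition contraction_defect :: "'h::real_inner set \<Rightarrow> nat \<Rightarrow> real \<Rightarrow> real \<Rightarrow> 'h tensor \<Rightarrow> real" where
  "contraction_defect B n N \<epsilon> f =
    (\<Sum>p\<in>{1..n - 1}. 2 * (tensor_norm B (2 * (n - p)) (contraction B n p f f))\<^sup>2) + 4 * \<epsilon> * (3 * N + 2)"

text \<open>In a diagram whose middle edges are not all absent, the edges between \<open>h1\<close> and \<open>h2\<close> do not
  exhaust both tensors, so at least one of the two contractions is a proper one.\<close>

lemma cross_diagram_bound:
  fixes B :: "'h::real_inner set"
  assumes B: "complete_orthonormal B"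
    and f1: "f1 \<in> symmetric_tensor_power B D1" "(tensor_norm B D1 f1)\<^sup>2 \<le> N"
    and f2: "f2 \<in> symmetric_tensor_power B D2" "(tensor_norm B D2 f2)\<^sup>2 \<le> N"
    and d1: "\<And>S. finite S \<Longrightarrow> S \<subseteq> B \<Longrightarrow> (\<Sum>zs\<in>tuples S D1. (coordinates A1 c1 zs - f1 zs)\<^sup>2) \<le> \<epsilon>"
    and d2: "\<And>S. finite S \<Longrightarrow> S \<subseteq> B \<Longrightarrow> (\<Sum>zs\<in>tuples S D2. (coordinates A2 c2 zs - f2 zs)\<^sup>2) \<le> \<epsilon>"
    and \<epsilon>: "0 \<le> \<epsilon>" "\<epsilon> \<le> 1"
    and a: "1 \<le> a" and e: "a + b + c = D1" "a + d + e = D2" "b + d + f = D1" "c + e + f = D2" "b + c + d + e > 0"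
  shows "\<bar>diagram_value inner A1 c1 A2 c2 a b c d e f\<bar> \<le>
    sqrt ((contraction_defect B D1 N \<epsilon> f1 + contraction_defect B D2 N \<epsilon> f2) * (2 * N + 2)\<^sup>2)"
proof -
  have N0: "0 \<le> N" by (rule order_trans[OF zero_le_power2 f1(2)])
  have le: "a \<le> D1" "a \<le> D2" using e by linarith+
  have cd: "2 * (tensor_norm B (2 * a) (contraction B n (n - a) g g))\<^sup>2 + 4 * \<epsilon> * (3 * N + 2) \<le> contraction_defect B n N \<epsilon> g"
    if "a < n" for n and g :: "'h tensor"
  proof -
    \<comment> \<open>\<open>1 \<le> a < n\<close> says that \<open>n - a\<close> is a proper
      contraction order. The edge drawn in advance rules out the full contraction, whose value is
      the squared norm of \<open>g\<close>.\<close>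
    have "n - (n - a) = a" "n - a \<in> {1..n - 1}" using that a by auto
    then show ?thesis unfolding contraction_defect_def
      using member_le_sum[of "n - a" "{1..n - 1}" "\<lambda>p. 2 * (tensor_norm B (2 * (n - p)) (contraction B n p g g))\<^sup>2"] by simp
  qed
  have cd0: "0 \<le> contraction_defect B n N \<epsilon> g" for n and g :: "'h tensor"
    unfolding contraction_defect_def using \<epsilon> N0 by (intro add_nonneg_nonneg sum_nonneg) auto
  note t1 = partial_contraction_approximation[OF f1 d1 \<epsilon>(2) le(1)]
  note t2 = partial_contraction_approximation[OF f2 d2 \<epsilon>(2) le(2)]
  \<comment> \<open>Either kernel may supply the small factor, while the other one is bounded by
    \<open>(2 * N + 2)\<^sup>2\<close>.\<close>
  have *: "\<bar>diagram_value inner A1 c1 A2 c2 a b c d e f\<bar> \<le> sqrt (R1 * R2)"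
    if "R1 = contraction_defect B D1 N \<epsilon> f1 \<and> a < D1 \<and> R2 = (2 * N + 2)\<^sup>2 \<or> R2 = contraction_defect B D2 N \<epsilon> f2 \<and> a < D2 \<and> R1 = (2 * N + 2)\<^sup>2" for R1 R2
    by (rule diagram_value_le[OF B e(1-4)])
      (use that t1 t2 in \<open>auto intro: order_trans[OF t1(2) cd] order_trans[OF t2(2) cd]\<close>)
  have mono: "sqrt (R1 * R2) \<le> sqrt ((contraction_defect B D1 N \<epsilon> f1 + contraction_defect B D2 N \<epsilon> f2) * (2 * N + 2)\<^sup>2)"
    if "R1 = contraction_defect B D1 N \<epsilon> f1 \<and> R2 = (2 * N + 2)\<^sup>2 \<or> R2 = contraction_defect B D2 N \<epsilon> f2 \<and> R1 = (2 * N + 2)\<^sup>2" for R1 R2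
    using that
  proof
    assume "R1 = contraction_defect B D1 N \<epsilon> f1 \<and> R2 = (2 * N + 2)\<^sup>2"
    then show ?thesis using cd0[of D2 f2] by (auto intro!: real_sqrt_le_mono mult_right_mono)
  next
    assume R: "R2 = contraction_defect B D2 N \<epsilon> f2 \<and> R1 = (2 * N + 2)\<^sup>2"
    then have "R1 * R2 = R2 * (2 * N + 2)\<^sup>2" by simp
    moreover have "R2 * (2 * N + 2)\<^sup>2 \<le> (contraction_defect B D1 N \<epsilon> f1 + contraction_defect B D2 N \<epsilon> f2) * (2 * N + 2)\<^sup>2"
      using R cd0[of D1 f1] by (intro mult_right_mono) auto
    ultimately show ?thesis by (intro real_sqrt_le_mono) linarith
  qed
  have "a < D1 \<or> a < D2" using e by linarith
  then show ?thesis
  proof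
    assume "a < D1"
    then show ?thesis
      by (intro order_trans[OF *[of "contraction_defect B D1 N \<epsilon> f1" "(2 * N + 2)\<^sup>2"] mono]) auto
  next
    assume "a < D2"
    then show ?thesis
      by (intro order_trans[OF *[of "(2 * N + 2)\<^sup>2" "contraction_defect B D2 N \<epsilon> f2"] mono]) auto
  qed
qed

text \<open>The supremum is taken in \<open>ennreal\<close>, where it exists for every set and is 0
  for the empty one. Compactness of \<open>K\<close> enters through a radius \<open>R\<close>, on
  which alone the bound \<open>b l\<close> depends.\<close>

theorem theorem1:
  fixes M :: "'w measure"
    and X :: "'h::{real_inner, banach, polish_space} \<Rightarrow> 'w \<Rightarrow> real"
    and B :: "'h set"
    and I :: "nat \<Rightarrow> 'h tensor \<Rightarrow> 'w \<Rightarrow> real"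
    and d :: "'k::finite \<Rightarrow> nat"
    and f :: "nat \<Rightarrow> 'k \<Rightarrow> 'h tensor"
    and P :: "nat \<Rightarrow> 'v measure"
    and N :: "nat \<Rightarrow> 'k \<Rightarrow> 'v \<Rightarrow> real"
    and \<eta> :: real
    and K :: "(real ^ 'k) set"
  assumes "prob_space M"
    and "isonormal_process M X"
    and "complete_orthonormal B"
    and "\<And>n. n \<ge> 1 \<Longrightarrow> wiener_isometry M X B n (I n)"
    and "\<And>j. d j \<ge> 1"
    and "\<And>l j. l \<ge> 1 \<Longrightarrow> f l j \<in> symmetric_tensor_power B (d j)"
    and "\<eta> > 0"
    and "\<And>l j. l \<ge> 1 \<Longrightarrow> tensor_norm B (d j) (f l j) \<ge> \<eta>"
    and "\<And>j. bounded ((\<lambda>l. LINT w|M. (I (d j) (f l j) w)\<^sup>2) ` {1..})"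
    and "\<And>l. l \<ge> 1 \<Longrightarrow> prob_space (P l)"
    and "\<And>l. l \<ge> 1 \<Longrightarrow> centered_jointly_gaussian (P l) (N l)"
    and "\<And>l i j. l \<ge> 1 \<Longrightarrow>
      (LINT v|P l. N l i v * N l j v) = (LINT w|M. I (d i) (f l i) w * I (d j) (f l j) w)"
    and "\<And>j p. 1 \<le> p \<Longrightarrow> p \<le> d j - 1 \<Longrightarrow>
      (\<lambda>l. tensor_norm B (2 * (d j - p)) (contraction B (d j) p (f l j) (f l j))) \<longlonglongrightarrow> 0"
    and "compact K"
  shows "(\<lambda>l. SUP \<xi>\<in>K. ennreal (cmod
      ((LINT w|M. iexp (\<Sum>j\<in>UNIV. \<xi> $ j * I (d j) (f l j) w)) -
       (LINT v|P l. iexp (\<Sum>j\<in>UNIV. \<xi> $ j * N l j v))))) \<longlonglongrightarrow> 0"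
proof -
  interpret isonormal M X
    using assms(1,2) by (intro isonormal.intro isonormal_axioms.intro)
  note B = assms(3) and W = assms(4) and d = assms(5) and f = assms(6)
  define Y where "Y l j = I (d j) (f l j)" for l j
  define C where "C l i j = (LINT w|M. Y l i w * Y l j w)" for l i j
  have chaos: "Y l j \<in> wiener_chaos M X (d j)" if "l \<ge> 1" for l j
    using W[OF d[of j]] f[OF that, of j] unfolding Y_def wiener_isometry_def by blast
  have mY: "Y l j \<in> borel_measurable M" and iY: "integrable M (\<lambda>w. (Y l j w)\<^sup>2)" if "l \<ge> 1" for l j
    using chaos[OF that, of j] unfolding wiener_chaos_def by blast+

  have "\<exists>K. \<forall>l\<ge>1. (LINT w|M. (Y l j w)\<^sup>2) \<le> K" for j
    using assms(9)[of j] unfolding bounded_iff Y_def by (auto intro: order_trans[OF abs_ge_self])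
  then obtain Kj where Kj: "\<And>j l. l \<ge> 1 \<Longrightarrow> (LINT w|M. (Y l j w)\<^sup>2) \<le> Kj j" by metis
  define Q where "Q = (\<Sum>j\<in>UNIV. \<bar>Kj j\<bar>)"
  have Q: "(LINT w|M. (Y l j w)\<^sup>2) \<le> Q" if "l \<ge> 1" for l j
    using Kj[OF that, of j] member_le_sum[of j UNIV "\<lambda>j. \<bar>Kj j\<bar>"] unfolding Q_def by fastforce
  have Q0: "0 \<le> Q" unfolding Q_def by (intro sum_nonneg) simp
  have tn: "(tensor_norm B (d j) (f l j))\<^sup>2 \<le> Q" if "l \<ge> 1" for l j
  proof -
    have "(LINT w|M. (Y l j w)\<^sup>2) = (sqrt (fact (d j)) * tensor_norm B (d j) (f l j))\<^sup>2"
      using W[OF d[of j]] f[OF that, of j] unfolding Y_def wiener_isometry_def by blast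
    then have "fact (d j) * (tensor_norm B (d j) (f l j))\<^sup>2 \<le> Q" using Q[OF that, of j] by (simp add: power_mult_distrib)
    moreover have "1 * (tensor_norm B (d j) (f l j))\<^sup>2 \<le> fact (d j) * (tensor_norm B (d j) (f l j))\<^sup>2"
      by (intro mult_right_mono fact_ge_1) simp
    ultimately show ?thesis by simp
  qed

  \<comment> \<open>The accuracy is tied to \<open>l\<close>, so that the approximation errors
    vanish in the same limit. \<open>\<epsilon> 0 = 0\<close> by the convention for division by 0,
    hence positivity is claimed for \<open>l \<ge> 1\<close> only.\<close>
  define \<epsilon> where "\<epsilon> l = (1 / real l)\<^sup>2" for l
  have \<epsilon>: "0 \<le> \<epsilon> l" "\<epsilon> l \<le> 1" "sqrt (\<epsilon> l) = 1 / real l" "l \<ge> 1 \<Longrightarrow> 0 < \<epsilon> l" for l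
  proof -
    have "1 / real l \<le> 1" by (cases "l = 0") auto
    then show "\<epsilon> l \<le> 1" unfolding \<epsilon>_def by (intro power_le_one) auto
  qed (auto simp: \<epsilon>_def)
  \<comment> \<open>\<open>A\<close> and \<open>c\<close> are taken from one choice of a pair, so
    that all properties refer to the same Hermite sum.\<close>
  define good where "good l j Z \<longleftrightarrow> finite (fst Z) \<and> (\<forall>h\<in>fst Z. norm h = 1) \<and>
      (LINT w|M. (Y l j w - hermite_sum (d j) (fst Z) (snd Z) w)\<^sup>2) \<le> \<epsilon> l \<and>
      (\<forall>S. finite S \<longrightarrow> S \<subseteq> B \<longrightarrow> (\<Sum>zs\<in>tuples S (d j). (coordinates (fst Z) (snd Z) zs - f l j zs)\<^sup>2) \<le> \<epsilon> l)"
    for l j and Z :: "'h set \<times> ('h \<Rightarrow> real)"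
  define A where "A l j = fst (SOME Z. good l j Z)" for l j
  define c where "c l j = snd (SOME Z. good l j Z)" for l j
  have "good l j (A l j, c l j)" if l: "l \<ge> 1" for l j
  proof -
    obtain A' c' where "finite A'" "\<And>h. h \<in> A' \<Longrightarrow> norm h = 1"
      "(LINT w|M. (I (d j) (f l j) w - hermite_sum (d j) A' c' w)\<^sup>2) \<le> \<epsilon> l"
      "\<And>S. finite S \<Longrightarrow> S \<subseteq> B \<Longrightarrow> (\<Sum>zs\<in>tuples S (d j). (coordinates A' c' zs - f l j zs)\<^sup>2) \<le> \<epsilon> l"
      by (rule chaos_approximation[OF B W[OF d[of j]] f[OF l, of j] \<epsilon>(4)[OF l]]) blast
    then have "good l j (A', c')" unfolding good_def Y_def by simp
    then show ?thesis unfolding A_def c_def by (simp add: someI[of "good l j"])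
  qed
  then have A: "\<And>l j. l \<ge> 1 \<Longrightarrow> finite (A l j)" "\<And>l j h. l \<ge> 1 \<Longrightarrow> h \<in> A l j \<Longrightarrow> norm h = 1"
    and ap: "\<And>l j. l \<ge> 1 \<Longrightarrow> (LINT w|M. (Y l j w - hermite_sum (d j) (A l j) (c l j) w)\<^sup>2) \<le> \<epsilon> l"
    and co: "\<And>l j S. l \<ge> 1 \<Longrightarrow> finite S \<Longrightarrow> S \<subseteq> B \<Longrightarrow> (\<Sum>zs\<in>tuples S (d j). (coordinates (A l j) (c l j) zs - f l j zs)\<^sup>2) \<le> \<epsilon> l"
    unfolding good_def fst_conv snd_conv by blast+
  define F where "F l j = hermite_sum (d j) (A l j) (c l j)" for l j
  define G where "G l i j = malliavin_product (d i) (A l i) (c l i) (d j) (A l j) (c l j)" for l i j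
  define C' where "C' l i j = (LINT w|M. F l i w * F l j w)" for l i j
  have amF: "all_moments M (F l j)" for l j unfolding F_def by (rule all_moments_hermite_sum)
  have mF: "F l j \<in> borel_measurable M" and iF: "integrable M (\<lambda>w. (F l j w)\<^sup>2)" for l j
    by (rule all_moments_measurable[OF amF], rule all_moments_integrable[OF all_moments_power[OF amF]])

  \<comment> \<open>\<open>\<delta>\<close> bounds every crossing diagram; \<open>w\<close> collects
    the combinatorial factors and does not depend on \<open>l\<close>.\<close>
  define \<delta> where "\<delta> l i j = sqrt ((contraction_defect B (d i) Q (\<epsilon> l) (f l i) + contraction_defect B (d j) Q (\<epsilon> l) (f l j)) * (2 * Q + 2)\<^sup>2)" for l i j
  define w where "w i j = (real (d j))\<^sup>2 * diagram_sum (\<lambda>_ _ _ _ _ _. 1) (d i - 1) (d j - 1) (d i - 1) (d j - 1)" for i j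
  have cd0: "0 \<le> contraction_defect B n Q (\<epsilon> l) g" for n l g
    unfolding contraction_defect_def using \<epsilon>(1) Q0 by (intro add_nonneg_nonneg sum_nonneg) auto
  have var: "(LINT v|M. (G l i j v - C' l i j)\<^sup>2) \<le> w i j * \<delta> l i j" if l: "l \<ge> 1" for l i j
    unfolding G_def C'_def F_def w_def
  proof (rule variance_malliavin_product[OF d d A(2)[OF l] A(2)[OF l]])
    show "0 \<le> \<delta> l i j" unfolding \<delta>_def using cd0 by simp
    show "\<bar>diagram_value inner (A l i) (c l i) (A l j) (c l j) a b c' d' e f'\<bar> \<le> \<delta> l i j"
      if "1 \<le> a" "a + b + c' = d i" "a + d' + e = d j" "b + d' + f' = d i" "c' + e + f' = d j" "0 < b + c' + d' + e" for a b c' d' e f'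
      unfolding \<delta>_def
      by (rule cross_diagram_bound[OF B f[OF l] tn[OF l] f[OF l] tn[OF l] co[OF l] co[OF l] \<epsilon>(1,2) that])
  qed
  have cov: "\<bar>C l i j - C' l i j\<bar> \<le> 1 / real l * (sqrt Q + sqrt (2 * Q + 2))" if l: "l \<ge> 1" for l i j
    unfolding C_def C'_def \<epsilon>(3)[symmetric]
    by (rule second_moment_perturbation[OF mY[OF l] iY[OF l] mY[OF l] iY[OF l] mF iF mF iF _ _ \<epsilon>(2) Q[OF l] Q[OF l]])
      (unfold F_def, (rule ap[OF l])+)

  obtain R where R: "\<And>\<xi>. \<xi> \<in> K \<Longrightarrow> norm \<xi> \<le> R" "R \<ge> 0"
    using compact_imp_bounded[OF assms(14)] unfolding bounded_pos by (metis less_imp_le)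
  \<comment> \<open>The three terms: replacing the integrals by Hermite sums, the Stein bound for
    these sums, and the change of the covariance matrix in the Gaussian characteristic
    function.\<close>
  define b where "b l = (\<Sum>j\<in>(UNIV :: 'k set). R * (1 / real l)) +
    2 * (\<Sum>i\<in>UNIV. \<Sum>j\<in>UNIV. R * R * sqrt (w i j * \<delta> l i j)) +
    (\<Sum>i\<in>(UNIV :: 'k set). \<Sum>j\<in>(UNIV :: 'k set). R * R * (1 / real l * (sqrt Q + sqrt (2 * Q + 2))))" for l
  have main: "cmod ((LINT w|M. iexp (\<Sum>j\<in>UNIV. \<xi> $ j * Y l j w)) - (LINT v|P l. iexp (\<Sum>j\<in>UNIV. \<xi> $ j * N l j v))) \<le> b l"
    if l: "l \<ge> 1" and \<xi>: "\<xi> \<in> K" for l \<xi>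
  proof -
    interpret PN: gaussian_family "P l" "N l"
      using assms(10,11)[OF l] by (intro gaussian_family.intro gaussian_family_axioms.intro)
    have r: "\<bar>\<xi> $ j\<bar> \<le> R" for j using component_le_norm_cart[of \<xi> j] R(1)[OF \<xi>] by linarith
    have rr: "\<bar>\<xi> $ i\<bar> * \<bar>\<xi> $ j\<bar> \<le> R * R" for i j using r R(2) by (intro mult_mono) auto
    define v where "v = (\<Sum>i\<in>UNIV. \<Sum>j\<in>UNIV. \<xi> $ i * \<xi> $ j * C l i j)"
    define v' where "v' = (\<Sum>i\<in>UNIV. \<Sum>j\<in>UNIV. \<xi> $ i * \<xi> $ j * C' l i j)"
    have CN: "(LINT v|P l. N l i v * N l j v) = C l i j" for i j
      using assms(12)[OF l] unfolding C_def Y_def .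
    \<comment> \<open>Both quadratic forms are second moments; their nonnegativity puts them in the
      range where \<open>exp (- x / 2)\<close> is Lipschitz with constant 1.\<close>
    have v0: "0 \<le> v"
    proof -
      have "v = (LINT v|P l. (\<Sum>i\<in>UNIV. \<xi> $ i * N l i v)\<^sup>2)"
        unfolding v_def PN.second_moment_combination CN ..
      then show ?thesis by simp
    qed
    have v'0: "0 \<le> v'"
    proof -
      have "v' = (LINT v|M. (\<Sum>i\<in>UNIV. \<xi> $ i * F l i v)\<^sup>2)"
        unfolding v'_def C'_def by (rule second_moment_linear_combination[symmetric]) (rule amF)
      then show ?thesis by simp
    qed
    have eN: "(LINT v|P l. iexp (\<Sum>j\<in>UNIV. \<xi> $ j * N l j v)) = complex_of_real (exp (- v / 2))"
      using PN.expectation_iexp_combination[of UNIV "\<lambda>j. \<xi> $ j"] unfolding CN v_def by simp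
    have s1: "cmod ((LINT w|M. iexp (\<Sum>j\<in>UNIV. \<xi> $ j * Y l j w)) - (LINT w|M. iexp (\<Sum>j\<in>UNIV. \<xi> $ j * F l j w))) \<le>
        (\<Sum>j\<in>(UNIV :: 'k set). R * (1 / real l))"
    proof -
      have dm: "(\<lambda>w. Y l j w - F l j w) \<in> borel_measurable M" for j by (intro borel_measurable_diff mY[OF l] mF)
      have d2: "integrable M (\<lambda>w. (Y l j w - F l j w)\<^sup>2)" for j
        using square_integrable_sum[OF mY[OF l] iY[OF l] mF iF, of 1 j "- 1" l j] by simp
      note e = expectation_abs_le[OF dm d2]
      have eq: "(\<Sum>j\<in>UNIV. \<xi> $ j * Y l j w) - (\<Sum>j\<in>UNIV. \<xi> $ j * F l j w) = (\<Sum>j\<in>UNIV. \<xi> $ j * (Y l j w - F l j w))" for w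
        by (simp add: sum_subtractf right_diff_distrib)
      have "cmod ((LINT w|M. iexp (\<Sum>j\<in>UNIV. \<xi> $ j * Y l j w)) - (LINT w|M. iexp (\<Sum>j\<in>UNIV. \<xi> $ j * F l j w))) \<le>
          (LINT w|M. \<bar>(\<Sum>j\<in>UNIV. \<xi> $ j * Y l j w) - (\<Sum>j\<in>UNIV. \<xi> $ j * F l j w)\<bar>)"
      proof (rule norm_expectation_iexp_diff_le)
        show "integrable M (\<lambda>w. (\<Sum>j\<in>UNIV. \<xi> $ j * Y l j w) - (\<Sum>j\<in>UNIV. \<xi> $ j * F l j w))"
          unfolding eq by (intro Bochner_Integration.integrable_sum integrable_mult_right e)
      qed (intro borel_measurable_sum borel_measurable_times borel_measurable_const mY[OF l] mF)+
      also have "\<dots> \<le> (LINT w|M. (\<Sum>j\<in>UNIV. \<bar>\<xi> $ j\<bar> * \<bar>Y l j w - F l j w\<bar>))"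
        unfolding eq
      proof (rule integral_mono)
        show "\<bar>\<Sum>j\<in>UNIV. \<xi> $ j * (Y l j w - F l j w)\<bar> \<le> (\<Sum>j\<in>UNIV. \<bar>\<xi> $ j\<bar> * \<bar>Y l j w - F l j w\<bar>)" for w
          unfolding abs_mult[symmetric] by (rule sum_abs)
      qed (intro integrable_abs Bochner_Integration.integrable_sum integrable_mult_right e)+
      also have "\<dots> = (\<Sum>j\<in>UNIV. \<bar>\<xi> $ j\<bar> * (LINT w|M. \<bar>Y l j w - F l j w\<bar>))"
        using e(1) by simp
      also have "\<dots> \<le> (\<Sum>j\<in>(UNIV :: 'k set). R * (1 / real l))"
      proof (intro sum_mono mult_mono r R(2))
        fix j
        show "(LINT w|M. \<bar>Y l j w - F l j w\<bar>) \<le> 1 / real l"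
          unfolding \<epsilon>(3)[symmetric] F_def
          by (rule order_trans[OF e(2)[unfolded F_def] real_sqrt_le_mono[OF ap[OF l]]])
      qed simp
      finally show ?thesis .
    qed
    have s2: "cmod ((LINT w|M. iexp (\<Sum>j\<in>UNIV. \<xi> $ j * F l j w)) - complex_of_real (exp (- v' / 2))) \<le>
        2 * (\<Sum>i\<in>UNIV. \<Sum>j\<in>UNIV. R * R * sqrt (w i j * \<delta> l i j))"
    proof -
      have "cmod ((LINT w|M. iexp (\<Sum>j\<in>UNIV. \<xi> $ j * F l j w)) - complex_of_real (exp (- v' / 2))) \<le>
          2 * (\<Sum>i\<in>UNIV. \<Sum>j\<in>UNIV. \<bar>\<xi> $ i\<bar> * \<bar>\<xi> $ j\<bar> * sqrt (LINT w|M. (G l i j w - C' l i j)\<^sup>2))"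
        unfolding v'_def C'_def F_def G_def
        by (rule char_hermite_sum_bound) (use d A l in auto)
      also have "\<dots> \<le> 2 * (\<Sum>i\<in>UNIV. \<Sum>j\<in>UNIV. R * R * sqrt (w i j * \<delta> l i j))"
        by (intro mult_left_mono sum_mono mult_mono rr real_sqrt_le_mono var[OF l]) (use R(2) in auto)
      finally show ?thesis .
    qed
    have s3: "cmod (complex_of_real (exp (- v' / 2)) - complex_of_real (exp (- v / 2))) \<le>
        (\<Sum>i\<in>(UNIV :: 'k set). \<Sum>j\<in>(UNIV :: 'k set). R * R * (1 / real l * (sqrt Q + sqrt (2 * Q + 2))))"
    proof -
      have "cmod (complex_of_real (exp (- v' / 2)) - complex_of_real (exp (- v / 2))) \<le> \<bar>v' - v\<bar>"
        unfolding of_real_diff[symmetric] norm_of_real by (rule abs_exp_minus_diff_le[OF v'0 v0])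
      also have "\<bar>v' - v\<bar> = \<bar>v - v'\<bar>" by simp
      also have "v - v' = (\<Sum>i\<in>UNIV. \<Sum>j\<in>UNIV. \<xi> $ i * \<xi> $ j * (C l i j - C' l i j))"
        unfolding v_def v'_def by (simp add: right_diff_distrib sum_subtractf)
      also have "\<bar>\<dots>\<bar> \<le> (\<Sum>i\<in>UNIV. \<Sum>j\<in>UNIV. \<bar>\<xi> $ i * \<xi> $ j * (C l i j - C' l i j)\<bar>)"
        by (rule order_trans[OF sum_abs sum_mono[OF sum_abs]])
      also have "\<dots> \<le> (\<Sum>i\<in>(UNIV :: 'k set). \<Sum>j\<in>(UNIV :: 'k set). R * R * (1 / real l * (sqrt Q + sqrt (2 * Q + 2))))"
        unfolding abs_mult by (intro sum_mono mult_mono rr cov[OF l]) (use R(2) in auto)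
      finally show ?thesis .
    qed
    have tri: "cmod (a - z) \<le> x1 + x2 + x3" if "cmod (a - b) \<le> x1" "cmod (b - c) \<le> x2" "cmod (c - z) \<le> x3" for a b c z x1 x2 x3
      using that norm_triangle_ineq[of "a - b" "(b - c) + (c - z)"] norm_triangle_ineq[of "b - c" "c - z"] by simp
    show ?thesis unfolding eN b_def by (rule tri[OF s1 s2 s3])
  qed

  have cd: "(\<lambda>l. contraction_defect B (d j) Q (\<epsilon> l) (f l j)) \<longlonglongrightarrow> 0" for j
  proof -
    have "(\<lambda>l. 1 / real l) \<longlonglongrightarrow> 0" by (rule lim_1_over_n)
    then have "(\<lambda>l. \<epsilon> l) \<longlonglongrightarrow> 0\<^sup>2" unfolding \<epsilon>_def by (intro tendsto_power)
    \<comment> \<open>The hypothesis on the contractions enters here, for every \<open>p\<close>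
      from 1 to \<open>d j - 1\<close>.\<close>
    then have "(\<lambda>l. contraction_defect B (d j) Q (\<epsilon> l) (f l j)) \<longlonglongrightarrow> (\<Sum>p\<in>{1..d j - 1}. 2 * 0\<^sup>2) + 4 * 0\<^sup>2 * (3 * Q + 2)"
      unfolding contraction_defect_def by (intro tendsto_intros assms(13)) auto
    then show ?thesis by simp
  qed
  have "(\<lambda>l. \<delta> l i j) \<longlonglongrightarrow> sqrt ((0 + 0) * (2 * Q + 2)\<^sup>2)" for i j
    unfolding \<delta>_def by (intro tendsto_intros cd)
  then have \<delta>: "(\<lambda>l. \<delta> l i j) \<longlonglongrightarrow> 0" for i j by simp
  have "b \<longlonglongrightarrow> (\<Sum>j\<in>(UNIV :: 'k set). R * 0) + 2 * (\<Sum>i\<in>UNIV. \<Sum>j\<in>UNIV. R * R * sqrt (w i j * 0)) +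
      (\<Sum>i\<in>(UNIV :: 'k set). \<Sum>j\<in>(UNIV :: 'k set). R * R * (0 * (sqrt Q + sqrt (2 * Q + 2))))"
    unfolding b_def by (intro tendsto_intros lim_1_over_n \<delta>)
  then have "b \<longlonglongrightarrow> 0" by simp
  then have eb: "(\<lambda>l. ennreal (b l)) \<longlonglongrightarrow> 0" using tendsto_ennrealI by fastforce
  show ?thesis
  proof (rule tendsto_sandwich[OF _ _ tendsto_const eb])
    show "\<forall>\<^sub>F l in sequentially. (SUP \<xi>\<in>K. ennreal (cmod
      ((LINT w|M. iexp (\<Sum>j\<in>UNIV. \<xi> $ j * I (d j) (f l j) w)) -
       (LINT v|P l. iexp (\<Sum>j\<in>UNIV. \<xi> $ j * N l j v))))) \<le> ennreal (b l)"
      by (rule eventually_sequentiallyI[of 1]) (intro SUP_least ennreal_leI main[unfolded Y_def])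
  qed simp
qed

end
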